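(* Let $\mathbf{w}\in\{0,1,2\}^\omega$ be an infinite word with factor complexity $2n+1$, i.e. for every $n\ge 0$ the number of distinct factors of $\mathbf{w}$ of length $n$ is exactly $2n+1$. Then the critical exponent of $\mathbf{w}$ is at least $\mu=2+\frac{1}{\lambda^2-1}=2.4808726\cdots$, where $\lambda\approx 1.7548777$ is the real zero of $x^3-2x^2+x-1$.
   Context: For a finite nonempty word $x$ with smallest period $p$, its exponent is $|x|/p$. The critical exponent of an infinite word is the supremum of the exponents of its finite nonempty factors. (The number $\mu$ is the critical exponent of the fixed point $\gamma^\omega(0)$ of the morphism $\gamma:0\mapsto 01,\ 1\mapsto 2,\ 2\mapsto 02$.)
   Formalization: The printed decimal 2.4808726 has transposed digits: the closed form 2+1/(λ²−1) with λ≈1.7548777 equals 2.4808627…, and the theorem is stated and proved for the closed form. *)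

theory Defs
  imports "HOL-Library.Extended_Real" "HOL-Library.Omega_Words_Fun"
begin

definition factors :: "'a word \<Rightarrow> 'a list set" where
  "factors w = {w [i \<rightarrow> j] | i j. i \<le> j}"

definition factor_complexity :: "'a word \<Rightarrow> nat \<Rightarrow> nat" where
  "factor_complexity w n = card {x \<in> factors w. length x = n}"

definition is_period :: "nat \<Rightarrow> 'a list \<Rightarrow> bool" where
  "is_period p x \<longleftrightarrow> 1 \<le> p \<and> p \<le> length x \<and> (\<forall>i. i + p < length x \<longrightarrow> x ! i = x ! (i + p))"

definition smallest_period :: "'a list \<Rightarrow> nat" where
  "smallest_period x = (LEAST p. is_period p x)"

definition exponent :: "'a list \<Rightarrow> real" where
  "exponent x = real (length x) / real (smallest_period x)"

(* The supremum may be infinite, hence the type ereal. *)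
definition critical_exponent :: "'a word \<Rightarrow> ereal" where
  "critical_exponent w = (SUP x \<in> factors w - {[]}. ereal (exponent x))"

definition lambda :: real where
  "lambda = (THE x. x ^ 3 - 2 * x ^ 2 + x - 1 = 0)"

definition mu :: real where
  "mu = 2 + 1 / (lambda ^ 2 - 1)"

lemma smallest_period_is_period:
  assumes "x \<noteq> []"
  shows "is_period (smallest_period x) x"
proof -
  have "is_period (length x) x"
    using assms by (cases x) (auto simp: is_period_def)
  then show ?thesis
    unfolding smallest_period_def by (rule LeastI)
qed

lemma cubic_strict_mono:
  fixes x y :: real
  assumes "1 \<le> x" "x < y"
  shows "x ^ 3 - 2 * x ^ 2 + x - 1 < y ^ 3 - 2 * y ^ 2 + y - 1"
proof -
  have "x * (x - 1) ^ 2 < y * (y - 1) ^ 2"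
    using assms by (intro mult_strict_mono power_strict_mono) auto
  then show ?thesis
    by (simp add: power2_eq_square power3_eq_cube algebra_simps)
qed

lemma cubic_root_gt_1:
  fixes x :: real
  assumes "x ^ 3 - 2 * x ^ 2 + x - 1 = 0"
  shows "1 < x"
proof (rule ccontr)
  assume "\<not> 1 < x"
  then have x: "x \<le> 1" by simp
  have eq: "x * (x - 1) ^ 2 = 1"
    using assms by (simp add: power2_eq_square power3_eq_cube algebra_simps)
  show False
  proof (cases "x \<le> 0")
    case True
    then have "x * (x - 1) ^ 2 \<le> 0" by (simp add: mult_nonpos_nonneg)
    then show False using eq by simp
  next
    case False
    then have "(1 - x) ^ 2 < 1" using x by (simp add: power_less_one_iff abs_square_less_1)
    then have "(x - 1) ^ 2 < 1" by (simp add: power2_commute)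
    then have "x * (x - 1) ^ 2 < 1" using False x
      by (smt (verit) mult_left_le_one_le zero_le_power2)
    then show False using eq by simp
  qed
qed

lemma cubic_root_between:
  "\<exists>x::real. 1.75487766 \<le> x \<and> x \<le> 1.75487767 \<and> x ^ 3 - 2 * x ^ 2 + x - 1 = 0"
  by (rule IVT') (auto intro!: continuous_intros simp: power2_eq_square power3_eq_cube)

lemma cubic_root_unique: "\<exists>!x::real. x ^ 3 - 2 * x ^ 2 + x - 1 = 0"
proof -
  obtain r :: real where r: "r ^ 3 - 2 * r ^ 2 + r - 1 = 0"
    using cubic_root_between by blast
  have "x = y" if "x ^ 3 - 2 * x ^ 2 + x - 1 = 0" "y ^ 3 - 2 * y ^ 2 + y - 1 = 0" for x y :: real
    using cubic_strict_mono[of x y] cubic_strict_mono[of y x]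
      cubic_root_gt_1[OF that(1)] cubic_root_gt_1[OF that(2)] that
    by (cases x y rule: linorder_cases) auto
  with r show ?thesis by blast
qed

lemma lambda_root: "lambda ^ 3 - 2 * lambda ^ 2 + lambda - 1 = 0"
  unfolding lambda_def by (rule theI'[OF cubic_root_unique])

lemma lambda_bounds: "1.75487766 \<le> lambda" "lambda \<le> 1.75487767"
  using cubic_root_between cubic_root_unique lambda_root by blast+

lemma mu_bounds: "2.4808627 < mu" "mu < 2.4808628"
proof -
  have lo: "1.75487766 * 1.75487766 \<le> lambda ^ 2"
    unfolding power2_eq_square using lambda_bounds by (intro mult_mono) auto
  have hi: "lambda ^ 2 \<le> 1.75487767 * 1.75487767"
    unfolding power2_eq_square using lambda_bounds by (intro mult_mono) auto
  show "2.4808627 < mu" "mu < 2.4808628"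
    using lo hi unfolding mu_def by (simp_all add: field_simps)
qed

end

theory Submission
  imports Defs "HOL-Library.Sublist"
begin

text \<open>
  Suppose the critical exponent is below \<open>mu\<close>, hence below \<open>5/2\<close>. The factors occurring infinitely
  often in the word form a factorial, two-sidedly extendable language \<open>L\<close> with
  \<open>|L\<^sub>n\<^sub>+\<^sub>1| \<le> |L\<^sub>n| + 2\<close> and without factors of exponent at least \<open>5/2\<close>. A finite search over the
  possible sets \<open>L\<^sub>n\<close> with \<open>n \<le> 11\<close> shows that, up to renaming of letters and reversal, \<open>L\<close> is obtained by
  decoding return words to a short word \<open>v\<close> from a language over the same alphabet that avoids
  \<open>00, 11, 22, 21, 101\<close>. Such a language is the image under \<open>gamma : 0 \<rightarrow> 01, 1 \<rightarrow> 2, 2 \<rightarrow> 02\<close> of a language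
  that again avoids these words, since otherwise \<open>02020\<close> or \<open>20120120\<close> would yield a factor of
  exponent at least \<open>5/2\<close> in \<open>L\<close>. Iterating, \<open>L\<close> contains the images \<open>F\<^sub>k(2020)\<close> of \<open>2020\<close> under all
  decodings \<open>F\<^sub>k = F \<circ> gamma\<^sup>2\<^sup>k\<close>, and these repetitions extend on both sides by a total length of
  \<open>\<Sum>j<k. |F\<^sub>j(20)|\<close>. As \<open>|F\<^sub>k(20)|\<close> grows like \<open>lambda\<^sup>2\<^sup>k\<close>, their exponents tend to
  \<open>2 + 1 / (lambda\<^sup>2 - 1)\<close>.
\<close>

section \<open>Extendable languages and the substitution gamma\<close>

text \<open>\<open>lambda\<close> is the dominant eigenvalue of the incidence matrix of
  \<open>gamma\<close>, whose characteristic polynomial is x^3 - 2x^2 + x - 1, and 1 / (lambda^2 -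
  1) is the sum of the powers lambda^(-2i) with i \<ge> 1. So \<open>mu\<close> is only a limit, out
  of reach of a finite search. The search therefore has a weaker aim: from the cruder bound 5/2 on
  exponents and the bound on the number of factors it forces self-similarity. The exact value of
  \<open>mu\<close> enters only when the growth of the images of 2020 is compared with the growth of
  their contexts. Languages replace the word because a one-sided infinite word has no reversal and
  its prefixes need not extend to the left, whereas recurrent factors extend on both sides and can
  be reversed. The substitution is applied in pairs because the images under \<open>gamma\<close>
  share neither a first nor a last letter, while those under its square all begin with 0 and end
  with 2. Each double step thus lengthens both contexts of a repetition by a known image.\<close>

text \<open>The letters \<open>0, 1, 2\<close> are written \<open>A, B, C\<close>.\<close>

datatype letter = A | B | C

definition lang :: "letter list set \<Rightarrow> bool" where
  "lang L \<longleftrightarrow> [] \<in> L \<and> (\<forall>x\<in>L. \<forall>y. sublist y x \<longrightarrow> y \<in> L)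
     \<and> (\<forall>x\<in>L. \<exists>l. x @ [l] \<in> L) \<and> (\<forall>x\<in>L. \<exists>l. l # x \<in> L)"

lemma lang_Nil: "lang L \<Longrightarrow> [] \<in> L"
  by (simp add: lang_def)

lemma lang_sublist: "lang L \<Longrightarrow> x \<in> L \<Longrightarrow> sublist y x \<Longrightarrow> y \<in> L"
  by (auto simp: lang_def)

lemma lang_factor: "lang L \<Longrightarrow> x @ y @ z \<in> L \<Longrightarrow> y \<in> L"
  by (rule lang_sublist) auto

lemma lang_right: "lang L \<Longrightarrow> x \<in> L \<Longrightarrow> \<exists>l. x @ [l] \<in> L"
  by (auto simp: lang_def)

lemma lang_left: "lang L \<Longrightarrow> x \<in> L \<Longrightarrow> \<exists>l. l # x \<in> L"
  by (auto simp: lang_def)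

text \<open>Position i < |R| of \<open>P @ R\<close> lies in the copy of \<open>R\<close> at the
  beginning, and position i + |P| is the same position in the copy of \<open>R\<close> that follows
  \<open>P\<close>.\<close>

lemma is_period_if_prefix:
  assumes "P \<noteq> []" "prefix R (P @ R)"
  shows "is_period (length P) (P @ R)"
proof -
  obtain T where T: "P @ R = R @ T"
    using assms(2) by (auto simp: prefix_def)
  have "(P @ R) ! i = (P @ R) ! (i + length P)" if "i < length R" for i
  proof -
    have "(P @ R) ! i = R ! i"
      using that by (simp add: T nth_append)
    then show ?thesis
      by (metis add.commute nth_append_length_plus)
  qed
  then show ?thesis
    using assms(1) by (auto simp: is_period_def Suc_le_eq)
qed

abbreviation hom :: "('a \<Rightarrow> 'b list) \<Rightarrow> 'a list \<Rightarrow> 'b list" where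
  "hom f u \<equiv> concat (map f u)"

lemma hom_hom: "hom f (hom g u) = hom (\<lambda>l. hom f (g l)) u"
  by (induction u) auto

text \<open>Since \<open>V\<close> begins whatever remains of a decoded word, decoded words can be
  cut on the right while keeping the context \<open>V\<close>.\<close>

lemma prefix_hom_append:
  assumes "\<And>l. prefix V (F l @ V)"
  shows "prefix V (hom F u @ V)"
proof (induction u)
  case (Cons l u)
  have "prefix (F l @ V) (F l @ hom F u @ V)"
    using Cons by simp
  then show ?case
    using assms[of l] prefix_order.trans by fastforce
qed simp

lemma suffix_append_hom:
  assumes "\<And>l. suffix U (U @ F l)"
  shows "suffix U (U @ hom F u)"
proof (induction u rule: rev_induct)
  case (snoc l u)
  have "suffix (U @ F l) (U @ hom F u @ F l)"
    using snoc by (metis append.assoc suffix_def)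
  then show ?case
    using assms[of l] suffix_order.trans by fastforce
qed simp

section \<open>The substitution and its inverse on languages\<close>

fun gamma :: "letter \<Rightarrow> letter list" where
  "gamma A = [A, B]"
| "gamma B = [C]"
| "gamma C = [A, C]"

text \<open>Without AA, BB and CB, words split into the blocks AB, AC and C and can be decoded by
  \<open>gamma\<close>. Excluding CC and BAB makes the decoded words avoid BB, CB and AA
  again.\<close>

definition core :: "letter list set \<Rightarrow> bool" where
  "core L \<longleftrightarrow> lang L \<and> [A, A] \<notin> L \<and> [B, B] \<notin> L \<and> [C, C] \<notin> L \<and> [C, B] \<notin> L \<and> [B, A, B] \<notin> L"

lemma core_lang: "core L \<Longrightarrow> lang L"
  by (simp add: core_def)

lemma core_pairs:
  assumes "core L" "x @ [a, b] @ y \<in> L"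
  shows "(a, b) \<in> {(A, B), (A, C), (B, A), (B, C), (C, A)}"
proof -
  have "[a, b] \<in> L"
    using assms lang_factor core_lang by blast
  then show ?thesis
    using assms(1) by (cases a; cases b) (auto simp: core_def)
qed

text \<open>The letter \<open>l\<close> precedes \<open>u\<close> because a leading \<open>C\<close> may be the end of the block
  \<open>[A, C]\<close> instead of \<open>gamma B\<close>.\<close>

definition desub :: "letter list set \<Rightarrow> letter list set" where
  "desub L = {u. \<exists>l. hom gamma (l # u) \<in> L}"

lemma desub_gamma: "lang L \<Longrightarrow> u \<in> desub L \<Longrightarrow> hom gamma u \<in> L"
  by (auto simp: desub_def intro: lang_factor[of _ _ _ "[]"])

text \<open>Blocks end in B or C. Only A can precede B, so the letter after a complete block always
  starts a new block.\<close>

lemma last_gamma: "hom gamma (l # u) \<noteq> []" "last (hom gamma (l # u)) \<noteq> A"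
proof (induction u arbitrary: l)
  case Nil
  {
    case 1
    show ?case by (cases l) auto
  next
    case 2
    show ?case by (cases l) auto
  }
next
  case (Cons k u)
  {
    case 1
    show ?case by (cases l) auto
  next
    case 2
    show ?case using Cons[of k] by (cases l) auto
  }
qed

text \<open>To the right, a block is determined by its first one or two letters. To the left, a
  letter C is either \<open>gamma B\<close> or the end of \<open>gamma C\<close>, and the letter
  before it decides which.\<close>

lemma desub_lang:
  assumes "core L"
  shows "lang (desub L)"
proof -
  note L = core_lang[OF assms]
  have right: "\<exists>l. x @ [l] \<in> desub L" if x: "x \<in> desub L" for x
  proof -
    obtain k where k: "hom gamma (k # x) \<in> L"
      using x by (auto simp: desub_def)
    obtain y d where yd: "hom gamma (k # x) = y @ [d]" "d \<noteq> A"
      using last_gamma by (metis append_butlast_last_id)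
    obtain e where e: "hom gamma (k # x) @ [e] \<in> L"
      using lang_right[OF L k] by blast
    have "y @ [d, e] @ [] \<in> L"
      using e unfolding yd(1) by simp
    from core_pairs[OF assms this] have "e \<noteq> B"
      using yd(2) by auto
    show ?thesis
    proof (cases e)
      case A
      obtain e' where e': "(hom gamma (k # x) @ [A]) @ [e'] \<in> L"
        using lang_right[OF L] e A by blast
      then have "e' = B \<or> e' = C"
        using core_pairs[OF assms, of "hom gamma (k # x)" A e' "[]"] by auto
      then have "hom gamma (k # x @ [A]) \<in> L \<or> hom gamma (k # x @ [C]) \<in> L"
        using e' by auto
      then show ?thesis
        by (auto simp only: desub_def)
    next
      case C
      then have "hom gamma (k # x @ [B]) \<in> L"
        using e by simp
      then show ?thesis
        by (auto simp only: desub_def)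
    qed (use \<open>e \<noteq> B\<close> in auto)
  qed
  \<comment> \<open>In front of A a block ends: B completes AB, and C is read provisionally as
    \<open>gamma B\<close>, which the undecided letter in \<open>desub\<close> permits.\<close>
  have leftA: "\<exists>k. hom gamma (k # y) \<in> L" if y: "hom gamma y \<in> L" "hom gamma y = A # z" for y z
  proof -
    obtain e where e: "e # A # z \<in> L"
      using lang_left[OF L y(1)] y(2) by auto
    have "e = B \<or> e = C"
      using core_pairs[OF assms, of "[]" e A z] e by auto
    then show ?thesis
    proof
      assume "e = B"
      obtain e' where e': "e' # B # A # z \<in> L"
        using lang_left[OF L e] \<open>e = B\<close> by auto
      then have "e' = A"
        using core_pairs[OF assms, of "[]" e' B "A # z"] by auto
      then have "hom gamma (A # y) \<in> L"
        using e' y(2) by simp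
      then show ?thesis ..
    next
      assume "e = C"
      then have "hom gamma (B # y) \<in> L"
        using e y(2) by simp
      then show ?thesis ..
    qed
  qed
  have left: "\<exists>l. l # x \<in> desub L" if x: "x \<in> desub L" for x
  proof -
    obtain k where k: "hom gamma (k # x) \<in> L"
      using x by (auto simp: desub_def)
    show ?thesis
    proof (cases k)
      \<comment> \<open>The provisional C is resolved here: after A it belongs to the block AC,
        after B it is a block of its own preceded by AB.\<close>
      case B
      obtain e where e: "e # C # hom gamma x \<in> L"
        using lang_left[OF L k] B by auto
      then have "e = A \<or> e = B"
        using core_pairs[OF assms, of "[]" e C "hom gamma x"] by auto
      then show ?thesis
      proof
        assume "e = A"
        then have "\<exists>k. hom gamma (k # C # x) \<in> L"
          using e by (intro leftA[of _ "C # hom gamma x"]) auto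
        then show ?thesis
          by (auto simp only: desub_def)
      next
        assume "e = B"
        obtain e' where e': "e' # B # C # hom gamma x \<in> L"
          using lang_left[OF L e] \<open>e = B\<close> by auto
        then have "e' = A"
          using core_pairs[OF assms, of "[]" e' B "C # hom gamma x"] by auto
        then have "hom gamma (A # B # x) \<in> L"
          using e' by simp
        then show ?thesis
          by (auto simp only: desub_def)
      qed
    next
      case A
      then have "\<exists>j. hom gamma (j # k # x) \<in> L"
        using k by (intro leftA) auto
      then show ?thesis
        by (auto simp only: desub_def)
    next
      case C
      then have "\<exists>j. hom gamma (j # k # x) \<in> L"
        using k by (intro leftA) auto
      then show ?thesis
        by (auto simp only: desub_def)
    qed
  qed
  have fact: "y \<in> desub L" if x: "x \<in> desub L" "sublist y x" for x y
  proof -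
    obtain p s where ps: "x = p @ y @ s"
      using x(2) by (auto simp: sublist_def)
    obtain k where k: "hom gamma (k # p @ y @ s) \<in> L"
      using x ps by (auto simp: desub_def)
    \<comment> \<open>The last letter before \<open>y\<close> becomes the undecided letter of
      \<open>desub\<close>.\<close>
    obtain p' j where "k # p = p' @ [j]"
      by (metis append_butlast_last_id list.distinct(1))
    then have "k # p @ y @ s = p' @ (j # y) @ s"
      by (metis append.assoc append_Cons append_Nil)
    then have "hom gamma p' @ hom gamma (j # y) @ hom gamma s \<in> L"
      using k by (metis concat_append map_append)
    then show ?thesis
      using lang_factor[OF L] unfolding desub_def by blast
  qed
  have "[] \<in> desub L"
  proof -
    obtain e where e: "[e] \<in> L"
      using lang_right[OF L lang_Nil[OF L]] by auto
    obtain e' where e': "[e, e'] \<in> L"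
      using lang_right[OF L e] by auto
    obtain k where k: "[k, e] \<in> L"
      using lang_left[OF L e] by auto
    have "(e, e') \<in> {(A, B), (A, C), (B, A), (B, C), (C, A)}"
      "(k, e) \<in> {(A, B), (A, C), (B, A), (B, C), (C, A)}"
      using core_pairs[OF assms, of "[]" _ _ "[]"] e' k by auto
    then have "hom gamma [A] \<in> L \<or> hom gamma [B] \<in> L \<or> hom gamma [C] \<in> L"
      using e e' k by auto
    then show ?thesis
      unfolding desub_def by blast
  qed
  with right left fact show ?thesis
    unfolding lang_def by blast
qed

text \<open>The images of BB and CB contain CC, and that of AA contains BAB. After CC comes a block
  starting with A, which yields ACACA. A factor BAB is followed by a block starting with A and
  preceded by the letter A, before which stands a block ending in C; this yields CABCABCA.\<close>

lemma core_desub: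
  assumes "core L" "[A, C, A, C, A] \<notin> L" "[C, A, B, C, A, B, C, A] \<notin> L"
  shows "core (desub L)"
proof -
  note L = core_lang[OF assms(1)]
  note D = desub_lang[OF assms(1)]
  have no: "u \<notin> desub L" if "sublist y (hom gamma u)" "y \<notin> L" for u y
    using that desub_gamma[OF L] lang_sublist[OF L] by blast
  have [simp]: "[B, B] \<notin> desub L" "[C, B] \<notin> desub L" "[A, A] \<notin> desub L"
    using assms(1) no[of "[C, C]" "[B, B]"] no[of "[C, C]" "[C, B]"] no[of "[B, A, B]" "[A, A]"]
    by (auto simp: core_def sublist_code)
  have [simp]: "[C, C] \<notin> desub L"
  proof
    assume "[C, C] \<in> desub L"
    then obtain e where e: "[C, C, e] \<in> desub L"
      using lang_right[OF D] by fastforce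
    then have "[C, e] \<in> desub L"
      using lang_sublist[OF D] by (auto simp: sublist_code)
    then have "e \<noteq> B"
      by auto
    then have "sublist [A, C, A, C, A] (hom gamma [C, C, e])"
      by (cases e) (auto simp: sublist_code)
    then show False
      using no e assms(2) by blast
  qed
  have "[B, A, B] \<notin> desub L"
  proof
    assume "[B, A, B] \<in> desub L"
    then obtain e where e: "[B, A, B, e] \<in> desub L"
      using lang_right[OF D] by fastforce
    then have "[B, e] \<in> desub L"
      using lang_sublist[OF D] by (auto simp: sublist_code)
    then have "e \<noteq> B"
      by auto
    obtain k where k: "[k, B, A, B, e] \<in> desub L"
      using lang_left[OF D e] by fastforce
    then have "[k, B] \<in> desub L"
      using lang_sublist[OF D] by (auto simp: sublist_code)
    then have "k = A"
      by (cases k) auto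
    obtain j where j: "[j, k, B, A, B, e] \<in> desub L"
      using lang_left[OF D k] by fastforce
    then have "[j, k] \<in> desub L"
      using lang_sublist[OF D] by (auto simp: sublist_code)
    then have "j \<noteq> A"
      using \<open>k = A\<close> by auto
    then have "sublist [C, A, B, C, A, B, C, A] (hom gamma [j, k, B, A, B, e])"
      using \<open>k = A\<close> \<open>e \<noteq> B\<close> by (cases e; cases j) (auto simp: sublist_code)
    then show False
      using no j assms(3) by blast
  qed
  then show ?thesis
    by (simp add: core_def D)
qed

section \<open>Codings by iterates of the substitution\<close>

definition low :: "real \<Rightarrow> letter list set \<Rightarrow> bool" where
  "low c L \<longleftrightarrow> (\<forall>x\<in>L. \<forall>p. is_period p x \<longrightarrow> real (length x) \<le> c * real p)"

text \<open>\<open>V\<close> and \<open>U\<close> are a common prefix and suffix of all sufficiently long decoded words;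
  they measure how far a repetition in \<open>L\<close> extends in \<open>M\<close> after decoding.\<close>

definition coded ::
    "letter list set \<Rightarrow> (letter \<Rightarrow> letter list) \<Rightarrow> letter list \<Rightarrow> letter list \<Rightarrow> letter list set \<Rightarrow> bool" where
  "coded M F U V L \<longleftrightarrow> core L \<and> (\<forall>u\<in>L. U @ hom F u @ V \<in> M)
     \<and> (\<forall>l. F l \<noteq> []) \<and> (\<forall>l. prefix V (F l @ V)) \<and> (\<forall>l. suffix U (U @ F l))"

lemma coded_prefix: "coded M F U V L \<Longrightarrow> prefix V (hom F u @ V)"
  by (rule prefix_hom_append) (simp add: coded_def)

lemma coded_suffix: "coded M F U V L \<Longrightarrow> suffix U (U @ hom F u)"
  by (rule suffix_append_hom) (simp add: coded_def)

text \<open>These inequalities make the decodings of \<open>ACACA\<close> and \<open>CABCABCA\<close> have exponent at least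
  \<open>5/2\<close>, both for \<open>F\<close> and for \<open>F \<circ> gamma\<close>, and they are inherited by \<open>F \<circ> gamma\<^sup>2\<close>.\<close>

definition balanced :: "(letter \<Rightarrow> letter list) \<Rightarrow> letter list \<Rightarrow> bool" where
  "balanced F V \<longleftrightarrow> length (F B) \<le> length (F A) + 2 * length V
     \<and> length (F C) \<le> length (F A) + 2 * length V
     \<and> length (F C) \<le> length (F B) + 2 * length V"

text \<open>The equation \<open>P @ R @ S = R @ T\<close> expresses that \<open>P @ R\<close> has
  period |P|. Decoding preserves this, and \<open>V\<close> prolongs the repetition because it
  begins whatever follows. The last hypothesis says that the decoded exponent reaches 5/2.\<close>

lemma coded_repetition:
  assumes "lang M" "low c M" "c < 5 / 2" "coded M F U V L" "P \<noteq> []" "P @ R @ S = R @ T"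
    and "5 * length (hom F P) \<le> 2 * (length (hom F (P @ R)) + length V)"
  shows "P @ R \<notin> L"
proof
  assume "P @ R \<in> L"
  then have "U @ hom F (P @ R) @ V \<in> M"
    using assms(4) unfolding coded_def by blast
  then have "U @ (hom F P @ hom F R @ V) @ [] \<in> M"
    by simp
  then have M: "hom F P @ hom F R @ V \<in> M"
    using lang_factor[OF assms(1)] by blast
  have V: "prefix V (hom F S' @ V)" for S'
    using assms(4) by (intro prefix_hom_append) (auto simp: coded_def)
  have "prefix (hom F R @ V) (hom F R @ hom F T @ V)"
    using V by simp
  moreover have "hom F R @ hom F T @ V = hom F P @ hom F R @ hom F S @ V"
    using assms(6) by (metis append.assoc concat_append map_append)
  ultimately have "prefix (hom F R @ V) ((hom F P @ hom F R) @ hom F S @ V)"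
    by simp
  moreover have "prefix (hom F P @ hom F R @ V) ((hom F P @ hom F R) @ hom F S @ V)"
    using V by simp
  ultimately have "prefix (hom F R @ V) (hom F P @ hom F R @ V)"
    by (rule prefix_length_prefix) simp
  moreover have ne: "hom F P \<noteq> []"
    using assms(4,5) by (cases P) (auto simp: coded_def)
  ultimately have "is_period (length (hom F P)) (hom F P @ hom F R @ V)"
    by (intro is_period_if_prefix)
  then have "real (length (hom F P @ hom F R @ V)) \<le> c * real (length (hom F P))"
    using assms(2) M by (auto simp: low_def)
  also have "\<dots> < 5 / 2 * real (length (hom F P))"
    using ne assms(3) by (intro mult_strict_right_mono) auto
  finally show False
    using assms(7) by simp
qed

text \<open>Let a, b, c, v be the lengths of the three images and of \<open>V\<close>. The decoding
  of ACACA, with period word AC, reaches exponent 5/2 if c \<le> a + 2v, and that of CABCABCA, with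
  period word CAB, if b \<le> a + c + 2v. So \<open>core_desub\<close> applies.\<close>

lemma coded_desub:
  assumes "lang M" "low c M" "c < 5 / 2" "coded M F U V L"
    and "length (F B) \<le> length (F A) + 2 * length V" "length (F C) \<le> length (F A) + 2 * length V"
  shows "coded M (\<lambda>l. hom F (gamma l)) U V (desub L)"
proof -
  have L: "core L" "lang L"
    using assms(4) core_lang by (auto simp: coded_def)
  have "[A, C] @ [A, C, A] \<notin> L"
    using assms(5,6) by (intro coded_repetition[OF assms(1-4), where S = "[C, A]" and T = "[C, A, C, A]"])
      auto
  moreover have "[C, A, B] @ [C, A, B, C, A] \<notin> L"
    using assms(5,6) by (intro coded_repetition[OF assms(1-4), where S = "[B, C, A]" and T = "[B, C, A, B, C, A]"])
      auto
  ultimately have core: "core (desub L)"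
    using L by (intro core_desub) auto
  note pre = coded_prefix[OF assms(4)] and suf = coded_suffix[OF assms(4)]
  have ne: "hom F (gamma l) \<noteq> []" for l
    using assms(4) by (cases l) (auto simp: coded_def)
  have "U @ hom (\<lambda>l. hom F (gamma l)) u @ V \<in> M" if u: "u \<in> desub L" for u
  proof -
    obtain k where "hom gamma (k # u) \<in> L"
      using u by (auto simp: desub_def)
    then have "U @ hom F (hom gamma (k # u)) @ V \<in> M"
      using assms(4) by (auto simp: coded_def)
    then have *: "(U @ hom F (gamma k)) @ hom F (hom gamma u) @ V \<in> M"
      by simp
    \<comment> \<open>Moving \<open>U\<close> across the image of the undecided letter
      \<open>k\<close> removes that image from the left end.\<close>
    obtain Z where "U @ hom F (gamma k) = Z @ U"
      using suf[of "gamma k"] by (auto simp: suffix_def)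
    then have "Z @ (U @ hom F (hom gamma u) @ V) @ [] \<in> M"
      using * by simp
    then show ?thesis
      unfolding hom_hom by (rule lang_factor[OF assms(1)])
  qed
  then show ?thesis
    using core ne pre suf by (simp add: coded_def)
qed

section \<open>Two desubstitution steps at a time\<close>

definition gamma2 :: "letter \<Rightarrow> letter list" where
  "gamma2 l = hom gamma (gamma l)"

lemma gamma2_simps [simp]: "gamma2 A = [A, B, C]" "gamma2 B = [A, C]" "gamma2 C = [A, B, A, C]"
  by (simp_all add: gamma2_def)

text \<open>All images under \<open>gamma2\<close> begin with A and end with C, so every decoded
  word acquires \<open>F C\<close> on its left and \<open>F A\<close> on its right. In the new
  \<open>balanced\<close>, with a, b, c, v the old lengths, the third inequality 2a + b + c \<le> (a
  + c) + 2(a + v) is the old first one, b \<le> a + 2v.\<close>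

lemma coded_desub2:
  assumes "lang M" "low c M" "c < 5 / 2" "coded M F U V L" "balanced F V"
  defines "F' \<equiv> \<lambda>l. hom F (gamma2 l)" and "U' \<equiv> U @ F C" and "V' \<equiv> F A @ V"
  shows "coded M F' U' V' (desub (desub L))" "balanced F' V'"
proof -
  have L: "core L" "lang L"
    using assms(4) core_lang by (auto simp: coded_def)
  have D: "coded M (\<lambda>l. hom F (gamma l)) U V (desub L)"
    using coded_desub assms(1-5) by (auto simp: balanced_def)
  have DL: "lang (desub L)"
    using D core_lang by (auto simp: coded_def)
  have "coded M (\<lambda>l. hom (\<lambda>l. hom F (gamma l)) (gamma l)) U V (desub (desub L))"
    using assms(5) by (intro coded_desub[OF assms(1-3) D]) (auto simp: balanced_def)
  then have core: "core (desub (desub L))"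
    by (simp add: coded_def)
  note D2 = core_lang[OF core]
  note pre = coded_prefix[OF assms(4)] and suf = coded_suffix[OF assms(4)]
  have "U' @ hom F' u @ V' \<in> M" if u: "u \<in> desub (desub L)" for u
  proof -
    \<comment> \<open>One neighbouring letter on each side is enough: the first letter of one image
      and the last letter of the other give the enlarged contexts.\<close>
    obtain k where "u @ [k] \<in> desub (desub L)"
      using lang_right[OF D2 u] by blast
    then obtain j where "j # u @ [k] \<in> desub (desub L)"
      using lang_left[OF D2] by blast
    then have "hom gamma (hom gamma (j # u @ [k])) \<in> L"
      using desub_gamma L DL by blast
    moreover obtain p where p: "gamma2 j = p @ [C]"
      by (cases j) auto
    moreover obtain s where s: "gamma2 k = A # s"
      by (cases k) auto
    ultimately have "p @ [C] @ hom gamma2 u @ [A] @ s \<in> L"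
      by (simp add: hom_hom flip: gamma2_def)
    then have "U @ hom F (p @ [C] @ hom gamma2 u @ [A] @ s) @ V \<in> M"
      using assms(4) by (auto simp: coded_def)
    then have *: "(U @ hom F p) @ F C @ hom F (hom gamma2 u) @ F A @ (hom F s @ V) \<in> M"
      by simp
    obtain Z where Z: "U @ hom F p = Z @ U"
      using suf[of p] by (auto simp: suffix_def)
    obtain Y where Y: "hom F s @ V = V @ Y"
      using pre[of s] by (auto simp: prefix_def)
    have "Z @ (U @ F C @ hom F (hom gamma2 u) @ F A @ V) @ Y \<in> M"
      using * unfolding Z Y by simp
    then have "U @ F C @ hom F (hom gamma2 u) @ F A @ V \<in> M"
      using lang_factor[OF assms(1)] by blast
    then show ?thesis
      by (simp add: F'_def U'_def V'_def hom_hom)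
  qed
  moreover have "F' l \<noteq> []" for l
    using assms(4) by (cases l) (auto simp: coded_def F'_def)
  moreover have "prefix V' (F' l @ V')" for l
  proof -
    obtain s where "gamma2 l = A # s"
      by (cases l) auto
    then show ?thesis
      using pre[of "s @ [A]"] by (simp add: F'_def V'_def)
  qed
  moreover have "suffix U' (U' @ F' l)" for l
  proof -
    obtain p where p: "gamma2 l = p @ [C]"
      by (cases l) auto
    obtain Z where "U @ hom F (C # p) = Z @ U"
      using suf[of "C # p"] by (auto simp: suffix_def)
    then have "U' @ F' l = Z @ U'"
      using p by (simp add: F'_def U'_def)
    then show ?thesis
      by (simp add: suffix_def)
  qed
  ultimately show "coded M F' U' V' (desub (desub L))"
    using core by (simp add: coded_def)
  show "balanced F' V'"
    using assms(5) by (auto simp: balanced_def F'_def V'_def)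
qed

text \<open>B is always preceded by A, and C is always followed by A.\<close>

lemma core_A:
  assumes "core L"
  shows "[A] \<in> L"
proof -
  note L = core_lang[OF assms]
  obtain e where e: "[e] \<in> L"
    using lang_right[OF L lang_Nil[OF L]] by auto
  obtain e' where e': "[e, e'] \<in> L"
    using lang_right[OF L e] by auto
  obtain k where k: "[k, e] \<in> L"
    using lang_left[OF L e] by auto
  have "e = A \<or> e' = A \<or> k = A"
    using core_pairs[OF assms, of "[]" e e' "[]"] core_pairs[OF assms, of "[]" k e "[]"] e' k by auto
  then show ?thesis
    using e' k lang_sublist[OF L] by (auto simp: sublist_code)
qed

text \<open>Every such language contains the square CACA. Its image extended by \<open>U\<close> and
  \<open>V\<close> keeps the period |F(CA)|, so its exponent is 2 + |UV| / |F(CA)|.\<close>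

lemma coded_low:
  assumes "lang M" "low c M" "c < 5 / 2" "coded M F U V L" "balanced F V"
  shows "2 * real (length (F A @ F C)) + real (length (U @ V)) \<le> c * real (length (F A @ F C))"
proof -
  note 1 = coded_desub2[OF assms]
  note 2 = coded_desub2[OF assms(1-3) 1]
  have L: "core L" "lang L" and D: "lang (desub L)" "lang (desub (desub L))"
    "core (desub (desub L))"
    using assms(4) core_lang desub_lang 1(1) by (auto simp: coded_def)
  have D3: "lang (desub (desub (desub L)))"
    using desub_lang D(3) by blast
  have "core (desub (desub (desub (desub L))))"
    using 2(1) by (simp add: coded_def)
  then have "[A] \<in> desub (desub (desub (desub L)))"
    by (rule core_A)
  \<comment> \<open>The fourth iterate of \<open>gamma\<close> on A is ABCACABAC, which contains
    CACA.\<close>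
  then have "hom gamma (hom gamma (hom gamma (hom gamma [A]))) \<in> L"
    using desub_gamma L D D3 by blast
  then have "[C, A, C, A] \<in> L"
    by (rule lang_sublist[OF L(2)]) (simp add: sublist_code)
  then have M: "U @ (F C @ F A) @ (F C @ F A) @ V \<in> M"
    using assms(4) by (auto simp: coded_def)
  note pre = coded_prefix[OF assms(4)] and suf = coded_suffix[OF assms(4)]
  obtain Z where Z: "U @ F C @ F A = Z @ U"
    using suf[of "[C, A]"] by (auto simp: suffix_def)
  then have lenZ: "length Z = length (F A @ F C)"
    by (metis add.commute add_left_cancel length_append)
  have ne: "Z \<noteq> []"
    using lenZ assms(4) by (auto simp: coded_def)
  define R where "R = U @ (F C @ F A) @ V"
  have ZR: "Z @ R = U @ (F C @ F A) @ (F C @ F A) @ V"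
    using Z by (metis R_def append.assoc)
  have "prefix R (Z @ R)"
    unfolding ZR using pre[of "[C, A]"] by (simp add: R_def)
  then have "is_period (length Z) (Z @ R)"
    using ne by (intro is_period_if_prefix)
  then have "real (length (Z @ R)) \<le> c * real (length Z)"
    using assms(2) M ZR by (auto simp: low_def)
  then show ?thesis
    by (simp add: lenZ R_def)
qed

section \<open>Growth of the iterated codings\<close>

primrec iterate :: "(letter \<Rightarrow> letter list) \<Rightarrow> nat \<Rightarrow> letter \<Rightarrow> letter list" where
  "iterate F 0 = F"
| "iterate F (Suc k) = (\<lambda>l. hom (iterate F k) (gamma2 l))"

text \<open>The sum arises because step j appends the current images of C and A to the two
  contexts.\<close>

lemma coded_iterate:
  assumes "lang M" "low c M" "c < 5 / 2" "coded M F U V L" "balanced F V"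
  shows "\<exists>U' V' L'. coded M (iterate F k) U' V' L' \<and> balanced (iterate F k) V' \<and>
     length (U' @ V') = length (U @ V) + (\<Sum>j<k. length (iterate F j A @ iterate F j C))"
proof (induction k)
  case (Suc k)
  then obtain U' V' L' where *: "coded M (iterate F k) U' V' L'" "balanced (iterate F k) V'"
    "length (U' @ V') = length (U @ V) + (\<Sum>j<k. length (iterate F j A @ iterate F j C))"
    by blast
  show ?case
    using coded_desub2[OF assms(1-3) *(1,2)] *(3)
    by (intro exI[of _ "U' @ iterate F k C"] exI[of _ "iterate F k A @ V'"]
          exI[of _ "desub (desub L')"]) simp
qed (use assms in auto)

lemma lambda_ge: "17 / 10 \<le> lambda" "lambda ^ 3 = 2 * lambda ^ 2 - lambda + 1"
  using lambda_bounds(1) lambda_root by auto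

text \<open>A left eigenvector for the eigenvalue \<open>lambda\<^sup>2\<close> of the incidence matrix of \<open>gamma2\<close>.\<close>

definition weight :: "(letter \<Rightarrow> letter list) \<Rightarrow> real" where
  "weight F = lambda * length (F A) + length (F B) + (lambda ^ 2 - lambda) * length (F C)"

lemma weight_iterate: "weight (iterate F k) = (lambda ^ 2) ^ k * weight F"
proof (induction k)
  case (Suc k)
  define a b c where abc: "a = real (length (iterate F k A))" "b = real (length (iterate F k B))"
    "c = real (length (iterate F k C))"
  have l3: "lambda * lambda * lambda = 2 * (lambda * lambda) - lambda + 1"
    using lambda_ge(2) by (simp add: power3_eq_cube power2_eq_square)
  then have l4: "lambda * lambda * (lambda * lambda) = 3 * (lambda * lambda) - lambda + 2"
    by algebra
  have "weight (iterate F (Suc k)) = lambda * (a + b + c) + (a + c) + (lambda ^ 2 - lambda) * (2 * a + b + c)"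
    by (simp add: weight_def abc algebra_simps)
  also have "\<dots> = lambda ^ 2 * (lambda * a + b + (lambda ^ 2 - lambda) * c)"
    using l3 l4 unfolding power2_eq_square by algebra
  also have "\<dots> = lambda ^ 2 * weight (iterate F k)"
    by (simp add: weight_def abc)
  finally show ?case
    using Suc by simp
qed simp

text \<open>The coefficients \<open>lambda\<close> and \<open>lambda\<close>^2 -
  \<open>lambda\<close> are both at least 1. For the second, the rational lower bound 17/10
  suffices, since 1.7 * 0.7 = 1.19.\<close>

lemma length_le_weight: "real (length (F A @ F C)) \<le> weight F"
proof -
  have "1 \<le> (17 / 10) * (17 / 10 - 1 :: real)"
    by simp
  also have "\<dots> \<le> lambda * (lambda - 1)"
    using lambda_ge(1) by (intro mult_mono) auto
  finally have "1 \<le> lambda ^ 2 - lambda"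
    by (simp add: power2_eq_square algebra_simps)
  moreover have "1 \<le> lambda"
    using lambda_ge(1) by simp
  ultimately have "1 * real (length (F A)) + 0 + 1 * real (length (F C)) \<le> weight F"
    unfolding weight_def by (intro add_mono mult_right_mono) auto
  then show ?thesis
    by simp
qed

text \<open>By \<open>coded_low\<close>, the sum of q 0, ..., q (k - 1) is at most \<theta> q k.
  This forces the partial sums to grow at least like (1 + 1/\<theta>)^k, whereas the eigenvector
  bound lets q k grow at most like \<open>lambda\<close>^(2k). For \<open>c\<close> <
  \<open>mu\<close> the first rate is the larger one.\<close>

theorem coded_contradiction:
  assumes "lang M" "low c M" "c < mu" "coded M F [] V L" "balanced F V"
  shows False
proof -
  have c: "c < 5 / 2"
    using assms(3) mu_bounds(2) by simp
  define q where "q k = real (length (iterate F k A @ iterate F k C))" for k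
  define s where "s k = (\<Sum>j<k. q j)" for k
  define \<theta> where "\<theta> = c - 2"
  have le: "s k \<le> \<theta> * q k" for k
  proof -
    obtain U' V' L' where *: "coded M (iterate F k) U' V' L'" "balanced (iterate F k) V'"
      "length (U' @ V') = length ([] @ V) + (\<Sum>j<k. length (iterate F j A @ iterate F j C))"
      using coded_iterate[OF assms(1,2) c assms(4,5)] by blast
    have "2 * q k + real (length (U' @ V')) \<le> c * q k"
      using coded_low[OF assms(1,2) c *(1,2)] by (simp add: q_def)
    moreover have "s k \<le> real (length (U' @ V'))"
      unfolding *(3) s_def q_def by simp
    ultimately show ?thesis
      by (simp add: \<theta>_def algebra_simps)
  qed
  have ne: "iterate F k l \<noteq> []" for k l
    using coded_iterate[OF assms(1,2) c assms(4,5), of k] by (auto simp: coded_def)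
  then have q_pos: "0 < q k" for k
    by (simp add: q_def add_pos_pos)
  \<comment> \<open>The case k = 1 already gives a positive \<theta>, by which the later steps
    divide.\<close>
  have "0 < s 1"
    using q_pos[of 0] by (simp add: s_def)
  also have "\<dots> \<le> \<theta> * q 1"
    by (rule le)
  finally have \<theta>: "0 < \<theta>"
    using q_pos[of 1] by (simp add: zero_less_mult_iff)
  define \<rho> where "\<rho> = 1 + 1 / \<theta>"
  have grow: "q 0 * \<rho> ^ k \<le> s (Suc k)" for k
  proof (induction k)
    case 0
    then show ?case by (simp add: s_def)
  next
    case (Suc k)
    have "q 0 * \<rho> ^ k * \<rho> \<le> s (Suc k) * \<rho>"
      using Suc \<theta> by (intro mult_right_mono) (auto simp: \<rho>_def)
    then have "q 0 * \<rho> ^ Suc k \<le> s (Suc k) * \<rho>"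
      by (simp add: mult_ac)
    also have "\<dots> = s (Suc k) + s (Suc k) / \<theta>"
      by (simp add: \<rho>_def algebra_simps)
    also have "s (Suc k) / \<theta> \<le> q (Suc k)"
      using le[of "Suc k"] \<theta> by (simp add: field_simps)
    finally show ?case
      by (simp add: s_def)
  qed
  have l2: "2 < lambda ^ 2"
  proof -
    have "(17 / 10) ^ 2 \<le> lambda ^ 2"
      using lambda_ge(1) by (intro power_mono) auto
    then show ?thesis
      by (simp add: power2_eq_square)
  qed
  have bound: "q 0 * \<rho> ^ k \<le> \<theta> * lambda ^ 2 * weight F * (lambda ^ 2) ^ k" for k
  proof -
    have "q 0 * \<rho> ^ k \<le> \<theta> * q (Suc k)"
      using grow[of k] le[of "Suc k"] by linarith
    also have "\<dots> \<le> \<theta> * weight (iterate F (Suc k))"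
      unfolding q_def using \<theta> length_le_weight[of "iterate F (Suc k)"] by (intro mult_left_mono) auto
    finally show ?thesis
      unfolding weight_iterate by (simp add: mult_ac)
  qed
  \<comment> \<open>Equivalently, 1 + 1/\<theta> exceeds \<open>lambda\<close>^2; this is where the
    exact value of \<open>mu\<close> is used.\<close>
  have "\<theta> < 1 / (lambda ^ 2 - 1)"
    using assms(3) by (simp add: \<theta>_def mu_def)
  then have "lambda ^ 2 < \<rho>"
    using \<theta> l2 by (simp add: \<rho>_def field_simps)
  then have "1 < \<rho> / lambda ^ 2"
    using l2 less_divide_eq_1_pos[of "lambda ^ 2" \<rho>] by linarith
  have l2p: "0 < (lambda ^ 2) ^ k" for k
    using lambda_ge(1) by simp
  obtain k where "\<theta> * lambda ^ 2 * weight F / q 0 < (\<rho> / lambda ^ 2) ^ k"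
    using real_arch_pow[OF \<open>1 < \<rho> / lambda ^ 2\<close>] by blast
  then have "\<theta> * lambda ^ 2 * weight F * (lambda ^ 2) ^ k < q 0 * \<rho> ^ k"
    using q_pos[of 0] l2p by (simp add: power_divide divide_simps mult_ac split: if_splits)
  then show False
    using bound[of k] by simp
qed

section \<open>Languages of small complexity\<close>

definition thin :: "letter list set \<Rightarrow> bool" where
  "thin L \<longleftrightarrow> (\<forall>n. card {x\<in>L. length x = Suc n} \<le> card {x\<in>L. length x = n} + 2)"

definition admissible :: "real \<Rightarrow> letter list set \<Rightarrow> bool" where
  "admissible c L \<longleftrightarrow> lang L \<and> thin L \<and> low c L"

instance letter :: finite
proof
  have "UNIV = {A, B, C}"
    using letter.exhaust by auto
  then show "finite (UNIV :: letter set)"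
    by (metis finite.emptyI finite.insertI)
qed

lemma finite_words: "finite {x\<in>L. length x = n}" for L :: "letter list set"
  using finite_lists_length_eq[of "UNIV :: letter set" n] by (rule rev_finite_subset) auto

text \<open>Choose one right extension for every word of length n. At most two words of length n + 1
  remain unchosen, and the chosen ones are determined by their first n letters. The global count
  thus becomes a bound on any set \<open>Z\<close>, however little is known of the rest.\<close>

lemma thin_card:
  assumes "lang L" "thin L" "Z \<subseteq> {x\<in>L. length x = Suc n}"
  shows "card Z \<le> card (butlast ` Z) + 2"
proof -
  define X Y where "X = {x\<in>L. length x = Suc n}" and "Y = {x\<in>L. length x = n}"
  have fin: "finite X" "finite Y" "finite Z"
    using finite_words rev_finite_subset[OF _ assms(3)] by (auto simp: X_def Y_def)
  \<comment> \<open>\<open>g\<close> is the chosen extension, and \<open>butlast\<close> is its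
    inverse.\<close>
  define g where "g y = y @ [SOME l. y @ [l] \<in> L]" for y
  have g: "g y \<in> L" if "y \<in> L" for y
    using lang_right[OF assms(1) that] unfolding g_def by (rule someI_ex)
  have bl: "butlast (g y) = y" for y
    by (simp add: g_def)
  have inj: "inj_on g Y" "inj_on butlast (g ` Y)"
    by (auto simp: inj_on_def) (metis bl)+
  have gY: "g ` Y \<subseteq> X"
    using g by (auto simp: X_def Y_def) (simp add: g_def)
  have "card (Z \<inter> g ` Y) = card (butlast ` (Z \<inter> g ` Y))"
    using inj(2) by (intro card_image[symmetric]) (auto intro: inj_on_subset)
  also have "\<dots> \<le> card (butlast ` Z)"
    using fin by (intro card_mono) auto
  finally have 1: "card (Z \<inter> g ` Y) \<le> card (butlast ` Z)" .
  have "card Z + card (g ` Y) = card (Z \<union> g ` Y) + card (Z \<inter> g ` Y)"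
    using fin by (intro card_Un_Int) auto
  also have "card (Z \<union> g ` Y) \<le> card X"
    using fin gY assms(3) by (intro card_mono) (auto simp: X_def)
  also have "card X \<le> card Y + 2"
    using assms(2) by (simp add: thin_def X_def Y_def)
  finally show ?thesis
    using 1 card_image[OF inj(1)] by simp
qed

section \<open>Invariance under reversal and renaming of letters\<close>

lemma is_period_rev:
  assumes "is_period p (rev x)"
  shows "is_period p x"
proof -
  have "x ! i = x ! (i + p)" if "i + p < length x" for i
  proof -
    define j where "j = length x - Suc (i + p)"
    have "rev x ! j = rev x ! (j + p)"
      using assms that by (auto simp: is_period_def j_def)
    then show ?thesis
      using that by (simp add: j_def rev_nth)
  qed
  then show ?thesis
    using assms by (auto simp: is_period_def)
qed

lemma is_period_map:
  assumes "inj_on f (set x)" "is_period p (map f x)"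
  shows "is_period p x"
  using assms unfolding is_period_def inj_on_def
  by (metis add_lessD1 length_map nth_map nth_mem)

lemma thin_image:
  assumes "inj_on h L" "\<And>x. length (h x) = length x" "thin L"
  shows "thin (h ` L)"
proof -
  have "card {x \<in> h ` L. length x = n} = card {x \<in> L. length x = n}" for n
  proof -
    have "{x \<in> h ` L. length x = n} = h ` {x \<in> L. length x = n}"
      using assms(2) by auto
    moreover have "inj_on h {x \<in> L. length x = n}"
      using assms(1) by (rule inj_on_subset) auto
    ultimately show ?thesis
      by (simp add: card_image)
  qed
  then show ?thesis
    using assms(3) by (simp add: thin_def)
qed

lemma admissible_rev:
  assumes "admissible c L"
  shows "admissible c (rev ` L)"
proof -
  have L: "lang L" "thin L" "low c L"
    using assms by (auto simp: admissible_def)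
  have "y \<in> rev ` L" if "x \<in> L" "sublist y (rev x)" for x y
    using lang_sublist[OF L(1) that(1), of "rev y"] that(2)
    by (metis image_eqI rev_rev_ident sublist_rev_right)
  moreover have "\<exists>l. rev x @ [l] \<in> rev ` L" "\<exists>l. l # rev x \<in> rev ` L" if "x \<in> L" for x
    using lang_left[OF L(1) that] lang_right[OF L(1) that]
    by (metis image_eqI rev.simps(2), metis image_eqI rev_eq_Cons_iff rev_rev_ident)
  ultimately have "lang (rev ` L)"
    using lang_Nil[OF L(1)] by (auto simp: lang_def image_iff)
  moreover have "thin (rev ` L)"
    using L(2) by (intro thin_image) (auto simp: inj_on_def)
  moreover have "low c (rev ` L)"
    using L(3) is_period_rev by (force simp: low_def)
  ultimately show ?thesis
    by (simp add: admissible_def)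
qed

lemma admissible_map:
  assumes "admissible c L" "inj \<sigma>"
  shows "admissible c (map \<sigma> ` L)"
proof -
  have L: "lang L" "thin L" "low c L"
    using assms by (auto simp: admissible_def)
  have "y \<in> map \<sigma> ` L" if x: "x \<in> L" "sublist y (map \<sigma> x)" for x y
  proof -
    obtain z where "sublist z x" "y = map \<sigma> z"
      using sublist_map_rightE[OF x(2)] by blast
    then show ?thesis
      using lang_sublist[OF L(1) x(1)] by blast
  qed
  moreover have "\<exists>l. map \<sigma> x @ [l] \<in> map \<sigma> ` L" "\<exists>l. l # map \<sigma> x \<in> map \<sigma> ` L"
    if x: "x \<in> L" for x
  proof -
    obtain l k where "x @ [l] \<in> L" "k # x \<in> L"
      using lang_left[OF L(1) x] lang_right[OF L(1) x] by blast
    then have *: "map \<sigma> x @ [\<sigma> l] \<in> map \<sigma> ` L" "\<sigma> k # map \<sigma> x \<in> map \<sigma> ` L"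
      using imageI[of "x @ [l]" L "map \<sigma>"] imageI[of "k # x" L "map \<sigma>"] by simp_all
    show "\<exists>l. map \<sigma> x @ [l] \<in> map \<sigma> ` L" "\<exists>l. l # map \<sigma> x \<in> map \<sigma> ` L"
      by (rule exI, rule *)+
  qed
  ultimately have "lang (map \<sigma> ` L)"
    using lang_Nil[OF L(1)] by (auto simp: lang_def image_iff)
  moreover have "thin (map \<sigma> ` L)"
    using L(2) assms(2) by (intro thin_image) (auto simp: inj_on_def)
  moreover have "low c (map \<sigma> ` L)"
    using L(3) is_period_map[OF inj_on_subset[OF assms(2)]] by (force simp: low_def)
  ultimately show ?thesis
    by (simp add: admissible_def)
qed

section \<open>Finite approximations of a language\<close>

datatype trie = Em | Lf | Nd trie trie trie

text \<open>A trie stands for a set of words of one length \<open>n\<close>; \<open>walk w\<close> only inspects the first \<open>n\<close>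
  letters of \<open>w\<close> and accepts shorter words that are prefixes.\<close>

fun child :: "letter \<Rightarrow> trie \<Rightarrow> trie" where
  "child l Em = Em"
| "child l Lf = Lf"
| "child A (Nd x y z) = x"
| "child B (Nd x y z) = y"
| "child C (Nd x y z) = z"

fun walk :: "letter list \<Rightarrow> trie \<Rightarrow> bool" where
  "walk w Em = False"
| "walk w Lf = True"
| "walk [] (Nd x y z) = True"
| "walk (A # w) (Nd x y z) = walk w x"
| "walk (B # w) (Nd x y z) = walk w y"
| "walk (C # w) (Nd x y z) = walk w z"

fun mem :: "letter list \<Rightarrow> trie \<Rightarrow> bool" where
  "mem w Em = False"
| "mem [] Lf = True"
| "mem (l # w) Lf = False"
| "mem [] (Nd x y z) = False"
| "mem (A # w) (Nd x y z) = mem w x"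
| "mem (B # w) (Nd x y z) = mem w y"
| "mem (C # w) (Nd x y z) = mem w z"

text \<open>Collapsing empty nodes removes a word from the trie once its last extension is gone;
  otherwise \<open>walk\<close> would still accept it as a prefix.\<close>

fun mk :: "trie \<Rightarrow> trie \<Rightarrow> trie \<Rightarrow> trie" where
  "mk Em Em Em = Em"
| "mk x y z = Nd x y z"

fun del :: "letter list \<Rightarrow> trie \<Rightarrow> trie" where
  "del w Em = Em"
| "del [] t = Em"
| "del (l # w) Lf = Lf"
| "del (A # w) (Nd x y z) = mk (del w x) y z"
| "del (B # w) (Nd x y z) = mk x (del w y) z"
| "del (C # w) (Nd x y z) = mk x y (del w z)"

fun ins :: "letter list \<Rightarrow> trie \<Rightarrow> trie" where
  "ins [] t = Lf"
| "ins (A # w) (Nd x y z) = Nd (ins w x) y z"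
| "ins (B # w) (Nd x y z) = Nd x (ins w y) z"
| "ins (C # w) (Nd x y z) = Nd x y (ins w z)"
| "ins (A # w) t = Nd (ins w Em) Em Em"
| "ins (B # w) t = Nd Em (ins w Em) Em"
| "ins (C # w) t = Nd Em Em (ins w Em)"

fun inter :: "trie \<Rightarrow> trie \<Rightarrow> trie" where
  "inter Em t = Em"
| "inter Lf t = t"
| "inter (Nd x y z) Em = Em"
| "inter (Nd x y z) Lf = Nd x y z"
| "inter (Nd x y z) (Nd x' y' z') = mk (inter x x') (inter y y') (inter z z')"

text \<open>For a trie of depth n \<ge> 1 this gives the words of length n + 1 whose first n and
  last n letters both lie in \<open>t\<close>: the child below \<open>l\<close> has depth n - 1, and
  \<open>inter\<close> continues with \<open>t\<close> beyond its leaves.\<close>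

definition grow :: "trie \<Rightarrow> trie" where
  "grow t = mk (inter (child A t) t) (inter (child B t) t) (inter (child C t) t)"

fun words :: "trie \<Rightarrow> letter list list" where
  "words Em = []"
| "words Lf = [[]]"
| "words (Nd x y z) = map ((#) A) (words x) @ map ((#) B) (words y) @ map ((#) C) (words z)"

definition tries :: "letter list list \<Rightarrow> trie" where
  "tries ws = foldr ins ws Em"

lemma walk_Cons_mk [simp]: "walk (l # w) (mk x y z) = walk w (child l (Nd x y z))"
  by (cases "(x, y, z)" rule: mk.cases; cases l) auto

lemma walk_Cons: "walk (l # w) t = walk w (child l t)"
  by (cases t; cases l) auto

lemma walk_append: "walk (w @ v) t \<Longrightarrow> walk w t"
  by (induction w t rule: walk.induct) auto

lemma mem_Cons: "mem (l # w) t \<longleftrightarrow> t \<noteq> Lf \<and> mem w (child l t)"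
  by (cases t; cases l) auto

lemma mem_walk: "mem w t \<Longrightarrow> walk (w @ v) t"
  by (induction w t rule: mem.induct) auto

lemma mem_words: "mem w t \<longleftrightarrow> w \<in> set (words t)"
  by (induction w t rule: mem.induct) auto

text \<open>\<open>size\<close> is a crude bound for the depth: a word of that length runs through
  to a leaf.\<close>

lemma walk_mem: "walk w t \<Longrightarrow> size t \<le> length w \<Longrightarrow> \<exists>p. prefix p w \<and> mem p t"
proof (induction w t rule: walk.induct)
  case (2 w)
  then show ?case
    by (intro exI[of _ "[]"]) auto
next
  case (4 w x y z)
  then obtain p where "prefix p w" "mem p x" by auto
  then show ?case by (intro exI[of _ "A # p"]) auto
next
  case (5 w x y z)
  then obtain p where "prefix p w" "mem p y" by auto
  then show ?case by (intro exI[of _ "B # p"]) auto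
next
  case (6 w x y z)
  then obtain p where "prefix p w" "mem p z" by auto
  then show ?case by (intro exI[of _ "C # p"]) auto
qed auto

lemma walk_del:
  "walk w t \<Longrightarrow> length y \<le> length w \<Longrightarrow> \<not> prefix y w \<Longrightarrow> walk w (del y t)"
proof (induction y t arbitrary: w rule: del.induct)
  case (4 y a b c)
  then obtain l w' where "w = l # w'" by (cases w) auto
  with 4 show ?case by (cases l) auto
next
  case (5 y a b c)
  then obtain l w' where "w = l # w'" by (cases w) auto
  with 5 show ?case by (cases l) auto
next
  case (6 y a b c)
  then obtain l w' where "w = l # w'" by (cases w) auto
  with 6 show ?case by (cases l) auto
qed auto

lemma mem_ins: "mem u (ins w t) \<Longrightarrow> u = w \<or> mem u t"
proof (induction w t arbitrary: u rule: ins.induct)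
  case (1 t u)
  then show ?case by (cases u) auto
qed (case_tac u; auto simp: mem_Cons split: letter.splits; (case_tac a; auto))+

text \<open>Short words must be excluded: \<open>walk\<close> accepts them at inner nodes of both
  tries even if the intersection below is empty.\<close>

lemma walk_inter: "walk w s \<Longrightarrow> walk w t \<Longrightarrow> size s \<le> length w \<Longrightarrow> walk w (inter s t)"
proof (induction s t arbitrary: w rule: inter.induct)
  case (5 x y z x' y' z')
  then obtain l w' where "w = l # w'" by (cases w) auto
  with 5 show ?case by (cases l) auto
qed auto

section \<open>Upper and lower approximations of a language\<close>

definition ub :: "letter list set \<Rightarrow> trie \<Rightarrow> bool" where
  "ub L t \<longleftrightarrow> (\<forall>w\<in>L. walk w t)"

definition lb :: "letter list set \<Rightarrow> trie \<Rightarrow> bool" where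
  "lb L t \<longleftrightarrow> (\<forall>w. mem w t \<longrightarrow> w \<in> L)"

lemma lang_extend:
  assumes "lang L" "x \<in> L"
  shows "\<exists>e. length e = n \<and> x @ e \<in> L"
proof (induction n)
  case (Suc n)
  then obtain e where e: "length e = n" "x @ e \<in> L" by blast
  then obtain l where "(x @ e) @ [l] \<in> L"
    using lang_right[OF assms(1)] by blast
  then show ?case
    using e by (intro exI[of _ "e @ [l]"]) auto
qed (use assms in auto)

text \<open>Every word extends to any length and \<open>walk\<close> passes to prefixes, so long
  words decide.\<close>

lemma ub_if_long:
  assumes "lang L" "\<And>w. w \<in> L \<Longrightarrow> n \<le> length w \<Longrightarrow> walk w t"
  shows "ub L t"
  unfolding ub_def
proof
  fix w assume "w \<in> L"
  then obtain e where "length e = n" "w @ e \<in> L"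
    using lang_extend[OF assms(1)] by blast
  then show "walk w t"
    using assms(2) walk_append by (metis length_append le_add2)
qed

lemma ub_grow:
  assumes "lang L" "ub L t"
  shows "ub L (grow t)"
proof (rule ub_if_long[OF assms(1)])
  fix w assume w: "w \<in> L" "Suc (size t + 1) \<le> length w"
  then obtain l v where lv: "w = l # v"
    by (cases w) auto
  have v: "walk v (child l t)" "walk v t"
    using w lv assms lang_factor[OF assms(1), of "[l]" v "[]"] walk_Cons by (auto simp: ub_def)
  have "size (child l t) \<le> size t + 1"
    by (cases t; cases l) auto
  then have "walk v (inter (child l t) t)"
    using v w lv by (intro walk_inter) auto
  then show "walk w (grow t)"
    unfolding lv grow_def by (cases l) auto
qed

lemma ub_del:
  assumes "lang L" "ub L t" "y \<notin> L"
  shows "ub L (del y t)"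
proof (rule ub_if_long[OF assms(1)])
  fix w assume w: "w \<in> L" "length y \<le> length w"
  have "\<not> prefix y w"
    using w(1) assms(3) lang_sublist[OF assms(1)] by blast
  then show "walk w (del y t)"
    using w assms(2) by (intro walk_del) (auto simp: ub_def)
qed

lemma lb_ins: "lb L t \<Longrightarrow> y \<in> L \<Longrightarrow> lb L (ins y t)"
  using mem_ins by (auto simp: lb_def)

text \<open>Agreement with the shift by \<open>p\<close> on \<open>\<lceil>3p/2\<rceil>\<close> letters, that is, exponent at least \<open>5/2\<close>.
  Three letters are consumed for two units of \<open>p\<close>.\<close>

fun cmp3 :: "nat \<Rightarrow> 'a list \<Rightarrow> 'a list \<Rightarrow> bool" where
  "cmp3 0 s t = True"
| "cmp3 (Suc 0) (a # b # s) (a' # b' # t) = (a = a' \<and> b = b')"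
| "cmp3 (Suc (Suc p)) (a # b # c # s) (a' # b' # c' # t) = (a = a' \<and> b = b' \<and> c = c' \<and> cmp3 p s t)"
| "cmp3 _ _ _ = False"

fun power_prefix :: "nat \<Rightarrow> 'a list \<Rightarrow> bool" where
  "power_prefix 0 s = False"
| "power_prefix (Suc p) s = cmp3 (Suc p) s (drop (Suc p) s)"

lemma cmp3_common_prefix:
  "cmp3 p s t \<Longrightarrow> \<exists>u s' t'. 3 * p \<le> 2 * length u \<and> s = u @ s' \<and> t = u @ t'"
proof (induction p s t rule: cmp3.induct)
  case (1 s t)
  then show ?case by (intro exI[of _ "[]"] exI[of _ s] exI[of _ t]) auto
next
  case (2 a b s a' b' t)
  then show ?case by (intro exI[of _ "[a, b]"] exI[of _ s] exI[of _ t]) auto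
next
  case (3 p a b c s a' b' c' t)
  then obtain u s' t' where "3 * p \<le> 2 * length u" "s = u @ s'" "t = u @ t'"
    by auto
  then show ?case
    using 3(2) by (intro exI[of _ "a # b # c # u"] exI[of _ s'] exI[of _ t']) auto
qed auto

text \<open>The first p letters followed by the common prefix \<open>u\<close> form a word of period
  p and length at least 5p/2.\<close>

lemma power_prefix_notin:
  assumes "lang L" "low c L" "c < 5 / 2" "power_prefix p s"
  shows "s \<notin> L"
proof
  assume s: "s \<in> L"
  have p: "0 < p" "cmp3 p s (drop p s)"
    using assms(4) by (cases p; simp)+
  then obtain u s' t' where u: "3 * p \<le> 2 * length u" "s = u @ s'" "drop p s = u @ t'"
    using cmp3_common_prefix by blast
  define P where "P = take p s"
  have "length (drop p s) \<noteq> 0"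
    using u(1) p(1) unfolding u(3) by auto
  then have P: "length P = p" "s = P @ u @ t'"
    by (simp add: P_def) (metis P_def append_take_drop_id u(3))
  then have "P @ u \<in> L"
    using s lang_sublist[OF assms(1)] by (metis append.assoc sublist_append_rightI)
  have "prefix u (P @ u)"
    using u(2) P(2) by (metis append.assoc le_add2 length_append prefixI prefix_length_prefix)
  then have "is_period (length P) (P @ u)"
    using P(1) p(1) by (intro is_period_if_prefix) auto
  then have "real (length (P @ u)) \<le> c * real p"
    using assms(2) \<open>P @ u \<in> L\<close> P(1) by (auto simp: low_def)
  also have "\<dots> < 5 / 2 * real p"
    using p(1) assms(3) by (intro mult_strict_right_mono) auto
  finally show False
    using u(1) P(1) by simp
qed

text \<open>A proof that a word cannot be extended to the left indefinitely: \<open>P p\<close> names the period of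
  a forbidden power at the beginning, and \<open>X\<close> lists one proof for each left extension that the
  trie allows.\<close>

datatype ext = P nat | X "ext list"

fun dead :: "trie \<Rightarrow> letter list \<Rightarrow> ext \<Rightarrow> bool"
  and deads :: "trie \<Rightarrow> letter list list \<Rightarrow> ext list \<Rightarrow> bool" where
  "dead t x (P p) = power_prefix p x"
| "dead t x (X es) = deads t [A # x, B # x, C # x] es"
| "deads t [] es = True"
| "deads t (y # ys) [] = (if walk y t then False else deads t ys [])"
| "deads t (y # ys) (e # es) = (if walk y t then dead t y e \<and> deads t ys es else deads t ys (e # es))"

text \<open>Extending to the left suits the data: \<open>walk\<close> inspects the first n letters,
  so each new letter is tested with the n - 1 letters after it, and powers too are sought at the
  beginning. Since every word of the language has a left extension, a finite tree whose leaves begin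
  with forbidden powers excludes its root.\<close>

lemma dead_notin:
  assumes "lang L" "low c L" "c < 5 / 2"
  shows "ub L t \<Longrightarrow> dead t x e \<Longrightarrow> x \<notin> L" "ub L t \<Longrightarrow> deads t ys es \<Longrightarrow> set ys \<inter> L = {}"
proof (induction t x e and t ys es rule: dead_deads.induct)
  case (1 t x p)
  then show ?case
    using power_prefix_notin assms by auto
next
  case (2 t x es)
  then have "A # x \<notin> L" "B # x \<notin> L" "C # x \<notin> L"
    by auto
  then show ?case
    using lang_left[OF assms(1)] by (metis letter.exhaust)
qed (auto simp: ub_def split: if_splits)

text \<open>In contrast to \<open>child\<close>, a leaf has no continuation here, in accordance with
  the exact membership \<open>mem\<close>.\<close>

fun kid :: "letter \<Rightarrow> trie \<Rightarrow> trie" where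
  "kid A (Nd x y z) = x"
| "kid B (Nd x y z) = y"
| "kid C (Nd x y z) = z"
| "kid l t = Em"

lemma mem_kid: "mem (l # w) t \<longleftrightarrow> mem w (kid l t)"
  by (cases t; cases l) auto

fun single :: "trie \<Rightarrow> trie \<Rightarrow> trie \<Rightarrow> bool" where
  "single Lf Em Em = True"
| "single Em Lf Em = True"
| "single Em Em Lf = True"
| "single x y z = False"

fun leaf_in :: "trie \<Rightarrow> letter \<Rightarrow> trie \<Rightarrow> bool" where
  "leaf_in Em l k = True"
| "leaf_in Lf l k = mem [l] k"
| "leaf_in (Nd x y z) l k = False"

text \<open>All words of the first trie lie in the language if each of them is listed in \<open>k\<close> or is the
  only possible right extension of a word of \<open>s\<close>.\<close>

fun known :: "trie \<Rightarrow> trie \<Rightarrow> trie \<Rightarrow> bool" where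
  "known Em k s = True"
| "known Lf k s = False"
| "known (Nd x y z) k Em = False"
| "known (Nd x y z) k Lf =
     (if single x y z then True else leaf_in x A k \<and> leaf_in y B k \<and> leaf_in z C k)"
| "known (Nd x y z) k (Nd x' y' z') =
     (known x (kid A k) x' \<and> known y (kid B k) y' \<and> known z (kid C k) z')"

lemma leaf_inD: "leaf_in t l k \<Longrightarrow> mem v t \<Longrightarrow> v = [] \<and> mem [l] k"
  by (cases t; cases v) auto

text \<open>\<open>p\<close> is the path already descended in all three tries. At a leaf of
  \<open>s\<close> the word \<open>p\<close> lies in the language; it has a right extension, and
  this is forced when only one remains.\<close>

lemma known_sound:
  assumes "lang L"
  shows "known t k s \<Longrightarrow> (\<And>w. p @ w \<in> L \<Longrightarrow> walk w t) \<Longrightarrow> (\<And>w. mem w k \<Longrightarrow> p @ w \<in> L)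
    \<Longrightarrow> (\<And>w. mem w s \<Longrightarrow> p @ w \<in> L) \<Longrightarrow> mem w t \<Longrightarrow> p @ w \<in> L"
proof (induction t k s arbitrary: p w rule: known.induct)
  case (4 x y z k)
  obtain l v where w: "w = l # v"
    using "4.prems"(5) by (cases w) auto
  show ?case
  proof (cases "single x y z")
    case True
    obtain e where e: "p @ [e] \<in> L"
      using lang_right[OF assms "4.prems"(4)[of "[]"]] by auto
    have "e = l \<and> v = []"
      using True "4.prems"(2)[OF e] "4.prems"(5) unfolding w
      by (cases "(x, y, z)" rule: single.cases; cases e; cases l; cases v) auto
    then show ?thesis
      using e w by simp
  next
    case False
    then have "leaf_in x A k" "leaf_in y B k" "leaf_in z C k"
      using "4.prems"(1) by auto
    then have "v = [] \<and> mem [l] k"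
      using "4.prems"(5) leaf_inD unfolding w by (cases l) auto
    then show ?thesis
      using "4.prems"(3) w by simp
  qed
next
  case (5 x y z k x' y' z')
  obtain l v where w: "w = l # v"
    using "5.prems"(5) by (cases w) auto
  have prems: "walk (l # u) (Nd x y z)" if "(p @ [l]) @ u \<in> L" for l u
    using "5.prems"(2) that by simp
  have "(p @ [l]) @ v \<in> L"
  proof (cases l)
    case A
    show ?thesis
      unfolding A by (rule "5.IH"(1))
        (use "5.prems" prems[of A] w A in \<open>auto simp: mem_kid\<close>)
  next
    case B
    show ?thesis
      unfolding B by (rule "5.IH"(2))
        (use "5.prems" prems[of B] w B in \<open>auto simp: mem_kid\<close>)
  next
    case C
    show ?thesis
      unfolding C by (rule "5.IH"(3))
        (use "5.prems" prems[of C] w C in \<open>auto simp: mem_kid\<close>)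
  qed
  then show ?case
    using w by simp
qed auto

text \<open>One \<open>walk\<close> sees only the beginning of a word. Testing all suffixes brings
  every window of the depth of the trie into view.\<close>

fun allw :: "trie \<Rightarrow> letter list \<Rightarrow> bool" where
  "allw t [] = True"
| "allw t (l # w) = (if walk (l # w) t then allw t w else False)"

lemma allw_if_in:
  assumes "lang L" "ub L t"
  shows "y \<in> L \<Longrightarrow> allw t y"
proof (induction y)
  case (Cons l y)
  then show ?case
    using assms lang_factor[OF assms(1), of "[l]" y "[]"] by (auto simp: ub_def)
qed simp

section \<open>Recognising codings by return words\<close>

definition dir :: "bool \<Rightarrow> letter list \<Rightarrow> letter list" where
  "dir r w = (if r then rev w else w)"

lemma dir_dir [simp]: "dir r (dir r w) = w" "length (dir r w) = length w"
  by (auto simp: dir_def)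

lemma admissible_dir:
  assumes "admissible c L"
  shows "admissible c (dir r ` L)"
proof (cases r)
  case True
  then show ?thesis
    using admissible_rev[OF assms] by (simp add: dir_def[abs_def])
next
  case False
  then show ?thesis
    using assms by (simp add: dir_def[abs_def])
qed

fun has_power :: "letter list \<Rightarrow> bool" where
  "has_power [] = False"
| "has_power (l # w) =
     (if power_prefix 1 (l # w) then True else if power_prefix 2 (l # w) then True
      else if power_prefix 3 (l # w) then True else if power_prefix 4 (l # w) then True
      else has_power w)"

lemma has_power_notin:
  assumes "lang L" "low c L" "c < 5 / 2"
  shows "has_power s \<Longrightarrow> s \<notin> L"
proof (induction s)
  case (Cons l s)
  show ?case
  proof (cases "has_power s")
    case True
    then show ?thesis
      using Cons lang_factor[OF assms(1), of "[l]" s "[]"] by auto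
  next
    case False
    then show ?thesis
      using Cons.prems power_prefix_notin[OF assms, of _ "l # s"]
      by (auto simp del: power_prefix.simps split: if_splits)
  qed
qed simp

text \<open>The list \<open>f # fs\<close> serves only as a bound on the recursion depth.\<close>

fun ret_right :: "trie \<Rightarrow> bool \<Rightarrow> letter list list \<Rightarrow> 'a list \<Rightarrow> letter list \<Rightarrow> bool" where
  "ret_right t r R [] x = False"
| "ret_right t r R (f # fs) x = list_all (\<lambda>l. if allw t (dir r (x @ [l])) then
      if x @ [l] \<in> set R then True else ret_right t r R fs (x @ [l]) else True) [A, B, C]"

fun ret_left :: "trie \<Rightarrow> bool \<Rightarrow> letter list list \<Rightarrow> 'a list \<Rightarrow> letter list \<Rightarrow> bool" where
  "ret_left t r R [] x = False"
| "ret_left t r R (f # fs) x = list_all (\<lambda>l. if allw t (dir r (l # x)) then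
      if l # x \<in> set R then True else ret_left t r R fs (l # x) else True) [A, B, C]"

text \<open>The recursion follows every letter the trie allows until a listed word is completed, so
  the actual continuation of \<open>x\<close> must complete one as well.\<close>

lemma ret_right_sound:
  assumes "lang M" "\<And>y. y \<in> M \<Longrightarrow> allw t (dir r y)"
  shows "ret_right t r R fs x \<Longrightarrow> z @ x \<in> M \<Longrightarrow> \<exists>e. x @ e \<in> set R \<and> z @ x @ e \<in> M"
proof (induction fs arbitrary: x)
  case (Cons f fs)
  obtain l where l: "z @ (x @ [l]) \<in> M"
    using lang_right[OF assms(1) Cons.prems(2)] by auto
  then have "allw t (dir r (x @ [l]))"
    using assms lang_factor[OF assms(1), of z "x @ [l]" "[]"] by auto
  then have "x @ [l] \<in> set R \<or> ret_right t r R fs (x @ [l])"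
    using Cons.prems(1) by (cases l) (auto split: if_splits)
  then show ?case
  proof
    assume "ret_right t r R fs (x @ [l])"
    from Cons.IH[OF this l] obtain e where "(x @ [l]) @ e \<in> set R" "z @ (x @ [l]) @ e \<in> M"
      by blast
    then show ?thesis
      by (intro exI[of _ "l # e"]) auto
  qed (use l in auto)
qed simp

lemma ret_left_sound:
  assumes "lang M" "\<And>y. y \<in> M \<Longrightarrow> allw t (dir r y)"
  shows "ret_left t r R fs x \<Longrightarrow> x @ z \<in> M \<Longrightarrow> \<exists>e. e @ x \<in> set R \<and> e @ x @ z \<in> M"
proof (induction fs arbitrary: x)
  case (Cons f fs)
  obtain l where l: "(l # x) @ z \<in> M"
    using lang_left[OF assms(1) Cons.prems(2)] by auto
  then have "allw t (dir r (l # x))"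
    using assms lang_factor[OF assms(1), of "[]" "l # x" z] by auto
  then have "l # x \<in> set R \<or> ret_left t r R fs (l # x)"
    using Cons.prems(1) by (cases l) (auto split: if_splits)
  then show ?case
  proof
    assume "ret_left t r R fs (l # x)"
    from Cons.IH[OF this l] obtain e where "e @ l # x \<in> set R" "e @ (l # x) @ z \<in> M"
      by blast
    then show ?thesis
      by (intro exI[of _ "e @ [l]"]) auto
  qed (use l in \<open>auto intro: exI[of _ "[l]"]\<close>)
qed simp

fun pick :: "'a \<Rightarrow> 'a \<Rightarrow> 'a \<Rightarrow> letter \<Rightarrow> 'a" where
  "pick x y z A = x"
| "pick x y z B = y"
| "pick x y z C = z"

text \<open>\<open>f\<close>, \<open>g\<close>, \<open>h\<close> are the proposed images of A, B, C,
  and \<open>v\<close> is the initial right context. The trie describes the original language while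
  the coding is read in its image under \<open>dir r\<close>, hence \<open>dir r\<close> in the
  lookups. The last list consists of the images of AA, BB, CC, CB and BAB, the words forbidden by
  \<open>core\<close>.\<close>

definition match :: "trie \<Rightarrow> trie \<Rightarrow> bool \<Rightarrow> letter list \<Rightarrow> letter list
    \<Rightarrow> letter list \<Rightarrow> letter list \<Rightarrow> letter list \<Rightarrow> bool" where
  "match s t r x v f g h \<longleftrightarrow>
     mem x s \<and> take (length v) (dir r x) = v
     \<and> list_all (\<lambda>y. y \<noteq> [] \<and> take (length v) (y @ v) = v) [f, g, h]
     \<and> length g \<le> length f + 2 * length v \<and> length h \<le> length f + 2 * length v
     \<and> length h \<le> length g + 2 * length v
     \<and> ret_right t r [f @ v, g @ v, h @ v] (f @ g @ h) v
     \<and> ret_left t r [f @ v, g @ v, h @ v] (f @ g @ h) v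
     \<and> list_all (\<lambda>y. if allw t (dir r (y @ v)) then has_power (y @ v) else True)
          [f @ f, g @ g, h @ h, h @ g, g @ f @ g]"

text \<open>The words that decode into the language form a core language: each occurrence of
  \<open>v\<close> continues on either side by one of the three return words, and factors are
  inherited because \<open>v\<close> begins every suffix of a decoded word. The left context starts
  out empty.\<close>

lemma match_sound:
  assumes "admissible c L" "c < mu" "lb L s" "ub L t" "match s t r x v f g h"
  shows False
proof -
  define M where "M = dir r ` L"
  have "admissible c M"
    using admissible_dir[OF assms(1)] by (simp add: M_def)
  then have M: "lang M" "low c M" and L: "lang L"
    using assms(1) by (auto simp: admissible_def)
  have c: "c < 5 / 2"
    using assms(2) mu_bounds(2) by simp
  have poss: "allw t (dir r y)" if "y \<in> M" for y
    using that allw_if_in[OF L assms(4)] by (auto simp: M_def)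
  define F where "F = pick f g h"
  have F: "F A = f" "F B = g" "F C = h"
    by (simp_all add: F_def)
  note m = assms(5)[unfolded match_def]
  have ne: "F l \<noteq> []" and pre: "prefix v (F l @ v)" for l
  proof -
    have "F l \<noteq> [] \<and> take (length v) (F l @ v) = v"
      using m by (cases l) (auto simp: F)
    then show "F l \<noteq> []" "prefix v (F l @ v)"
      by (blast, metis take_is_prefix)
  qed
  note preh = prefix_hom_append[where F = F and V = v, OF pre]
  define N where "N = {u. hom F u @ v \<in> M}"
  have "v \<in> M"
  proof -
    have "dir r x \<in> M"
      using m assms(3) by (auto simp: M_def lb_def)
    then show ?thesis
      using m lang_sublist[OF M(1)] by (metis sublist_take)
  qed
  moreover have "y \<in> N" if "w \<in> N" "sublist y w" for y w
  proof -
    obtain p e where "w = p @ y @ e"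
      using \<open>sublist y w\<close> by (auto simp: sublist_def)
    moreover obtain Y where "hom F e @ v = v @ Y"
      using preh[of e] by (auto simp: prefix_def)
    ultimately have "hom F p @ (hom F y @ v) @ Y \<in> M"
      using \<open>w \<in> N\<close> by (simp add: N_def)
    then show ?thesis
      using lang_factor[OF M(1)] by (simp add: N_def)
  qed
  moreover have "\<exists>l. w @ [l] \<in> N" if "w \<in> N" for w
  proof -
    have "hom F w @ v \<in> M"
      using that by (simp add: N_def)
    then obtain e where e: "v @ e \<in> set [f @ v, g @ v, h @ v]" "hom F w @ v @ e \<in> M"
      using ret_right_sound[OF M(1) poss] m by blast
    then obtain l where "v @ e = F l @ v"
      using F by auto
    then show ?thesis
      using e(2) by (auto simp: N_def)
  qed
  moreover have "\<exists>l. l # w \<in> N" if "w \<in> N" for w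
  proof -
    \<comment> \<open>For the left extension, the occurrence of \<open>v\<close> at the beginning of
      the decoded word is used instead of the one at its end.\<close>
    obtain z where z: "hom F w @ v = v @ z"
      using preh[of w] by (auto simp: prefix_def)
    then have "v @ z \<in> M"
      using that by (simp add: N_def)
    then obtain e where e: "e @ v \<in> set [f @ v, g @ v, h @ v]" "e @ v @ z \<in> M"
      using ret_left_sound[OF M(1) poss] m by blast
    then obtain l where "e = F l"
      using F by auto
    then show ?thesis
      using e(2) z by (auto simp: N_def)
  qed
  ultimately have N: "lang N"
    unfolding lang_def by (auto simp: N_def)
  have bad: "y @ v \<notin> M" if "y \<in> {f @ f, g @ g, h @ h, h @ g, g @ f @ g}" for y
  proof
    assume "y @ v \<in> M"
    then have "has_power (y @ v)"
      using m that poss[of "y @ v"] by auto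
    then show False
      using has_power_notin[OF M c] \<open>y @ v \<in> M\<close> by blast
  qed
  have "core N"
    using N bad[of "f @ f"] bad[of "g @ g"] bad[of "h @ h"] bad[of "h @ g"] bad[of "g @ f @ g"]
    by (simp add: core_def N_def F)
  then have "coded M F [] v N"
    using ne pre by (simp add: coded_def N_def)
  moreover have "balanced F v"
    using m by (simp add: balanced_def F)
  ultimately show False
    using coded_contradiction[OF M assms(2)] by blast
qed

text \<open>\<sigma> and \<tau> are inverse renamings. The common length of the words of
  \<open>s\<close> is recorded because words of the transformed language are cut to it.\<close>

definition similar :: "(letter \<Rightarrow> letter) \<Rightarrow> (letter \<Rightarrow> letter) \<Rightarrow> bool \<Rightarrow> trie \<Rightarrow> trie \<Rightarrow> bool" where
  "similar \<sigma> \<tau> r s t \<longleftrightarrow>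
     list_all (\<lambda>l. \<sigma> (\<tau> l) = l \<and> \<tau> (\<sigma> l) = l) [A, B, C]
     \<and> list_all (\<lambda>u. length u = length (hd (words s)) \<and> mem (dir r (map \<sigma> u)) t) (words s)
     \<and> list_all (\<lambda>w. mem (map \<tau> (dir r w)) s) (words t)"

definition refuted :: "real \<Rightarrow> trie \<Rightarrow> bool" where
  "refuted c t \<longleftrightarrow> (\<forall>L. admissible c L \<longrightarrow> lb L t \<longrightarrow> ub L t \<longrightarrow> False)"

text \<open>Admissibility is invariant, so a refutation of \<open>t\<close> applies to the
  transformed language. Reversal turns prefixes into suffixes, so the upper bound cannot be carried
  along \<open>walk\<close>; it is rebuilt from whole words of length \<open>n\<close>.\<close>

lemma similar_refuted:
  assumes "similar \<sigma> \<tau> r s t" "refuted c t"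
  shows "refuted c s"
  unfolding refuted_def
proof (intro allI impI)
  fix L assume L: "admissible c L" "lb L s" "ub L s"
  then have lang: "lang L"
    by (simp add: admissible_def)
  define n where "n = length (hd (words s))"
  have inv: "\<sigma> (\<tau> l) = l" "\<tau> (\<sigma> l) = l" for l
    using assms(1) by (cases l; simp add: similar_def)+
  then have inj: "inj \<sigma>"
    by (metis injI)
  define M where "M = dir r ` map \<sigma> ` L"
  have M: "admissible c M"
    unfolding M_def by (intro admissible_dir admissible_map L inj)
  then have langM: "lang M"
    by (simp add: admissible_def)
  have "w \<in> M" if "mem w t" for w
  proof -
    have "mem (map \<tau> (dir r w)) s"
      using assms(1) that by (auto simp: similar_def list_all_iff mem_words)
    then have "map \<tau> (dir r w) \<in> L"
      using L(2) by (auto simp: lb_def)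
    moreover have "w = dir r (map \<sigma> (map \<tau> (dir r w)))"
      by (simp add: inv o_def)
    ultimately show ?thesis
      unfolding M_def by blast
  qed
  then have "lb M t"
    by (simp add: lb_def)
  moreover have "ub M t"
  proof (rule ub_if_long[OF langM])
    fix w assume w: "w \<in> M" "n \<le> length w"
    then have "take n w \<in> M"
      using lang_sublist[OF langM] by blast
    then obtain u where u: "u \<in> L" "take n w = dir r (map \<sigma> u)"
      by (auto simp: M_def)
    then have len: "length u = n"
      using w(2) by (metis dir_dir(2) length_map length_take min_absorb2)
    \<comment> \<open>Extending beyond the depth of the trie turns \<open>walk\<close> into
      membership of a prefix.\<close>
    obtain e where "length e = size s" "u @ e \<in> L"
      using lang_extend[OF lang u(1)] by blast
    then obtain p where p: "prefix p (u @ e)" "mem p s"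
      using walk_mem[of "u @ e" s] L(3) by (auto simp: ub_def)
    then have "length p = n" "mem (dir r (map \<sigma> p)) t"
      using assms(1) by (auto simp: similar_def list_all_iff mem_words n_def)
    moreover have "p = u"
      using p(1) \<open>length p = n\<close> len by (auto simp: prefix_def append_eq_append_conv)
    ultimately have "mem (take n w) t"
      using u(2) by simp
    then show "walk w t"
      using mem_walk by (metis append_take_drop_id)
  qed
  ultimately show False
    using assms(2) M by (auto simp: refuted_def)
qed

section \<open>Certificates\<close>

text \<open>A certificate refutes a state \<open>(s, t, k)\<close>: the words of length \<open>n\<close> in the language are exactly
  those of \<open>s\<close>, those of length \<open>n + 1\<close> are among \<open>t\<close> and include \<open>k\<close>. \<open>CloseR\<close> and \<open>CloseL\<close> point to
  a word of \<open>s\<close> without extension in \<open>t\<close>, \<open>Many\<close> to three pairs of siblings in \<open>k\<close>, which exceed the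
  admissible growth, and \<open>Dead\<close> to a word of \<open>k\<close> that is not extendable. \<open>Del\<close> removes such a word
  from \<open>t\<close>, \<open>Split\<close> decides whether a word belongs to the language, and \<open>Up\<close> passes to the next length.
  \<open>Match\<close> recognises a coding by return words, and \<open>Ref\<close> refers to a refuted state up to symmetry.\<close>

datatype cert =
    CloseR "letter list"
  | CloseL "letter list"
  | Many "(letter list \<times> letter list) list"
  | Dead "letter list" ext
  | Del "letter list" ext cert
  | Split "letter list" cert cert
  | Up cert
  | Match bool "letter list" "letter list" "letter list" "letter list" "letter list"
  | Ref nat letter letter letter letter letter letter bool

text \<open>Only the first components must be pairwise distinct. A second component may be shared,
  so a word with three extensions can provide two of the pairs.\<close>

definition many :: "trie \<Rightarrow> (letter list \<times> letter list) list \<Rightarrow> bool" where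
  "many k ps \<longleftrightarrow> (case map fst ps of
      [u, v, w] \<Rightarrow> u \<noteq> v \<and> u \<noteq> w \<and> v \<noteq> w \<and> u \<noteq> [] \<and>
        list_all (\<lambda>(z, y). mem z k \<and> mem y k \<and> butlast z = butlast y \<and> length z = length u
           \<and> length y = length u \<and> y \<noteq> u \<and> y \<noteq> v \<and> y \<noteq> w) ps
    | _ \<Rightarrow> False)"

text \<open>Removing the last letter sends the three first components onto prefixes of their
  siblings. The listed words therefore outnumber their prefixes by at least three, against
  \<open>thin_card\<close>.\<close>

lemma many_sound:
  assumes "lang L" "thin L" "lb L k" "many k ps"
  shows False
proof -
  obtain u v w where zs: "map fst ps = [u, v, w]"
    using assms(4) by (auto simp: many_def split: list.splits)
  note m = assms(4)[unfolded many_def zs list.case]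
  define Y where "Y = snd ` set ps"
  have Z: "fst ` set ps = {u, v, w}"
    using zs by (metis list.set_map list.simps(15) empty_set)
  have fin: "finite Y"
    by (simp add: Y_def)
  have in_L: "x \<in> L" if "mem x k" for x
    using assms(3) that by (simp add: lb_def)
  have all: "z \<in> L \<and> y \<in> L \<and> butlast z = butlast y \<and> length z = length u \<and> length y = length u
      \<and> y \<notin> {u, v, w}" if "(z, y) \<in> set ps" for z y
    using m that in_L by (auto simp: list_all_iff)
  have sub: "{u, v, w} \<union> Y \<subseteq> {x \<in> L. length x = Suc (length u - 1)}"
    using all m unfolding Z[symmetric] Y_def by fastforce
  have disj: "{u, v, w} \<inter> Y = {}"
    using all unfolding Y_def by fastforce
  have "butlast ` ({u, v, w} \<union> Y) \<subseteq> butlast ` Y"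
    using all unfolding Z[symmetric] Y_def by (auto simp: image_iff) (metis snd_conv)
  then have "card (butlast ` ({u, v, w} \<union> Y)) \<le> card Y"
    using fin card_image_le card_mono order_trans by (metis finite_imageI)
  moreover have "card ({u, v, w} \<union> Y) = 3 + card Y"
    using disj fin m by (subst card_Un_disjoint) auto
  ultimately show False
    using thin_card[OF assms(1,2) sub] by simp
qed

text \<open>In a \<open>Split\<close> the first certificate handles the absence of \<open>y\<close>,
  the second its presence. \<open>Up\<close> restarts with an empty third trie because nothing is
  known yet about the new length.\<close>

fun check :: "trie list \<Rightarrow> cert \<Rightarrow> trie \<Rightarrow> trie \<Rightarrow> trie \<Rightarrow> bool" where
  "check env (CloseR x) s t k = (mem x s \<and> \<not> walk x t)"
| "check env (CloseL x) s t k =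
     (mem x s \<and> \<not> walk (A # x) t \<and> \<not> walk (B # x) t \<and> \<not> walk (C # x) t)"
| "check env (Many ps) s t k = many k ps"
| "check env (Dead y e) s t k = (mem y k \<and> dead t y e)"
| "check env (Del y e c) s t k = (dead t y e \<and> check env c s (del y t) k)"
| "check env (Split y c d) s t k = (check env c s (del y t) k \<and> check env d s t (ins y k))"
| "check env (Up c) s t k = (known t k s \<and> check env c t (grow t) Em)"
| "check env (Match r x v f g h) s t k = match s t r x v f g h"
| "check env (Ref i a b c a' b' c' r) s t k =
     (i < length env \<and> similar (pick a b c) (pick a' b' c') r s (env ! i))"

lemma check_sound:
  assumes "admissible c L" "c < mu" "\<And>u. u \<in> set env \<Longrightarrow> refuted c u"
  shows "check env d s t k \<Longrightarrow> lb L s \<Longrightarrow> ub L s \<Longrightarrow> ub L t \<Longrightarrow> lb L k \<Longrightarrow> False"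
proof -
  have lang: "lang L" and c: "c < 5 / 2"
    using assms(1,2) mu_bounds(2) by (auto simp: admissible_def)
  have dead: "y \<notin> L" if "ub L t" "dead t y e" for y e t
    using dead_notin(1)[OF lang _ c that] assms(1) by (simp add: admissible_def)
  show "check env d s t k \<Longrightarrow> lb L s \<Longrightarrow> ub L s \<Longrightarrow> ub L t \<Longrightarrow> lb L k \<Longrightarrow> False"
  proof (induction d arbitrary: s t k)
    case (CloseR x)
    then show ?case
      by (auto simp: lb_def ub_def)
  next
    case (CloseL x)
    then have "x \<in> L"
      by (auto simp: lb_def)
    then obtain l where "l # x \<in> L"
      using assms(1) lang_left by (auto simp: admissible_def)
    then show ?case
      using CloseL by (cases l) (auto simp: ub_def)
  next
    case (Many ps)
    then show ?case
      using many_sound assms(1) by (auto simp: admissible_def)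
  next
    case (Dead y e)
    then show ?case
      using dead assms(1) by (auto simp: lb_def)
  next
    case (Del y e d)
    then have "ub L (del y t)"
      using dead ub_del[OF lang] by auto
    then show ?case
      using Del by auto
  next
    case (Split y d1 d2)
    show ?case
    proof (cases "y \<in> L")
      case True
      then have "lb L (ins y k)"
        using Split.prems lb_ins by blast
      then show ?thesis
        using Split by auto
    next
      case False
      then have "ub L (del y t)"
        using Split.prems ub_del[OF lang] by blast
      then show ?thesis
        using Split by auto
    qed
  next
    case (Up d)
    have "lb L t"
      using known_sound[OF lang, of t k s "[]"] Up.prems by (auto simp: lb_def ub_def)
    moreover have "lb L Em"
      by (simp add: lb_def)
    ultimately show ?case
      using Up ub_grow[OF lang] by auto
  next
    case (Match r x v f g h)
    then show ?case
      using match_sound assms(1,2) by auto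
  next
    case (Ref i a1 a2 a3 b1 b2 b3 r)
    then have "env ! i \<in> set env" "similar (pick a1 a2 a3) (pick b1 b2 b3) r s (env ! i)"
      by auto
    then have "refuted c s"
      using similar_refuted assms(3) by blast
    then show ?case
      using Ref.prems assms(1) by (auto simp: refuted_def)
  qed
qed

lemma check_refuted:
  assumes "check env d s (grow s) Em" "c < mu" "\<And>u. u \<in> set env \<Longrightarrow> refuted c u"
  shows "refuted c s"
  unfolding refuted_def
proof (intro allI impI)
  fix L assume L: "admissible c L" "lb L s" "ub L s"
  then have "ub L (grow s)"
    using ub_grow by (auto simp: admissible_def)
  moreover have "lb L Em"
    by (simp add: lb_def)
  ultimately show False
    using check_sound[OF L(1) assms(2,3) assms(1) L(2,3)] by blast
qed

section \<open>The search tree\<close>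

text \<open>\<open>leveln_i\<close> is the set \<open>L\<^sub>n\<close> in the \<open>i\<close>-th case of the search.\<close>

definition level3_1 :: trie where
  "level3_1 = tries [[B,B,C], [B,C,B], [B,C,C], [C,B,B], [C,B,C], [C,C,B]]"

text \<open>The Thue-Morse language has these factors of length three and no exponent above 2, so
  powers alone cannot refute this case. It is excluded because its ten words of length four exceed
  the eight allowed.\<close>

lemma refuted_level3_1:
  assumes "c < mu"
  shows "refuted c level3_1"
proof (rule check_refuted[OF _ assms])
  show "check [] (Split [B,B,C,B] (Del [B,C,B,C] (X[P 2]) (Del [B,C,B,B] (X[X[X[X[X[X[X[X[X[X[X[P 6], X[X[P
3]]]]]], X[X[X[P 4], X[X[X[X[X[X[X[X[X[X[X[X[P 6], X[X[X[P 4], X[X[X[X[X[X[X[X[P 13]]], X[X[X[P 4], X[P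
7]]]]], P 3]]]]]]], X[X[P 3]]]]]], X[X[X[P 4], X[P 7]]]]], P 3]]]]]]], X[X[P 3]]]]]]) (CloseR [B,C,B])))
(Split [B,B,C,C] (Del [C,C,B,B] (X[X[X[X[X[X[X[X[P 3], X[P 2,X[X[X[X[X[X[X[X[P 3], X[P 2,X[P 8]]],
X[X[X[X[X[X[X[X[P 3], X[P 2,X[X[X[X[X[X[X[X[P 3], X[P 2,X[P 8]]], X[X[X[P 14,X[X[P 3]]]]]]], P 2], X[P
3]]]]]], P 6]], P 2], X[X[P 3]]]]]]], P 2], X[P 3]]]]]], X[X[X[X[X[P 6], P 2], X[X[P 3]]]]]]], P 2], X[X[P
3]]]]]) (Dead [B,B,C,B] (X[X[X[X[P 3], X[P 2,X[X[X[X[X[X[X[X[P 3], X[P 2,X[X[X[X[P 8,P 2], X[P 3]]]]]]]], P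
2], X[P 3]]]]]]]]))) (Split [B,C,B,B] (Del [B,C,B,C] (X[X[X[X[X[X[X[X[P 4]]], X[X[X[X[X[X[X[X[X[P 4]]], P
6]]]], P 2], X[X[X[X[X[X[X[P 4], X[X[X[X[X[X[X[X[X[P 4]]], X[X[P 6,P 2], X[X[X[X[X[X[X[P 4], X[X[X[X[P 13]], P
2], X[X[X[P 7], P 3]]]]]]], P 3]]]]]]], P 2], X[X[X[P 7], P 3]]]]]]], P 3]]]]]]], P 2]) (CloseR [B,C,B]))
(Split [C,B,C,C] (Del [C,B,C,B] (X[P 2,X[X[X[X[X[X[X[P 3,X[X[X[X[X[X[X[P 3,X[P 7]]], X[P 2,X[X[X[X[X[X[X[P
3,X[X[X[X[X[X[X[P 3,X[P 7]]], X[P 2,X[X[P 13]]]], X[P 4]]]]]]], X[P 2,P 6]], X[X[X[P 4]]]]]]]]], X[P 4]]]]]]],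
X[P 2,X[X[X[X[P 6,X[X[X[P 4]]]]]]]]], X[X[X[P 4]]]]]]]]) (CloseR [C,B,C])) (Split [C,B,C,B] (Split [B,C,B,C]
(Dead [B,C,B,B] (X[X[X[X[P 3], X[X[X[X[X[X[X[P 3,X[X[X[X[P 7,X[P 4]]], X[X[X[X[X[X[X[X[P 3,X[X[X[X[X[X[X[P
3,X[P 7]]]], X[P 4]]], X[X[X[P 10,P 3]]]]]]]], X[X[X[P 4], X[X[X[X[P 7], P 3]]]]]]], P 3]]]]]]]], X[P 4]]],
X[X[X[X[X[X[X[X[P 3,X[X[X[X[X[X[X[P 3,X[P 7]]]], X[P 4]]], X[X[X[X[X[X[P 10], X[X[X[P 4], X[X[X[X[P 7], P
3]]]]]]], P 3]]]]]]]], X[X[X[P 4], X[X[X[X[P 7], P 3]]]]]]], P 3]]]]]]]])) (Split [C,C,B,B] (Dead [B,B,C,B]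
(X[X[X[X[P 3]]]])) (Split [C,C,B,C] (Dead [C,B,C,C] (X[X[X[X[X[X[P 3]], X[X[X[X[X[X[X[P 3,X[X[X[X[X[P 7], X[P
4]]], X[X[X[X[X[X[P 3]], X[X[X[X[X[X[X[P 3,X[X[X[X[X[P 7], X[P 4]]], X[X[X[P 13]]]]]]]], X[P 4]]], X[P
6]]]]]]]]]]]], X[P 4]]], X[X[X[X[X[X[P 3]], X[P 6]]]]]]]]]]])) (Many [([B,B,C,C], [B,B,C,B]),([B,C,B,C],
[B,C,B,B]),([C,C,B,C], [C,C,B,B])])))) (Split [B,C,B,C] (Split [C,C,B,C] (CloseL [C,B,C]) (Split [C,C,B,B]
(Dead [B,B,C,C] (X[X[X[X[X[P 3]], X[X[X[X[X[X[X[X[P 3]], X[X[P 6]]]]], X[X[P 3]]]]]]]])) (Many [([B,B,C,C],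
[B,B,C,B]),([C,B,C,C], [C,B,C,B]),([C,C,B,B], [C,C,B,C])]))) (Many [([B,B,C,C], [B,B,C,B]),([C,B,C,C],
[C,B,C,B]),([B,C,B,C], [B,C,B,B])]))))))) level3_1 (grow level3_1) Em"
    by code_simp
qed simp

definition level2_1 :: trie where
  "level2_1 = tries [[B,B], [B,C], [C,B], [C,C]]"

lemma refuted_level2_1:
  assumes "c < mu"
  shows "refuted c level2_1"
proof (rule check_refuted[OF _ assms])
  show "check [level3_1] (Del [B,B,B] (P 1) (Del [C,C,C] (P 1) (Split [B,C,C] (CloseL [C,C]) (Split [C,B,B]
(CloseL [B,B]) (Split [B,C,B] (Del [B,B,C] (X[X[X[X[X[X[X[P 4]]], X[X[X[X[X[X[X[X[P 4], X[X[X[X[P 7], P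
3]]]]]]], P 3]]]]]]]) (CloseR [B,B])) (Split [C,B,C] (Dead [B,C,B] (X[X[X[X[X[P 3]], X[X[X[X[X[X[X[P
3,X[X[X[X[X[P 7], X[P 4]]]]]]]], X[P 4]]]]]]]])) (Up (Ref 0 A B C A B C False)))))))) level2_1 (grow level2_1) Em"
    by code_simp
qed (auto simp: refuted_level3_1[OF assms])

definition level1_1 :: trie where
  "level1_1 = tries [[B], [C]]"

lemma refuted_level1_1:
  assumes "c < mu"
  shows "refuted c level1_1"
proof (rule check_refuted[OF _ assms])
  show "check [level2_1] (Split [B,B] (Del [B,C] (X[X[X[P 2], X[X[X[X[P 2], X[P 3,P 1]]], P 1]]]) (CloseR [B]))
(Split [B,C] (Del [C,B] (X[X[P 1]]) (Dead [B,B] (X[P 1]))) (Split [C,B] (Dead [B,B] (X[P 1])) (Split [C,C]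
(Dead [B,B] (X[P 1,X[X[X[P 1,X[X[P 3,X[P 2]]]], X[P 2]]]])) (Up (Ref 0 A B C A B C False)))))) level1_1 (grow
level1_1) Em"
    by code_simp
qed (auto simp: refuted_level2_1[OF assms])

section \<open>Three letters, with A and B adjacent only to C\<close>

definition level4_1 :: trie where
  "level4_1 = tries [[A,C,B,C], [B,C,A,C], [B,C,C,A], [B,C,C,B], [C,A,C,B], [C,B,C,A], [C,B,C,C], [C,C,A,C],
[C,C,B,C]]"

text \<open>Three branches end in a coding: one in each reading direction by the words C, CA, CB
  returning to C, and one in the reversed language by BCACC, BCC, BCAC returning to B.\<close>

lemma refuted_level4_1:
  assumes "c < mu"
  shows "refuted c level4_1"
proof (rule check_refuted[OF _ assms])
  show "check [] (Split [C,B,C,C,A] (CloseL [B,C,C,A]) (Split [C,B,C,C,B] (CloseL [B,C,C,B]) (Split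
[A,C,B,C,A] (Split [C,C,B,C,A] (CloseL [C,B,C,A]) (Match True [A,C,B,C] [C] [C,B] [C,A] [C])) (Split
[A,C,B,C,C] (Del [B,C,C,B,C] (X[X[X[P 3]]]) (CloseR [B,C,C,B])) (Split [C,C,B,C,A] (Up (Del [C,C,B,C,C,B]
(X[X[P 3]]) (Split [A,C,B,C,C,B] (CloseL [C,B,C,C,B]) (Split [C,A,C,B,C,A] (CloseL [A,C,B,C,A]) (Split
[C,A,C,B,C,C] (CloseL [A,C,B,C,C]) (Split [A,C,B,C,C,A] (Del [B,C,A,C,B,C] (X[X[X[X[P
4,X[X[X[X[X[X[X[X[X[X[X[X[P 4,X[X[X[X[X[X[X[X[P 12,X[X[X[X[X[X[P 8]]]]]]]]]]]]]]]]]], X[X[X[X[X[X[P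
8]]]]]]]]]]]]]]]]]]) (CloseR [B,C,A,C,B])) (Up (Del [B,C,A,C,B,C,A] (X[X[X[P 4]]]) (Split [C,A,C,B,C,C,B]
(CloseL [A,C,B,C,C,B]) (Split [C,A,C,B,C,C,A] (CloseL [A,C,B,C,C,A]) (Split [C,C,A,C,B,C,A] (CloseL
[C,A,C,B,C,A]) (Split [C,C,A,C,B,C,C] (Del [A,C,B,C,C,A,C] (X[X[X[X[X[X[X[X[X[X[X[X[X[X[X[X[P 9]]]]]]],
X[X[X[X[X[X[X[X[X[X[X[X[X[X[X[X[X[X[X[X[X[P 9,X[X[X[X[X[X[X[X[X[X[X[X[X[X[X[X[P 21]]]], X[X[X[X[P
12]]]]]]]]]]]]]]]]]]]]]]]]], X[X[X[X[P 12]]]]]]]]]]]]]]]]]]]]]]]]]) (CloseR [A,C,B,C,C,A])) (Up (Split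
[B,C,C,A,C,B,C,A] (CloseL [C,C,A,C,B,C,A]) (Split [B,C,C,A,C,B,C,C] (CloseL [C,C,A,C,B,C,C]) (Split
[B,C,A,C,B,C,C,A] (Del [B,C,A,C,B,C,C,B] (X[X[X[X[X[X[X[X[X[X[X[P 5]]]], X[X[X[X[X[X[X[X[X[X[X[X[X[X[X[X[P
5]]]], X[X[X[P 12]]]]]]]]]], X[X[X[X[X[X[P 5]]], X[X[X[P 8]]]]]]]]]]]]]]]]]]) (CloseR [B,C,A,C,B,C,C])) (Split
[B,C,A,C,B,C,C,B] (Del [C,C,B,C,C,A,C,B] (X[X[X[X[X[X[X[X[X[X[X[X[X[X[X[X[X[X[X[X[X[X[P 9]]], X[X[P 5]]]],
X[X[X[X[X[X[X[X[X[X[X[X[X[X[X[X[X[X[X[X[X[X[P 9]]], X[X[P 5]]]], X[P 17]]]]]]]], X[P 5]]], X[X[X[P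
8]]]]]]]]]]]]]]]]]], X[P 5]]], X[X[X[X[P 8]]]]]]]]]]]]) (CloseR [C,C,B,C,C,A,C])) (Split [C,C,A,C,B,C,C,A] (Up
(Split [C,B,C,A,C,B,C,C,A] (CloseL [B,C,A,C,B,C,C,A]) (Split [C,B,C,A,C,B,C,C,B] (CloseL [B,C,A,C,B,C,C,B])
(Split [C,B,C,C,A,C,B,C,C] (CloseL [B,C,C,A,C,B,C,C]) (Split [C,B,C,C,A,C,B,C,A] (CloseL [B,C,C,A,C,B,C,A])
(Up (Split [A,C,B,C,A,C,B,C,C,A] (CloseL [C,B,C,A,C,B,C,C,A]) (Split [A,C,B,C,A,C,B,C,C,B] (CloseL
[C,B,C,A,C,B,C,C,B]) (Split [A,C,B,C,C,A,C,B,C,A] (Del [A,C,B,C,C,A,C,B,C,C]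
(X[X[X[X[X[X[X[X[X[X[X[X[X[X[X[X[X[X[X[X[X[X[X[X[X[P 12]]]]]]]]]]],
X[X[X[X[X[X[X[X[X[X[X[X[X[X[X[X[X[X[X[X[X[X[X[X[X[X[X[X[P 12]]]]]]]]]]], X[X[P 17]]]]]]]]]]]]]]]], X[X[X[P
8]]]]]]]]]]]]]]]]]]]]) (CloseR [A,C,B,C,C,A,C,B,C])) (Split [A,C,B,C,C,A,C,B,C,C] (Dead [A,C,B,C,C,A,C,B,C,A]
(X[X[X[X[X[X[X[X[X[X[X[X[X[P 9]]]], X[X[X[X[X[X[X[X[X[X[X[X[X[X[X[X[X[X[X[X[X[P 9,X[X[X[X[X[X[X[X[X[X[X[X[X[P
21], X[X[X[X[P 12]]]]]]]]]]], X[X[X[X[X[X[P 8]]]]]]]]]]]]]]]]]]]], X[X[X[X[P 12]]]]]]]]]]], X[X[X[X[X[X[P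
8]]]]]]]]]]]]]]]]]]]])) (Split [C,C,B,C,C,A,C,B,C,A] (Dead [A,C,B,C,A,C,B,C,C,A] (X[X[X[X[X[X[X[X[X[X[X[X[X[P
9]]]]]]]]]]]]])) (Split [C,C,B,C,C,A,C,B,C,C] (Match True [B,C,C,A,C,B,C,C,B] [B] [B,C,A,C,C] [B,C,C]
[B,C,A,C]) (Many [([A,C,B,C,C,A,C,B,C,C], [A,C,B,C,C,A,C,B,C,A]),([A,C,B,C,A,C,B,C,C,B],
[A,C,B,C,A,C,B,C,C,A]),([C,C,B,C,C,A,C,B,C,C], [C,C,B,C,C,A,C,B,C,A])]))))))))))))) (Split [C,C,A,C,B,C,C,B]
(Del [C,C,B,C,C,A,C,B] (X[X[X[X[X[X[X[X[X[X[X[X[X[X[X[X[X[X[X[X[X[P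
9,X[X[X[X[X[X[X[X[X[X[X[X[X[X[X[X[X[X[X[X[X[P 9,X[X[X[P 21]]]]]]]]]], X[X[P 5]]]], X[X[X[X[P
12]]]]]]]]]]]]]]]]]]]]]]], X[X[P 5]]]], X[X[X[X[X[X[X[X[X[X[P 12]]]]]]]]]]]]]]]]]]]]]]) (CloseR
[C,C,B,C,C,A,C])) (Many [([B,C,C,A,C,B,C,C], [B,C,C,A,C,B,C,A]),([B,C,A,C,B,C,C,B],
[B,C,A,C,B,C,C,A]),([C,C,A,C,B,C,C,B], [C,C,A,C,B,C,C,A])])))))))))))))))))))) (Split [C,C,B,C,C] (Match False
[C,A,C,B] [C] [C,B] [C] [C,A]) (Many [([A,C,B,C,C], [A,C,B,C,A]),([C,B,C,C,B], [C,B,C,C,A]),([C,C,B,C,C],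
[C,C,B,C,A])]))))))) level4_1 (grow level4_1) Em"
    by code_simp
qed simp

definition level3_2 :: trie where
  "level3_2 = tries [[A,C,B], [B,C,A], [B,C,C], [C,A,C], [C,B,C], [C,C,A], [C,C,B]]"

lemma refuted_level3_2:
  assumes "c < mu"
  shows "refuted c level3_2"
proof (rule check_refuted[OF _ assms])
  show "check [level4_1] (Split [B,C,C,A] (CloseL [C,C,A]) (Split [B,C,C,B] (CloseL [C,C,B]) (Split [C,B,C,A]
(CloseL [B,C,A]) (Split [C,B,C,C] (CloseL [B,C,C]) (Up (Ref 0 A B C A B C False)))))) level3_2 (grow level3_2) Em"
    by code_simp
qed (auto simp: refuted_level4_1[OF assms])

definition level4_2 :: trie where
  "level4_2 = tries [[A,C,C,A], [A,C,C,B], [B,C,A,C], [B,C,C,B], [C,A,C,C], [C,B,C,A], [C,B,C,C], [C,C,A,C],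
[C,C,B,C]]"

lemma refuted_level4_2:
  assumes "c < mu"
  shows "refuted c level4_2"
proof (rule check_refuted[OF _ assms])
  show "check [] (Split [C,C,B,C,A] (CloseL [C,B,C,A]) (Split [C,C,B,C,C] (CloseL [C,B,C,C]) (Split
[C,A,C,C,A] (CloseL [A,C,C,A]) (Split [C,A,C,C,B] (CloseL [A,C,C,B]) (Up (Del [B,C,C,B,C,C] (X[X[P 3]]) (Del
[C,C,A,C,C,A] (X[X[P 3]]) (Split [A,C,C,B,C,C] (CloseL [C,C,B,C,C]) (Split [B,C,A,C,C,A] (CloseL [C,A,C,C,A])
(Split [A,C,C,B,C,A] (Del [A,C,C,A,C,C] (X[X[X[X[X[X[X[X[X[X[X[X[X[X[X[X[X[P 8]]]]]]],
X[X[X[X[X[X[X[X[X[X[X[X[X[X[X[X[X[X[P 8]]]]]]], X[P 11]]]]]]]]]]]]]]]]]]]]]]) (CloseR [A,C,C,A,C])) (Split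
[B,C,A,C,C,B] (Dead [A,C,C,B,C,A] (X[X[X[X[X[X[X[X[X[X[X[X[X[X[P 8]]]]]],
X[X[X[X[X[X[X[X[X[X[X[X[X[X[X[X[X[X[P 8]]]]]]], X[X[X[X[P 11]]]]]]]]]]]]]]]]]]]]]]])) (Up (Split
[C,B,C,A,C,C,B] (CloseL [B,C,A,C,C,B]) (Split [C,B,C,A,C,C,A] (CloseL [B,C,A,C,C,A]) (Split [C,A,C,C,B,C,A]
(CloseL [A,C,C,B,C,A]) (Split [C,A,C,C,B,C,C] (CloseL [A,C,C,B,C,C]) (Up (Split [C,C,B,C,A,C,C,A] (CloseL
[C,B,C,A,C,C,A]) (Split [C,C,B,C,A,C,C,B] (CloseL [C,B,C,A,C,C,B]) (Split [B,C,A,C,C,B,C,A] (Del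
[A,C,C,B,C,A,C,C] (X[X[X[X[X[X[X[X[X[X[X[X[P 8]]]], X[X[X[X[X[X[X[X[X[X[X[X[X[X[X[X[X[X[X[X[P 8]]]],
X[X[X[X[X[X[X[X[P 16,X[X[X[X[P 8]]]]]]], X[X[X[X[X[X[X[X[X[X[X[X[X[P 8]]]]]]], X[X[X[X[P
11]]]]]]]]]]]]]]]]]]]]]]], X[X[X[X[P 8]]]]]]], X[X[X[X[X[X[X[X[X[X[X[X[X[P 8]]]]]]], X[X[X[X[P
11]]]]]]]]]]]]]]]]]]]]]]]) (CloseR [A,C,C,B,C,A,C])) (Split [B,C,A,C,C,B,C,C] (Del [B,C,C,B,C,A,C,C]
(X[X[X[X[X[X[X[X[X[X[X[X[X[X[X[X[P 5,X[X[X[X[X[X[X[X[X[X[X[X[X[X[X[X[P 5,P 16]]], X[X[X[X[X[P 8]]]]]]],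
X[X[X[X[X[X[X[X[X[P 11]]]]]]]]]]]]]]]]]]]]]]], X[X[X[X[X[P 8]]]]]]], X[X[X[X[X[X[X[X[X[P
11]]]]]]]]]]]]]]]]]]]]) (CloseR [B,C,C,B,C,A,C])) (Split [C,C,A,C,C,B,C,A] (Del [A,C,C,B,C,A,C,C] (X[X[X[X[X[P
5,X[X[X[X[X[X[X[X[X[X[X[P 5]]], X[X[P 8]]]]], X[X[X[X[X[X[X[X[X[X[X[P 5,X[X[X[X[X[X[X[X[X[X[X[P 5]]], X[X[P
8]]]]], X[X[X[X[X[X[P 16,X[X[X[X[X[X[X[X[X[X[X[P 5]]], X[X[X[X[P 8]]]]]]], X[X[X[X[P
11]]]]]]]]]]]]]]]]]]]]]]]]], X[X[X[X[X[X[X[X[X[X[X[P 5]]], X[X[X[X[P 8]]]]]]], X[X[X[X[P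
11]]]]]]]]]]]]]]]]]]]]]]]]]) (CloseR [A,C,C,B,C,A,C])) (Split [C,C,A,C,C,B,C,C] (Up (Split [C,B,C,A,C,C,B,C,A]
(CloseL [B,C,A,C,C,B,C,A]) (Split [C,B,C,A,C,C,B,C,C] (CloseL [B,C,A,C,C,B,C,C]) (Split [A,C,C,B,C,A,C,C,A]
(Del [A,C,C,B,C,A,C,C,B] (X[X[X[X[P 5]], X[X[X[X[X[X[X[X[X[X[X[X[X[X[X[X[X[P 5], X[X[X[X[X[X[X[X[X[X[X[X[X[P
16]]]]]]]]]]]]]]], X[X[X[X[P 8]]]]]]]]]]]]]]]]]]]]) (CloseR [A,C,C,B,C,A,C,C])) (Split [A,C,C,B,C,A,C,C,B]
(Del [A,C,C,B,C,C,B,C,A] (X[X[X[X[X[X[X[X[X[X[X[P 8]]]]]]]]]]]) (CloseR [A,C,C,B,C,C,B,C])) (Split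
[B,C,C,B,C,A,C,C,A] (Del [B,C,A,C,C,B,C,A,C] (X[X[X[X[P 5], X[X[X[X[X[X[X[X[X[X[X[P 5],
X[X[X[X[X[X[X[X[X[X[X[P 5,X[X[X[X[X[X[X[X[X[X[X[P 5], X[X[X[X[X[X[X[X[X[X[P 21]], X[X[P 8]]]]]]]]]]]], X[X[P
8]]]]]]]]]]]]], X[X[P 8]]]]]]]]]]]], X[X[P 8]]]]]]]]]]]]]) (CloseR [B,C,A,C,C,B,C,A])) (Split
[B,C,C,B,C,A,C,C,B] (Del [B,C,A,C,C,B,C,A,C] (X[X[X[X[P 5]]]]) (CloseR [B,C,A,C,C,B,C,A])) (Many
[([A,C,C,B,C,A,C,C,B], [A,C,C,B,C,A,C,C,A]),([C,B,C,A,C,C,B,C,C], [C,B,C,A,C,C,B,C,A]),([B,C,C,B,C,A,C,C,B],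
[B,C,C,B,C,A,C,C,A])])))))))) (Many [([C,C,B,C,A,C,C,B], [C,C,B,C,A,C,C,A]),([B,C,A,C,C,B,C,C],
[B,C,A,C,C,B,C,A]),([C,C,A,C,C,B,C,C], [C,C,A,C,C,B,C,A])])))))))))))))))))))))))) level4_2 (grow level4_2) Em"
    by code_simp
qed simp

definition level3_3 :: trie where
  "level3_3 = tries [[A,C,C], [B,C,A], [B,C,C], [C,A,C], [C,B,C], [C,C,A], [C,C,B]]"

lemma refuted_level3_3:
  assumes "c < mu"
  shows "refuted c level3_3"
proof (rule check_refuted[OF _ assms])
  show "check [level4_2] (Split [C,B,C,A] (CloseL [B,C,A]) (Split [C,B,C,C] (CloseL [B,C,C]) (Split [A,C,C,A]
(Split [B,C,C,A] (CloseL [C,C,A]) (Match True [A,C,C] [C] [C] [C,A] [C,B])) (Split [A,C,C,B] (Del [B,C,C,B]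
(X[X[X[X[P 3]]]]) (CloseL [C,C,B])) (Split [B,C,C,A] (Up (Ref 0 A B C A B C False)) (Split [B,C,C,B] (Match
False [C,A,C] [C] [C] [C,B] [C,A]) (Many [([A,C,C,B], [A,C,C,A]),([C,B,C,C], [C,B,C,A]),([B,C,C,B],
[B,C,C,A])]))))))) level3_3 (grow level3_3) Em"
    by code_simp
qed (auto simp: refuted_level4_2[OF assms])

definition level2_2 :: trie where
  "level2_2 = tries [[A,C], [B,C], [C,A], [C,B], [C,C]]"

lemma refuted_level2_2:
  assumes "c < mu"
  shows "refuted c level2_2"
proof (rule check_refuted[OF _ assms])
  show "check [level3_2, level3_3] (Del [C,C,C] (P 1) (Split [A,C,C] (Split [B,C,C] (CloseL [C,C]) (Split [A,C,B] (Del
[C,C,B] (X[X[X[X[P 2], X[X[P 3]]]]]) (Del [B,C,A] (X[X[X[P 2]]]) (Del [B,C,B] (X[X[P 2]]) (CloseL [C,B]))))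
(Split [B,C,A] (Del [C,C,B] (X[X[X[X[X[X[P 2], X[X[X[X[X[X[P 2], X[P 5]]], X[P 2], X[X[X[X[X[X[P 2],
X[X[X[X[X[X[P 2], X[P 5]]], X[P 2], X[P 8]]]]]], X[P 2], P 3]]]]]]]], X[P 2], X[X[P 3]]]]]) (Del [A,C,A]
(X[X[P 2,X[X[X[X[X[X[P 2], X[X[X[X[P 5], X[P 2]]]]]], X[P 2]]]]]]) (Dead [A,C,B] (X[X[X[X[X[X[X[X[X[X[P 5,X[P
2]]]]]], X[P 2]]]]]])))) (Split [C,C,A] (Dead [A,C,B] (X[X[X[P 2], X[X[X[X[X[P 2], X[P 4]]], X[P 2],
X[X[X[X[X[X[P 2], X[X[X[X[X[P 2], P 4]], X[P 2], X[X[X[X[P 7], X[P 2], X[P 3]]]]]]]], X[P 2], X[P 3]]]]]]]]))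
(Split [C,C,B] (Dead [B,C,A] (X[X[X[X[X[P 2], X[X[X[P 4], X[P 2]]], X[X[X[X[X[X[P 2], X[X[X[X[X[P 2], P
4,X[X[X[X[X[X[P 2], X[X[P 9,X[P 2]]], X[X[P 5]]]], X[P 2]]]]]], X[P 2]]], X[X[P 5]]]], X[P 2]]]]]], X[P 2]]]))
(Split [B,C,B] (Split [A,C,A] (Up (Ref 0 A B C A B C False)) (Many [([B,C,C], [B,C,A]),([C,C,B],
[C,C,A]),([A,C,A], [A,C,B])])) (Many [([B,C,C], [B,C,A]),([C,C,B], [C,C,A]),([B,C,B], [B,C,A])]))))))) (Split
[C,C,A] (Split [A,C,B] (Del [B,C,C] (X[X[X[P 2], X[X[X[X[P 2], X[X[X[P 2], X[X[X[X[P 2], X[P 5]]], X[X[X[P 2],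
X[X[X[X[P 2], X[X[X[P 2], X[X[X[X[P 2], X[P 5]]], X[P 8]]]]]], P 3]]]]]]]], X[X[X[P 2], P 3]]]]]) (Del [A,C,A]
(X[X[P 2,X[X[X[P 2], X[X[X[X[P 2], X[X[X[P 2], X[X[P 5]]]]]]]]]]]) (Dead [A,C,C] (X[X[X[X[X[P 2],
X[X[X[X[X[X[P 2], X[P 5]]]]]]]]]])))) (Split [B,C,A] (Del [A,C,A] (X[X[P 2]]) (CloseL [C,A])) (Split [B,C,C]
(Dead [A,C,B] (X[X[X[P 2], X[X[X[X[X[P 2], X[P 4]]], X[P 2], X[X[X[X[P 2], X[X[X[X[X[P 2], X[X[P 4,X[P 2],
X[X[X[X[P 2], X[X[X[X[X[P 2], P 9]], X[P 2], X[X[P 5]]]]]]]]]]], X[P 2], X[X[P 5]]]]]]]]]]])) (Split [B,C,B]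
(Split [A,C,A] (Up (Ref 0 A B C A B C True)) (Many [([B,C,C], [B,C,A]),([A,C,C], [A,C,B]),([A,C,A],
[A,C,B])])) (Many [([B,C,C], [B,C,A]),([A,C,C], [A,C,B]),([B,C,B], [B,C,A])]))))) (Split [A,C,A] (Split
[A,C,B] (Split [B,C,A] (Dead [A,C,C] (X[X[X[X[X[P 3]], X[X[X[P 2], X[X[X[X[X[X[P 3]], X[X[X[P 2], X[P
6,X[X[X[P 2], P 3]]]]]]]], X[X[X[P 2], P 3]]]]]]]])) (Split [B,C,C] (Dead [C,C,A] (X[X[X[X[X[X[P 2],
X[X[X[X[X[X[P 2], X[P 5]]], X[X[X[X[X[X[P 2], X[X[X[X[X[X[P 2], X[P 5]]], X[P 8]]]]]], P 3]]]]]]]], X[X[P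
3]]]]])) (Split [B,C,B] (Split [C,C,B] (CloseL [C,B]) (Up (Ref 1 A B C A B C False))) (Split [C,C,B] (Dead
[B,C,A] (X[X[X[P 2]]])) (Many [([B,C,B], [B,C,A]),([B,C,C], [B,C,A]),([C,C,B], [C,C,A])]))))) (Split [B,C,A]
(Split [B,C,C] (Dead [A,C,C] (X[X[X[X[X[P 3]]]]])) (Split [C,C,B] (Dead [A,C,C] (X[X[X[X[X[P 3]],
X[X[X[X[X[X[X[X[P 3,X[X[X[X[X[X[P 8], X[X[X[P 5], X[P 2]]]]]], X[P 2]]]]]], X[X[X[P 5], X[P 2]]]]]], X[P
2]]]]]])) (Split [B,C,B] (Up (Ref 1 A B C A B C True)) (Many [([C,C,B], [C,C,A]),([A,C,C], [A,C,B]),([B,C,B],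
[B,C,C])])))) (Split [B,C,B] (Split [B,C,C] (Split [C,C,B] (Dead [B,C,A] (X[X[X[X[X[X[X[P 4]]],
X[X[X[X[X[X[X[X[X[P 4]], X[X[X[X[P 7], X[P 3]]]]]]]], X[P 3]]]]]]]])) (Up (Ref 0 B A C B A C False))) (Split
[C,C,B] (Up (Ref 0 B A C B A C True)) (Many [([B,C,C], [B,C,A]),([A,C,C], [A,C,B]),([C,C,B], [C,C,A])])))
(Split [B,C,C] (Split [C,C,B] (Dead [B,C,A] (X[X[X[X[X[X[X[P 4], X[P 2]]], X[X[X[X[X[X[X[X[X[P 4,X[P 2]]],
X[X[X[X[P 7], X[P 3]]]]]], X[P 2]]], X[P 3]]]]]], X[P 2]]])) (Many [([B,C,B], [B,C,A]),([A,C,C],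
[A,C,B]),([C,C,B], [C,C,A])])) (Many [([B,C,B], [B,C,A]),([A,C,C], [A,C,B]),([B,C,C], [B,C,A])]))))) (Split
[A,C,B] (Split [B,C,A] (Dead [A,C,C] (X[X[X[P 2], X[X[X[X[P 2], P 3]], X[X[X[P 2], X[X[X[X[P 2], X[X[X[X[P 2],
P 3]], X[X[X[P 2], X[P 6,X[X[X[P 2], P 3]]]]]]]], X[X[X[P 2], P 3]]]]]]]])) (Split [B,C,B] (Split [C,C,B]
(CloseL [C,B]) (Split [B,C,C] (Dead [C,C,A] (X[X[X[X[P 2], X[X[X[X[X[X[P 2], X[X[X[P 5]]], X[X[X[X[P 2],
X[X[X[X[X[X[P 2], X[X[X[P 5]]], X[P 8]]]]]], P 3]]]]]]]], X[X[P 3]]]]])) (Many [([A,C,C], [A,C,A]),([C,C,B],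
[C,C,A]),([B,C,C], [B,C,A])]))) (Split [B,C,C] (Split [C,C,B] (Dead [B,C,A] (X[X[X[P 2]]])) (Many [([B,C,B],
[B,C,A]),([A,C,C], [A,C,A]),([C,C,B], [C,C,A])])) (Many [([B,C,B], [B,C,A]),([A,C,C], [A,C,A]),([B,C,C],
[B,C,A])])))) (Split [C,C,B] (Split [B,C,A] (Dead [A,C,C] (X[X[X[P 2], X[X[X[X[P 2], P 3]], X[X[X[X[X[P 2],
X[X[X[X[P 2], X[P 3,X[X[X[X[X[P 2], X[X[P 8], X[X[X[P 5], X[P 2]]]]]], X[P 2]]]]]], X[X[X[P 5], X[P 2]]]]]],
X[P 2]]]]]])) (Split [B,C,C] (Split [B,C,B] (Dead [B,C,A] (X[X[X[X[X[P 2], X[X[X[P 4]]], X[X[X[X[P 2],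
X[X[X[X[X[P 2], X[X[P 4]], X[X[X[X[P 2], X[P 7], X[P 3]]]]]]]], X[P 3]]]]]]]])) (Many [([A,C,B],
[A,C,A]),([A,C,C], [A,C,A]),([B,C,B], [B,C,A])])) (Many [([A,C,B], [A,C,A]),([A,C,C], [A,C,A]),([B,C,C],
[B,C,A])]))) (Many [([A,C,B], [A,C,A]),([A,C,C], [A,C,A]),([C,C,B], [C,C,A])]))))))) level2_2 (grow level2_2) Em"
    by code_simp
qed (auto simp: refuted_level3_2[OF assms] refuted_level3_3[OF assms])

section \<open>Three letters, with BB allowed and A adjacent only to C\<close>

definition level4_3 :: trie where
  "level4_3 = tries [[A,C,B,B], [B,B,C,A], [B,B,C,B], [B,C,A,C], [B,C,B,B], [B,C,B,C], [C,A,C,B], [C,B,B,C],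
[C,B,C,A]]"

text \<open>The only branch that survives powers and counting is coded by CBB, CBCA and CBBCA, the
  return words to the two-letter word CB.\<close>

lemma refuted_level4_3:
  assumes "c < mu"
  shows "refuted c level4_3"
proof (rule check_refuted[OF _ assms])
  show "check [] (Split [C,B,B,C,A] (CloseL [B,B,C,A]) (Split [C,B,B,C,B] (CloseL [B,B,C,B]) (Split
[B,B,C,B,B] (CloseL [B,C,B,B]) (Split [B,B,C,B,C] (CloseL [B,C,B,C]) (Up (Del [B,C,B,B,C,B] (X[X[P 3]]) (Split
[A,C,B,B,C,B] (CloseL [C,B,B,C,B]) (Split [C,B,B,C,B,C] (CloseL [B,B,C,B,C]) (Split [C,B,B,C,B,B] (CloseL
[B,B,C,B,B]) (Split [A,C,B,B,C,A] (Del [B,B,C,A,C,B] (X[X[X[X[X[X[X[X[X[X[X[X[X[X[P 8]]]]]],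
X[X[X[X[X[X[X[X[X[X[X[X[X[X[X[X[X[X[P 8]]], X[X[X[X[X[X[X[X[X[P 15]], X[X[P 7]]]]]]]]]]]]]]]]], X[X[P
7]]]]]]]]]]]]]]]]]) (CloseR [B,B,C,A,C])) (Up (Split [C,A,C,B,B,C,A] (CloseL [A,C,B,B,C,A]) (Split
[C,A,C,B,B,C,B] (CloseL [A,C,B,B,C,B]) (Split [A,C,B,B,C,B,B] (CloseL [C,B,B,C,B,B]) (Split [A,C,B,B,C,B,C]
(CloseL [C,B,B,C,B,C]) (Up (Split [B,C,A,C,B,B,C,A] (CloseL [C,A,C,B,B,C,A]) (Split [B,C,A,C,B,B,C,B] (CloseL
[C,A,C,B,B,C,B]) (Split [C,A,C,B,B,C,B,B] (CloseL [A,C,B,B,C,B,B]) (Split [C,A,C,B,B,C,B,C] (CloseL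
[A,C,B,B,C,B,C]) (Up (Split [B,C,A,C,B,B,C,B,C] (CloseL [C,A,C,B,B,C,B,C]) (Split [B,C,A,C,B,B,C,B,B] (CloseL
[C,A,C,B,B,C,B,B]) (Split [B,B,C,A,C,B,B,C,B] (Del [A,C,B,B,C,B,C,A,C] (X[X[X[X[X[X[X[X[X[P 7]]]]]]]]])
(CloseR [A,C,B,B,C,B,C,A])) (Split [C,B,C,A,C,B,B,C,A] (Del [A,C,B,B,C,A,C,B,B] (X[X[X[X[P 5]]]]) (CloseR
[A,C,B,B,C,A,C,B])) (Split [C,B,C,A,C,B,B,C,B] (Del [B,C,B,B,C,A,C,B,B] (X[X[X[X[X[X[X[X[X[X[X[P
5,X[X[X[X[X[X[X[X[X[X[X[X[P 5,X[X[X[X[P 12]]]]]]], X[X[X[X[X[X[X[X[X[X[X[P 5,X[X[X[X[X[X[X[X[X[X[X[X[P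
5,X[X[X[X[P 12]]]]]]], X[P 20]]]]]]]]]]]]], X[P 8]]]]]]]]]]]]]]]]]]]]], X[X[X[P 8]]]]]]]]]]]) (CloseR
[B,C,B,B,C,A,C,B])) (Split [B,B,C,A,C,B,B,C,A] (Up (Split [B,C,B,C,A,C,B,B,C,A] (CloseL [C,B,C,A,C,B,B,C,A])
(Split [B,C,B,C,A,C,B,B,C,B] (CloseL [C,B,C,A,C,B,B,C,B]) (Split [B,B,C,A,C,B,B,C,B,B] (Del
[A,C,B,B,C,A,C,B,B,C] (X[X[X[X[X[X[X[X[X[X[X[X[X[X[X[X[X[X[X[X[P 12]]]]]]]],
X[X[X[X[X[X[X[X[X[X[X[X[X[X[X[X[X[X[X[X[X[X[X[X[X[X[X[X[P 12], X[X[X[X[X[X[X[X[X[X[X[X[X[X[X[X[X[X[X[P 27]]]],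
X[X[X[X[X[X[P 15]]]]]]]], X[X[P 7]]]]]]]]]]]]]]]]], X[X[X[P 7]]]]]]]]]]]]], X[X[X[X[X[X[P 15]]]]]]]], X[X[P
7]]]]]]]]]]]]]]]]], X[X[X[P 7]]]]]]]]]]]]]) (CloseR [A,C,B,B,C,A,C,B,B])) (Split [B,B,C,A,C,B,B,C,B,C] (Del
[A,C,B,B,C,B,C,A,C,B] (X[X[X[X[X[X[X[X[P 7]]]]]]]]) (CloseR [A,C,B,B,C,B,C,A,C])) (Split [C,B,C,A,C,B,B,C,B,B]
(Del [A,C,B,B,C,A,C,B,B,C] (X[X[X[X[X[X[X[X[X[X[X[X[X[X[X[X[X[X[X[X[P 12]]]]]]]],
X[X[X[X[X[X[X[X[X[X[X[X[X[X[X[X[X[X[X[X[X[X[X[X[X[X[X[P 12]]]]]]], X[X[X[X[X[X[X[X[P 20,X[P 8]]]]]]]]]]],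
X[X[X[P 7]]]]]]]]]]]]], X[P 8]]]]]]]]]]], X[X[X[P 7]]]]]]]]]]]]]) (CloseR [A,C,B,B,C,A,C,B,B])) (Split
[C,B,C,A,C,B,B,C,B,C] (Match False [C,B,B,C,A,C,B,B,C] [C,B] [C,B,B] [C,B,C,A] [C,B,B,C,A]) (Many
[([B,B,C,A,C,B,B,C,B,C], [B,B,C,A,C,B,B,C,B,B]),([B,C,B,C,A,C,B,B,C,B],
[B,C,B,C,A,C,B,B,C,A]),([C,B,C,A,C,B,B,C,B,C], [C,B,C,A,C,B,B,C,B,B])])))))))) (Many [([C,B,C,A,C,B,B,C,B],
[C,B,C,A,C,B,B,C,A]),([B,C,A,C,B,B,C,B,C], [B,C,A,C,B,B,C,B,B]),([B,B,C,A,C,B,B,C,A],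
[B,B,C,A,C,B,B,C,B])])))))))))))))))))))))))))))) level4_3 (grow level4_3) Em"
    by code_simp
qed simp

definition level4_4 :: trie where
  "level4_4 = tries [[A,C,B,B], [A,C,B,C], [B,B,C,A], [B,C,A,C], [B,C,B,B], [C,A,C,B], [C,B,B,C], [C,B,C,A],
[C,B,C,B]]"

lemma refuted_level4_4:
  assumes "c < mu"
  shows "refuted c level4_4"
proof (rule check_refuted[OF _ assms])
  show "check [] (Split [C,A,C,B,B] (CloseL [A,C,B,B]) (Split [C,A,C,B,C] (CloseL [A,C,B,C]) (Split
[A,C,B,C,A] (CloseL [C,B,C,A]) (Split [A,C,B,C,B] (CloseL [C,B,C,B]) (Up (Split [C,A,C,B,C,B] (CloseL
[A,C,B,C,B]) (Split [C,A,C,B,C,A] (CloseL [A,C,B,C,A]) (Split [B,C,A,C,B,C] (CloseL [C,A,C,B,C]) (Split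
[B,C,A,C,B,B] (CloseL [C,A,C,B,B]) (Up (Del [C,B,C,A,C,B,C] (X[X[X[P 4]]]) (Split [B,C,A,C,B,C,B] (CloseL
[C,A,C,B,C,B]) (Split [B,C,A,C,B,C,A] (CloseL [C,A,C,B,C,A]) (Split [B,B,C,A,C,B,C] (CloseL [B,C,A,C,B,C])
(Match False [C,A,C,B,B,C] [C] [C,A] [C,B] [C,B,B]))))))))))))))) level4_4 (grow level4_4) Em"
    by code_simp
qed simp

definition level4_5 :: trie where
  "level4_5 = tries [[A,C,B,B], [A,C,B,C], [B,B,C,A], [B,B,C,B], [B,C,A,C], [B,C,B,B], [C,A,C,B], [C,B,B,C],
[C,B,C,A]]"

text \<open>Two branches survive powers and counting. Both are coded by the return words BCACB, BCB,
  BCAC to BC, one of them after reversal.\<close>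

lemma refuted_level4_5:
  assumes "c < mu"
  shows "refuted c level4_5"
proof (rule check_refuted[OF _ assms])
  show "check [] (Split [C,B,B,C,A] (CloseL [B,B,C,A]) (Split [C,B,B,C,B] (CloseL [B,B,C,B]) (Split
[C,A,C,B,B] (CloseL [A,C,B,B]) (Split [C,A,C,B,C] (CloseL [A,C,B,C]) (Up (Del [B,C,B,B,C,B] (X[X[P 3]]) (Split
[B,C,A,C,B,C] (CloseL [C,A,C,B,C]) (Split [B,C,A,C,B,B] (CloseL [C,A,C,B,B]) (Split [A,C,B,B,C,B] (CloseL
[C,B,B,C,B]) (Split [A,C,B,B,C,A] (Del [B,B,C,A,C,B] (X[X[X[X[X[X[X[X[X[X[X[X[X[X[P 8]]]]]],
X[X[X[X[X[X[X[X[X[X[X[X[X[X[X[X[X[X[P 8]]]]]], X[X[X[X[P 12,P 4]]]]]]]]]]]], P 4]]]]]]]]]]]]) (CloseR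
[B,B,C,A,C])) (Up (Del [C,B,C,A,C,B,C] (X[X[X[P 4]]]) (Split [B,B,C,A,C,B,C] (CloseL [B,C,A,C,B,C]) (Split
[C,A,C,B,B,C,B] (CloseL [A,C,B,B,C,B]) (Split [C,A,C,B,B,C,A] (CloseL [A,C,B,B,C,A]) (Split [B,B,C,A,C,B,B]
(Del [A,C,B,B,C,A,C] (X[X[X[X[X[X[X[X[X[X[X[X[X[X[X[X[P 9]]]]]]], X[X[X[X[X[X[X[X[X[X[X[X[X[X[X[X[X[X[X[X[X[P
9,X[X[X[X[X[X[X[X[X[X[X[X[X[X[X[X[P 21]]]], X[X[X[X[P 12]]]]]]]]]]]]]]]]]]]]]]]]], X[X[X[X[P
12]]]]]]]]]]]]]]]]]]]]]]]]]) (CloseR [A,C,B,B,C,A])) (Up (Split [B,C,A,C,B,B,C,A] (CloseL [C,A,C,B,B,C,A])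
(Split [B,C,A,C,B,B,C,B] (CloseL [C,A,C,B,B,C,B]) (Split [C,B,B,C,A,C,B,C] (CloseL [B,B,C,A,C,B,C]) (Split
[C,B,B,C,A,C,B,B] (CloseL [B,B,C,A,C,B,B]) (Up (Split [A,C,B,B,C,A,C,B,C] (Del [A,C,B,C,A,C,B,B,C]
(X[X[X[X[X[X[X[X[X[X[X[X[X[X[X[X[P 5,X[X[X[X[X[X[X[X[X[X[X[X[X[X[X[X[X[P 5,X[P 17]]]], X[X[X[X[P 8]]]]]],
X[X[X[X[X[X[X[X[X[X[P 12]]]]]]]]]]]]]]]]]]]]]]]]], X[X[X[X[P 8]]]]]], X[X[X[X[X[X[X[X[X[X[P
12]]]]]]]]]]]]]]]]]]]]]) (CloseR [A,C,B,C,A,C,B,B])) (Split [B,C,B,B,C,A,C,B,B] (Del [B,B,C,A,C,B,B,C,A]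
(X[X[X[X[P 5]]]]) (Split [C,B,C,A,C,B,B,C,A] (CloseL [B,C,A,C,B,B,C,A]) (Split [A,C,B,B,C,A,C,B,B] (CloseL
[C,B,B,C,A,C,B,B]) (Match True [A,C,B,B,C,A,C,B] [B,C] [B,C,A,C,B] [B,C,B] [B,C,A,C])))) (Split
[C,B,C,A,C,B,B,C,A] (Del [A,C,B,B,C,A,C,B,B] (X[X[X[X[P 5]]]]) (Dead [A,C,B,B,C,A,C,B,C]
(X[X[X[X[X[X[X[X[X[X[X[X[X[X[X[P 8]]]], X[X[X[X[X[X[X[X[X[X[X[X[X[X[X[X[X[X[X[X[X[P 8]]]], X[X[X[X[X[X[P
17,X[X[X[X[X[X[X[X[X[X[X[X[P 8]]]]]], X[X[X[X[P 12]]]]]]]]]]]]]]]]]]]]]]]]]]], X[X[X[X[X[X[X[X[X[X[X[X[P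
8]]]]]], X[X[X[X[P 12]]]]]]]]]]]]]]]]]]]]]]]]]]]))) (Split [B,B,C,A,C,B,B,C,B] (Split [C,B,C,A,C,B,B,C,B]
(CloseL [B,C,A,C,B,B,C,B]) (Split [A,C,B,B,C,A,C,B,B] (Match False [B,C,A,C,B,B,C,A] [B,C] [B,C,A,C,B] [B,C,B]
[B,C,A,C]) (Split [B,C,B,B,C,A,C,B,C] (Del [A,C,B,B,C,B,B,C,A] (X[X[X[X[X[X[X[X[X[X[X[X[X[X[P
5,X[X[X[X[X[X[X[X[X[X[X[X[X[X[X[X[X[P 5,X[X[X[P 17]]]]], X[X[X[X[X[X[P 9]]]]]]]]]]]]]]]]]]]]]]], X[X[X[X[X[X[P
9]]]]]]]]]]]]]]]]]]) (CloseR [A,C,B,B,C,B,B,C])) (Many [([C,B,C,A,C,B,B,C,B],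
[C,B,C,A,C,B,B,C,A]),([A,C,B,B,C,A,C,B,C], [A,C,B,B,C,A,C,B,B]),([B,C,B,B,C,A,C,B,C],
[B,C,B,B,C,A,C,B,B])])))) (Split [A,C,B,B,C,A,C,B,B] (Split [B,B,C,A,C,B,B,C,A] (Dead [A,C,B,B,C,A,C,B,C]
(X[X[X[X[X[X[X[X[X[X[X[X[X[X[P 9]]]]], X[X[X[X[X[X[X[X[X[X[X[X[P 8]]]]]], X[X[X[X[X[X[X[X[X[X[X[X[X[X[X[P
9,X[X[X[X[X[X[X[X[X[X[X[X[P 8]]]]]], X[X[X[X[X[X[X[X[P 21]], X[X[X[X[P 12]]]]]]]]]]]]]]]]]]]]]]]]], X[X[X[X[P
12]]]]]]]]]]]]]]]]]]]]]]]]])) (Split [B,C,B,B,C,A,C,B,C] (Del [A,C,B,C,A,C,B,B,C]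
(X[X[X[X[X[X[X[X[X[X[X[X[X[X[X[X[X[X[X[X[P 8]]]], X[X[X[X[X[X[X[X[X[X[X[X[X[X[X[X[X[X[X[X[X[P 8]]]], X[P
17]]]]]]]]], X[X[X[X[X[X[P 9]]]]]]]]]]]]]]]]]]]]]]], X[X[X[X[X[X[P 9]]]]]]]]]]]]]]) (CloseR
[A,C,B,C,A,C,B,B])) (Split [C,B,C,A,C,B,B,C,B] (Del [A,C,B,B,C,B,B,C,A] (X[X[X[X[X[X[X[X[X[X[X[P 8]]]]]]]]]]])
(CloseR [A,C,B,B,C,B,B,C])) (Many [([B,B,C,A,C,B,B,C,B], [B,B,C,A,C,B,B,C,A]),([B,C,B,B,C,A,C,B,C],
[B,C,B,B,C,A,C,B,B]),([C,B,C,A,C,B,B,C,B], [C,B,C,A,C,B,B,C,A])])))) (Split [B,B,C,A,C,B,B,C,A] (Split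
[B,C,B,B,C,A,C,B,C] (Dead [A,C,B,B,C,A,C,B,C] (X[X[X[X[X[X[X[X[X[X[X[X[X[X[P 9]]]]]]]]]]]]]])) (Split
[C,B,C,A,C,B,B,C,B] (Dead [A,C,B,B,C,A,C,B,B] (X[X[X[X[X[X[X[X[X[X[X[X[X[X[X[P 9]]]]]],
X[X[X[X[X[X[X[X[X[X[X[X[X[X[X[X[X[X[X[X[X[X[X[P 9]]]]]], X[X[X[X[X[X[X[X[P 17,X[X[X[X[P
8]]]]]]]]]]]]]]]]]]]]], X[X[X[X[P 8]]]]]]]]]]]]]]]]]]]]])) (Many [([A,C,B,B,C,A,C,B,C],
[A,C,B,B,C,A,C,B,B]),([B,C,B,B,C,A,C,B,C], [B,C,B,B,C,A,C,B,B]),([C,B,C,A,C,B,B,C,B], [C,B,C,A,C,B,B,C,A])])))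
(Split [C,B,C,A,C,B,B,C,B] (Split [B,C,B,B,C,A,C,B,C] (Dead [A,C,B,B,C,A,C,B,B] (X[X[X[X[P 5],
X[X[X[X[X[X[X[X[X[X[X[P 5,X[X[X[X[X[X[X[X[X[X[X[P 5,X[X[X[X[X[X[X[X[X[X[X[P 5,X[X[X[X[X[X[X[X[X[X[P 22]],
X[X[P 8]]]]]]]]]]]], X[X[X[P 9]]]]]]]]]]]]]]], X[X[P 8]]]]]]]]]]]], X[X[X[P 9]]]]]]]]]]]]]]])) (Many
[([B,B,C,A,C,B,B,C,B], [B,B,C,A,C,B,B,C,A]),([A,C,B,B,C,A,C,B,C], [A,C,B,B,C,A,C,B,B]),([B,C,B,B,C,A,C,B,C],
[B,C,B,B,C,A,C,B,B])])) (Many [([B,B,C,A,C,B,B,C,B], [B,B,C,A,C,B,B,C,A]),([A,C,B,B,C,A,C,B,C],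
[A,C,B,B,C,A,C,B,B]),([C,B,C,A,C,B,B,C,B], [C,B,C,A,C,B,B,C,A])])))))))))))))))))))))))))))))) level4_5 (grow
level4_5) Em"
    by code_simp
qed simp

definition level3_4 :: trie where
  "level3_4 = tries [[A,C,B], [B,B,C], [B,C,A], [B,C,B], [C,A,C], [C,B,B], [C,B,C]]"

lemma refuted_level3_4:
  assumes "c < mu"
  shows "refuted c level3_4"
proof (rule check_refuted[OF _ assms])
  show "check [level4_3, level4_4, level4_5] (Split [A,C,B,B] (Del [B,C,B,C] (X[X[X[X[X[P 3], X[X[X[X[X[X[X[X[X[P 3]],
X[X[X[X[X[P 7], X[X[X[P 4]], X[X[X[X[X[P 3], X[X[X[X[X[X[X[X[X[P 3]], X[X[X[X[X[P 7], X[X[X[P 4]], X[X[X[X[X[P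
3], P 16]]], P 2]]]]], P 2]]]], X[X[X[P 4]], X[X[X[P 9]], P 2]]]]], P 2]]]], P 2]]]]], P 2]]]], X[X[X[P 4]],
X[X[X[X[X[P 3], X[X[X[X[X[X[X[X[X[P 3]], X[X[X[X[X[P 7], X[X[X[P 4]], X[X[X[X[X[P 3], X[X[X[X[X[X[X[X[X[P 3]],
X[X[P 16], P 2]]]], X[X[X[P 4]], X[X[X[P 9]], P 2]]]]], P 2]]]], P 2]]]]], P 2]]]], X[X[X[P 4]], X[P 9,P
2]]]]], P 2]]]], P 2]]]]], P 2]]]], P 2]) (Del [A,C,B,C] (X[X[X[X[X[X[X[X[P 3]], X[X[X[X[X[X[X[X[X[P 3]], X[P
7]]]], X[X[X[P 4]]]]]]]]]], X[X[X[P 4]]]]]]) (CloseR [A,C,B]))) (Split [B,B,C,A] (Del [C,B,C,B]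
(X[X[X[X[X[X[X[P 4]], X[X[X[X[X[X[X[X[X[X[P 4]]], X[X[X[X[P 7], X[X[P 3], X[X[X[X[X[X[X[P 4]],
X[X[X[X[X[X[X[X[X[X[P 4]]], X[X[X[X[P 7], X[X[P 3], X[X[X[X[P 16]]], P 2]]]], P 2]]]]], X[X[P 3], X[X[X[P 9]],
P 2]]]], P 2]]]]], P 2]]]], P 2]]]]], X[X[P 3], X[X[X[X[X[X[X[P 4]], X[X[X[X[X[X[X[X[X[X[P 4]]], X[X[X[X[P 7],
X[X[P 3], X[X[X[X[X[X[X[P 4]], X[X[X[X[X[X[X[X[X[X[P 4]]], X[P 16,P 2]]]]], X[X[P 3], X[X[X[P 9]], P 2]]]], P
2]]]]], P 2]]]], P 2]]]]], X[X[P 3], X[P 9,P 2]]]], P 2]]]]], P 2]]]], P 2]]]]], P 2]) (Dead [A,C,B,B]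
(X[X[X[X[X[X[X[P 4]]], X[X[X[X[X[X[X[X[X[X[P 4]]], X[X[X[P 7,X[X[P 3]]]]]]]]], X[X[P 3]]]]]]]]]))) (Split
[A,C,B,C] (Del [C,B,C,B] (X[P 2]) (Split [B,B,C,B] (CloseL [B,C,B]) (Split [B,C,B,C] (CloseL [C,B,C]) (Split
[B,C,B,B] (Dead [B,B,C,A] (X[X[X[X[X[X[X[X[X[P 5]]]], X[X[X[X[X[X[X[X[X[X[X[X[P 5,X[X[X[X[X[X[X[X[X[P 12]],
X[X[X[P 7]]]]]]]]]]]]]]], X[X[X[P 7]]]]]]]]]]]]]]])) (Up (Ref 0 A B C A B C False)))))) (Split [B,B,C,B] (Del
[B,C,B,C] (X[P 2]) (Split [C,B,C,B] (CloseL [B,C,B]) (Split [C,B,C,A] (Dead [A,C,B,B] (X[X[X[X[X[X[X[X[X[P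
5]]]], X[X[X[X[X[X[X[X[X[X[X[X[P 5,X[X[X[X[X[X[X[X[X[P 12]], X[X[X[P 7]]]]]]]]]]]]]]], X[X[X[P
7]]]]]]]]]]]]]]])) (Up (Ref 1 A B C A B C False))))) (Split [B,C,B,B] (Split [C,B,C,A] (Dead [A,C,B,B]
(X[X[X[X[X[X[X[X[X[P 5]]]]]]]]])) (Split [C,B,C,B] (Up (Ref 1 A B C A B C True)) (Many [([B,B,C,B],
[B,B,C,A]),([A,C,B,C], [A,C,B,B]),([C,B,C,B], [C,B,C,A])]))) (Split [B,C,B,C] (Split [C,B,C,A] (Up (Ref 0 A B
C A B C True)) (Split [C,B,C,B] (Up (Ref 2 A B C A B C False)) (Many [([B,B,C,B], [B,B,C,A]),([A,C,B,C],
[A,C,B,B]),([C,B,C,B], [C,B,C,A])]))) (Many [([B,B,C,B], [B,B,C,A]),([A,C,B,C], [A,C,B,B]),([B,C,B,C],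
[B,C,B,B])]))))))) level3_4 (grow level3_4) Em"
    by code_simp
qed (auto simp: refuted_level4_3[OF assms] refuted_level4_4[OF assms] refuted_level4_5[OF assms])

definition level2_3 :: trie where
  "level2_3 = tries [[A,C], [B,B], [B,C], [C,A], [C,B]]"

lemma refuted_level2_3:
  assumes "c < mu"
  shows "refuted c level2_3"
proof (rule check_refuted[OF _ assms])
  show "check [level3_4] (Del [B,B,B] (P 1) (Split [C,B,B] (CloseL [B,B]) (Split [A,C,B] (Del [B,B,C] (X[X[X[X[X[P
3]], X[P 2]]]]) (CloseR [B,B])) (Split [B,C,A] (Del [A,C,A] (X[X[P 2]]) (CloseL [C,A])) (Split [B,C,B] (Del
[C,B,C] (X[X[X[X[P 2], X[X[X[X[X[X[P 2], X[X[X[P 5]], X[X[X[X[P 2], X[X[X[X[X[X[P 2], X[X[X[P 5]], X[X[P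
9]]]]]]], P 4]]]]]]]]], X[X[X[X[P 2], P 4]]]]]]]) (Del [A,C,A] (X[X[P 2,X[X[X[X[X[X[P 2], X[X[X[X[P
5]]]]]]]]]]]) (Dead [A,C,B] (X[X[X[X[X[X[X[X[X[X[P 5]]]]]]]]]])))) (Split [C,B,C] (Dead [B,C,B] (X[X[X[X[X[X[P
2], X[X[X[X[X[X[P 2], X[P 5]]], X[X[X[X[X[X[P 2], X[X[X[X[X[X[P 2], X[P 5]]], X[P 8]]]]]], P 3]]]]]]]], X[X[P
3]]]]])) (Split [A,C,A] (Up (Ref 0 A B C A B C False)) (Many [([B,C,B], [B,C,A]),([C,B,C], [C,B,B]),([A,C,A],
[A,C,B])])))))))) level2_3 (grow level2_3) Em"
    by code_simp
qed (auto simp: refuted_level3_4[OF assms])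

section \<open>Three letters, with CC allowed and B only inside CBA\<close>

definition level4_6 :: trie where
  "level4_6 = tries [[A,C,A,C], [A,C,B,A], [A,C,C,B], [B,A,C,A], [B,A,C,B], [B,A,C,C], [C,A,C,C], [C,B,A,C],
[C,C,B,A]]"

lemma refuted_level4_6:
  assumes "c < mu"
  shows "refuted c level4_6"
proof (rule check_refuted[OF _ assms])
  show "check [] (Split [C,B,A,C,C] (CloseL [B,A,C,C]) (Split [C,B,A,C,A] (CloseL [B,A,C,A]) (Split
[C,B,A,C,B] (CloseL [B,A,C,B]) (Up (Del [A,C,B,A,C,B] (X[X[P 3]]) (Split [C,C,B,A,C,B] (CloseL [C,B,A,C,B])
(Split [A,C,B,A,C,A] (Del [C,A,C,C,B,A] (X[X[X[X[X[X[X[X[X[X[X[X[X[X[X[X[X[P 7]], X[P 4]]],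
X[X[X[X[X[X[X[X[X[X[X[X[X[X[X[X[X[P 7]], X[P 4]]], X[P 13]]]]]], X[P 4]]], X[X[P 6]]]]]]]]]]]]], X[P 4]]],
X[X[X[P 6]]]]]]]]]) (CloseR [C,A,C,C,B])) (Split [A,C,B,A,C,C] (Dead [A,C,B,A,C,A] (X[X[X[X[X[X[X[X[P 4]]],
X[X[X[X[X[X[X[X[X[X[X[X[P 4]]], X[X[X[P 9]]]]]]]], X[X[X[X[X[P 4]]], X[X[P 6]]]]]]]]]]]]])) (Split
[C,C,B,A,C,A] (Del [C,A,C,C,B,A] (X[X[X[X[X[X[X[X[X[X[X[X[X[X[X[X[X[P 7], X[X[X[X[X[X[X[X[X[X[X[X[X[X[X[X[X[P
7], X[X[P 16]]]]]]], X[P 4]]], X[X[X[X[P 9]]]]]]]]]]]]]]]]]], X[P 4]]], X[X[X[X[X[X[X[X[P 9]]]]]]]]]]]]]]]]])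
(CloseR [C,A,C,C,B])) (Split [C,C,B,A,C,C] (Up (Split [B,A,C,B,A,C,A] (CloseL [A,C,B,A,C,A]) (Split
[B,A,C,B,A,C,C] (CloseL [A,C,B,A,C,C]) (Split [A,C,C,B,A,C,A] (CloseL [C,C,B,A,C,A]) (Split [A,C,C,B,A,C,B]
(CloseL [C,C,B,A,C,B]) (Up (Split [C,B,A,C,B,A,C,A] (CloseL [B,A,C,B,A,C,A]) (Split [C,B,A,C,B,A,C,C] (CloseL
[B,A,C,B,A,C,C]) (Split [B,A,C,C,B,A,C,A] (Del [B,A,C,C,B,A,C,B] (X[X[X[X[X[X[X[X[X[X[P 7]]],
X[X[X[X[X[X[X[X[X[X[X[X[X[X[X[X[X[P 7], X[X[X[X[X[X[X[X[X[P 16,X[X[X[X[P 9,X[X[X[X[P 6]]]]]]]]]]]]], X[X[X[X[P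
6]]]]]]]]]]]]]]], X[X[X[X[P 9,X[X[X[X[P 6]]]]]]]]]]]]], X[X[X[X[P 6]]]]]]]]]]]]]]]) (CloseR [B,A,C,C,B,A,C]))
(Split [B,A,C,C,B,A,C,B] (Del [A,C,B,A,C,A,C,C] (X[X[X[X[X[X[X[X[X[X[X[X[X[X[X[P 9]]]]]],
X[X[X[X[X[X[X[X[X[X[X[X[X[X[X[X[X[X[X[X[X[X[P 9,X[X[X[X[X[X[X[X[X[X[X[X[X[X[X[X[P 22]]], X[X[X[X[X[X[P 13]]]],
X[X[P 6]]]]]]]]]]]]]]], X[X[P 6]]]]]]]]]]]]], X[X[X[X[X[X[P 13]]]], X[X[P 6]]]]]]]]]]]]]]], X[X[P
6]]]]]]]]]]]]]) (CloseR [A,C,B,A,C,A,C])) (Split [C,A,C,C,B,A,C,A] (Match True [A,C,A,C,C,B,A] [A] [A,B,C,C]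
[A,C] [A,B,C]) (Split [C,A,C,C,B,A,C,B] (Del [A,C,B,A,C,C,B,A] (X[X[X[X[X[X[X[X[X[X[P 7]]]]]]]]]]) (CloseR
[A,C,B,A,C,C,B])) (Many [([B,A,C,C,B,A,C,B], [B,A,C,C,B,A,C,A]),([C,B,A,C,B,A,C,C],
[C,B,A,C,B,A,C,A]),([C,A,C,C,B,A,C,B], [C,A,C,C,B,A,C,A])]))))))))))))) (Many [([C,C,B,A,C,B],
[C,C,B,A,C,A]),([A,C,B,A,C,C], [A,C,B,A,C,A]),([C,C,B,A,C,C], [C,C,B,A,C,A])]))))))))))) level4_6 (grow level4_6) Em"
    by code_simp
qed simp

definition level4_7 :: trie where
  "level4_7 = tries [[A,C,A,C], [A,C,B,A], [A,C,C,B], [B,A,C,A], [B,A,C,B], [C,A,C,B], [C,A,C,C], [C,B,A,C],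
[C,C,B,A]]"

lemma refuted_level4_7:
  assumes "c < mu"
  shows "refuted c level4_7"
proof (rule check_refuted[OF _ assms])
  show "check [] (Split [A,C,A,C,C] (CloseL [C,A,C,C]) (Split [A,C,A,C,B] (CloseL [C,A,C,B]) (Split
[C,B,A,C,A] (CloseL [B,A,C,A]) (Split [C,B,A,C,B] (CloseL [B,A,C,B]) (Up (Split [B,A,C,A,C,C] (CloseL
[A,C,A,C,C]) (Split [B,A,C,A,C,B] (CloseL [A,C,A,C,B]) (Split [A,C,B,A,C,A] (Del [A,C,A,C,C,B]
(X[X[X[X[X[X[X[X[X[P 6]]]]]]]]]) (CloseR [A,C,A,C,C])) (Split [C,C,B,A,C,A] (Del [B,A,C,B,A,C] (X[X[P
3,X[X[X[X[X[X[X[X[X[P 3,X[X[X[X[X[X[P 9]]]]]]]], X[X[X[X[X[X[X[P 3,X[X[X[X[X[X[X[X[X[P 3,X[X[X[X[P 9]]]]]],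
X[X[X[X[X[X[P 14], P 5]]]]]]]]]]]]]], P 5]]]]]]]]]]]]]]) (CloseR [B,A,C,B,A])) (Split [A,C,B,A,C,B] (Split
[C,C,B,A,C,B] (CloseL [C,B,A,C,B]) (Up (Split [A,C,C,B,A,C,A] (CloseL [C,C,B,A,C,A]) (Split [A,C,C,B,A,C,B]
(CloseL [C,C,B,A,C,B]) (Split [C,B,A,C,A,C,B] (CloseL [B,A,C,A,C,B]) (Split [C,B,A,C,A,C,C] (CloseL
[B,A,C,A,C,C]) (Up (Split [C,A,C,C,B,A,C,A] (CloseL [A,C,C,B,A,C,A]) (Split [C,A,C,C,B,A,C,B] (CloseL
[A,C,C,B,A,C,B]) (Split [A,C,B,A,C,A,C,B] (Del [B,A,C,B,A,C,A,C] (X[X[X[X[X[X[X[X[X[X[X[X[X[X[X[P 9]]]]]],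
X[X[X[X[X[X[X[X[X[X[X[X[X[X[X[X[X[X[X[X[X[X[P 9]], X[X[X[X[X[X[X[X[X[X[X[X[X[P 20]], X[X[X[X[X[P 11]]]]]],
X[X[P 6]]]]]]]]]]]]], X[X[X[X[P 6]]]]]]]]]]]], X[X[X[X[X[P 11]]]]]], X[X[P 6]]]]]]]]]]]]], X[X[X[X[P
6]]]]]]]]]]]]) (CloseR [B,A,C,B,A,C,A])) (Split [A,C,B,A,C,A,C,C] (Del [A,C,A,C,C,B,A,C] (X[X[X[X[X[X[X[P
6]]]]]]]) (CloseR [A,C,A,C,C,B,A])) (Split [C,C,B,A,C,A,C,B] (Del [C,A,C,B,A,C,A,C]
(X[X[X[X[X[X[X[X[X[X[X[X[X[X[X[X[X[X[X[X[P 9]]]]]], X[X[X[X[X[X[X[X[X[X[X[X[X[P 14,X[X[X[X[P 6]]]]]]]]]]]], P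
5]]]]]], X[X[X[X[P 6]]]]]]]]]]]], P 5]]]]]) (CloseR [C,A,C,B,A,C,A])) (Split [C,C,B,A,C,A,C,C] (Match False
[A,C,A,C,B,A,C] [A] [A,C] [A,C,C,B] [A,C,B]) (Many [([C,A,C,C,B,A,C,B], [C,A,C,C,B,A,C,A]),([A,C,B,A,C,A,C,C],
[A,C,B,A,C,A,C,B]),([C,C,B,A,C,A,C,C], [C,C,B,A,C,A,C,B])])))))))))))))) (Split [C,C,B,A,C,B] (Del
[B,A,C,B,A,C] (X[X[P 3]]) (CloseR [B,A,C,B,A])) (Many [([B,A,C,A,C,C], [B,A,C,A,C,B]),([A,C,B,A,C,B],
[A,C,B,A,C,A]),([C,C,B,A,C,B], [C,C,B,A,C,A])])))))))))))) level4_7 (grow level4_7) Em"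
    by code_simp
qed simp

definition level4_8 :: trie where
  "level4_8 = tries [[A,C,A,C], [A,C,B,A], [A,C,C,B], [B,A,C,A], [B,A,C,C], [C,A,C,B], [C,A,C,C], [C,B,A,C],
[C,C,B,A]]"

lemma refuted_level4_8:
  assumes "c < mu"
  shows "refuted c level4_8"
proof (rule check_refuted[OF _ assms])
  show "check [] (Split [C,B,A,C,C] (CloseL [B,A,C,C]) (Split [C,B,A,C,A] (CloseL [B,A,C,A]) (Split
[A,C,A,C,C] (CloseL [C,A,C,C]) (Split [A,C,A,C,B] (CloseL [C,A,C,B]) (Up (Split [B,A,C,A,C,C] (CloseL
[A,C,A,C,C]) (Split [B,A,C,A,C,B] (CloseL [A,C,A,C,B]) (Split [A,C,B,A,C,A] (Del [C,A,C,C,B,A]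
(X[X[X[X[X[X[X[X[X[X[X[X[X[X[X[X[X[X[X[X[P 9]]], X[P 4]]], X[X[X[X[X[X[X[X[X[X[X[X[X[X[X[X[X[X[X[X[P 9]]], X[P
4]]], X[X[P 15]]]]]]]]], X[P 4]]], P 6]]]]]]]]]]]]], X[P 4]]], X[X[X[P 6]]]]]]]]]) (CloseR [C,A,C,C,B]))
(Split [A,C,B,A,C,C] (Dead [A,C,B,A,C,A] (X[X[X[X[X[X[X[P 5]], X[X[X[X[X[P 4]]], X[X[X[X[X[X[X[X[X[X[P 5],
X[X[X[X[X[P 4]]], X[X[X[X[P 11,X[X[X[X[X[P 4]]], P 6]]]]]]]]]]]]], X[X[X[X[X[P 4]]], P 6]]]]]]]]]]]]])) (Split
[C,C,B,A,C,A] (Del [A,C,A,C,B,A] (X[X[X[X[X[X[X[P 5]]]]]]]) (CloseR [A,C,A,C,B])) (Split [C,C,B,A,C,C] (Match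
True [A,C,A,C,C] [C] [C,A,B] [C] [C,A]) (Many [([B,A,C,A,C,C], [B,A,C,A,C,B]),([A,C,B,A,C,C],
[A,C,B,A,C,A]),([C,C,B,A,C,C], [C,C,B,A,C,A])])))))))))))) level4_8 (grow level4_8) Em"
    by code_simp
qed simp

definition level4_9 :: trie where
  "level4_9 = tries [[A,C,A,C], [A,C,B,A], [A,C,C,B], [B,A,C,A], [B,A,C,B], [B,A,C,C], [C,A,C,B], [C,B,A,C],
[C,C,B,A]]"

text \<open>The coding uses the same return words to A as for \<open>level4_6\<close>, with ABC and
  ABCC exchanged as the images of A and C.\<close>

lemma refuted_level4_9:
  assumes "c < mu"
  shows "refuted c level4_9"
proof (rule check_refuted[OF _ assms])
  show "check [] (Split [C,B,A,C,C] (CloseL [B,A,C,C]) (Split [C,B,A,C,A] (CloseL [B,A,C,A]) (Split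
[C,B,A,C,B] (CloseL [B,A,C,B]) (Up (Split [A,C,B,A,C,A] (Del [B,A,C,B,A,C] (X[X[P 3,X[X[X[X[X[X[X[P 3,X[X[X[P
7]]]]], X[X[X[X[X[X[X[X[X[X[X[P 3,X[X[X[X[X[X[P 7], X[X[X[X[X[X[X[X[X[X[X[P 3,P 16]], X[X[X[X[P 9]]]]], X[P
4]]]]]]]]]], X[P 4]]]]]]], X[X[X[X[P 9]]]]], X[P 4]]]]]]]]]], X[P 4]]]]]]]) (CloseR [B,A,C,B,A])) (Split
[A,C,B,A,C,C] (Del [A,C,C,B,A,C] (X[X[X[X[P 4]]]]) (CloseR [A,C,C,B,A])) (Split [C,C,B,A,C,A] (Del
[B,A,C,B,A,C] (X[X[P 3,X[X[X[X[X[X[X[P 3,X[X[X[P 7]]]]], X[X[X[X[X[X[X[P 3,X[X[X[X[X[X[X[P 3,X[X[X[P 7]]]]],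
X[X[X[X[X[P 12,X[X[P 5]]]]]]]], X[P 4]]]]]]], X[X[P 5]]]]]]]], X[P 4]]]]]]]) (CloseR [B,A,C,B,A])) (Split
[A,C,B,A,C,B] (Split [C,C,B,A,C,B] (CloseL [C,B,A,C,B]) (Split [C,C,B,A,C,C] (Up (Split [A,C,C,B,A,C,A]
(CloseL [C,C,B,A,C,A]) (Split [A,C,C,B,A,C,B] (CloseL [C,C,B,A,C,B]) (Split [B,A,C,B,A,C,A] (Del
[B,A,C,B,A,C,C] (X[X[X[X[X[X[X[X[X[X[X[P 7]]]], X[X[X[X[X[X[X[P 5]]], X[X[X[X[X[X[X[X[X[X[X[X[X[P 7],
X[X[X[X[X[X[X[P 5]]], X[X[X[X[X[X[P 16], X[X[X[X[X[X[X[P 5]]], P 9]]]]]]]]]]]]]]]]]]]], X[X[X[X[X[X[X[P 5]]],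
P 9]]]]]]]]]]]]]]]]]]]]) (CloseR [B,A,C,B,A,C])) (Split [B,A,C,B,A,C,C] (Del [C,C,B,A,C,A,C]
(X[X[X[X[X[X[X[X[X[X[X[X[X[X[X[X[X[X[X[X[X[X[X[X[X[P 12]]], X[X[P 5]]],
X[X[X[X[X[X[X[X[X[X[X[X[X[X[X[X[X[X[X[X[X[X[X[X[X[P 12]]], X[X[P 5]]], X[X[X[X[P 21]]]]]]]]]]]]]]], X[X[P
5]]], P 9]]]]]]]]]]]]]]]]]]]], X[X[P 5]]], X[X[X[X[X[X[X[P 9]]]]]]]]]]]]]]]]) (CloseR [C,C,B,A,C,A])) (Split
[C,A,C,B,A,C,A] (Match True [A,C,A,C,B,A] [A] [A,B,C] [A,C] [A,B,C,C]) (Split [C,A,C,B,A,C,C] (Del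
[A,C,B,A,C,C,B] (X[X[X[X[X[X[X[X[X[X[X[P 7]]]]]]]]]]]) (CloseR [A,C,B,A,C,C])) (Many [([A,C,C,B,A,C,B],
[A,C,C,B,A,C,A]),([B,A,C,B,A,C,C], [B,A,C,B,A,C,A]),([C,A,C,B,A,C,C], [C,A,C,B,A,C,A])])))))))) (Many
[([C,C,B,A,C,B], [C,C,B,A,C,A]),([A,C,B,A,C,C], [A,C,B,A,C,A]),([C,C,B,A,C,C], [C,C,B,A,C,A])]))) (Split
[C,C,B,A,C,C] (Split [C,C,B,A,C,B] (Del [B,A,C,B,A,C] (X[X[P 3]]) (CloseR [B,A,C,B,A])) (Many [([A,C,B,A,C,B],
[A,C,B,A,C,A]),([A,C,B,A,C,C], [A,C,B,A,C,A]),([C,C,B,A,C,B], [C,C,B,A,C,A])])) (Many [([A,C,B,A,C,B],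
[A,C,B,A,C,A]),([A,C,B,A,C,C], [A,C,B,A,C,A]),([C,C,B,A,C,C], [C,C,B,A,C,A])])))))))))) level4_9 (grow level4_9) Em"
    by code_simp
qed simp

definition level3_5 :: trie where
  "level3_5 = tries [[A,C,A], [A,C,B], [A,C,C], [B,A,C], [C,A,C], [C,B,A], [C,C,B]]"

lemma refuted_level3_5:
  assumes "c < mu"
  shows "refuted c level3_5"
proof (rule check_refuted[OF _ assms])
  show "check [level4_6, level4_7, level4_8, level4_9] (Del [C,A,C,A] (X[P 2]) (Split [B,A,C,A] (CloseL [A,C,A]) (Split
[C,A,C,B] (Split [B,A,C,B] (CloseL [A,C,B]) (Split [B,A,C,C] (Del [A,C,B,A] (X[X[X[X[P 3], X[X[X[X[X[X[X[X[X[P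
3,X[X[X[X[X[X[X[P 9], X[X[X[X[P 6]]]]]]]]]]]]], X[X[X[X[P 6]]]]]]]]]]]]]) (CloseR [A,C,B])) (Up (Ref 0 A B C A
B C False)))) (Split [B,A,C,C] (Split [C,A,C,C] (CloseL [A,C,C]) (Split [B,A,C,B] (Del [A,C,B,A]
(X[X[X[X[X[X[X[X[X[P 5]]]], X[X[X[X[X[X[X[X[X[X[X[X[P 5], X[X[X[X[X[X[X[X[P 11]], X[X[P 6]]]]]]]]]]]]], X[X[P
6]]]]]]]]]]]]]) (CloseR [A,C,B])) (Up (Ref 1 A B C A B C False)))) (Split [B,A,C,B] (Split [C,A,C,C] (Del
[A,C,B,A] (X[X[X[X[X[X[X[X[X[P 5]]]], X[X[X[X[X[X[X[X[X[X[X[X[P 5]]], X[X[X[X[X[P 9], X[P 4]]]]]]]]]], X[P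
4]]]]]]]]]]) (CloseR [A,C,B])) (Up (Ref 2 A B C A B C False))) (Split [C,A,C,C] (Up (Ref 3 A B C A B C False))
(Many [([B,A,C,B], [B,A,C,A]),([B,A,C,C], [B,A,C,A]),([C,A,C,C], [C,A,C,B])]))))))) level3_5 (grow level3_5) Em"
    by code_simp
qed (auto simp: refuted_level4_6[OF assms] refuted_level4_7[OF assms] refuted_level4_8[OF assms] refuted_level4_9[OF assms])

definition level4_10 :: trie where
  "level4_10 = tries [[A,C,A,C], [A,C,C,A], [A,C,C,B], [B,A,C,A], [B,A,C,C], [C,A,C,C], [C,B,A,C], [C,C,A,C],
[C,C,B,A]]"

lemma refuted_level4_10:
  assumes "c < mu"
  shows "refuted c level4_10"
proof (rule check_refuted[OF _ assms])
  show "check [] (Split [C,B,A,C,C] (CloseL [B,A,C,C]) (Split [C,B,A,C,A] (CloseL [B,A,C,A]) (Split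
[B,A,C,C,A] (Del [A,C,A,C,C] (X[X[X[X[X[X[X[X[P 4]]], X[X[X[X[X[P 6]]]], X[X[X[X[X[X[X[X[X[X[X[P 4]]],
X[X[X[X[X[P 6]]]], X[X[X[P 9,P 3]]]]]]]]], P 3]]]]]]]]]) (CloseR [A,C,A,C])) (Split [B,A,C,C,B] (Split
[C,A,C,C,B] (CloseL [A,C,C,B]) (Match False [C,A,C,C] [C] [C] [C,B,A] [C,A])) (Split [C,A,C,C,A] (Del
[A,C,A,C,C] (X[X[X[X[X[X[X[X[P 4]]], X[X[X[X[X[P 6]]]], X[X[X[X[X[X[X[X[P 4]], X[X[X[X[X[X[X[X[X[P 4]]], X[X[P
6], X[X[X[X[X[X[X[X[P 4]], X[X[X[P 13]], X[X[X[P 7]]]]]]]]]]]]]]]], X[X[X[P 7]]]]]]]]]]]]]]]]) (CloseR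
[A,C,A,C])) (Split [C,A,C,C,B] (Del [A,C,C,B,A] (X[X[X[X[X[P 4]]]]]) (CloseR [A,C,C,B])) (Many [([C,B,A,C,C],
[C,B,A,C,A]),([B,A,C,C,B], [B,A,C,C,A]),([C,A,C,C,B], [C,A,C,C,A])]))))))) level4_10 (grow level4_10) Em"
    by code_simp
qed simp

definition level3_6 :: trie where
  "level3_6 = tries [[A,C,A], [A,C,C], [B,A,C], [C,A,C], [C,B,A], [C,C,A], [C,C,B]]"

lemma refuted_level3_6:
  assumes "c < mu"
  shows "refuted c level3_6"
proof (rule check_refuted[OF _ assms])
  show "check [level4_10] (Split [A,C,C,A] (CloseL [C,C,A]) (Split [A,C,C,B] (CloseL [C,C,B]) (Split [B,A,C,A]
(Del [A,C,A,C] (X[P 2]) (CloseR [A,C,A])) (Split [B,A,C,C] (Del [C,C,A,C] (X[X[X[X[X[X[X[X[X[X[X[X[X[P 6]]], P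
2], X[X[X[X[X[X[X[X[X[X[X[X[X[P 6]]], P 2], X[P 9]]]]]], P 2], P 3]]]]]]]], P 2], X[P 3]]]]) (CloseR [C,C,A]))
(Split [C,A,C,A] (Up (Ref 0 A B C A B C False)) (Split [C,A,C,C] (Dead [A,C,C,B] (X[X[X[X[X[X[P 4]]]]]]))
(Many [([A,C,C,B], [A,C,C,A]),([B,A,C,C], [B,A,C,A]),([C,A,C,C], [C,A,C,A])]))))))) level3_6 (grow level3_6) Em"
    by code_simp
qed (auto simp: refuted_level4_10[OF assms])

definition level4_11 :: trie where
  "level4_11 = tries [[A,C,B,A], [A,C,C,A], [A,C,C,B], [B,A,C,B], [B,A,C,C], [C,A,C,C], [C,B,A,C], [C,C,A,C],
[C,C,B,A]]"

lemma refuted_level4_11: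
  assumes "c < mu"
  shows "refuted c level4_11"
proof (rule check_refuted[OF _ assms])
  show "check [] (Split [C,B,A,C,C] (CloseL [B,A,C,C]) (Split [C,B,A,C,B] (CloseL [B,A,C,B]) (Split
[B,A,C,C,A] (Del [A,C,C,A,C] (X[X[X[P 3]]]) (CloseR [A,C,C,A])) (Split [B,A,C,C,B] (Del [A,C,B,A,C] (X[X[X[P
3,X[X[X[X[X[X[X[X[X[X[P 3,X[X[X[X[X[X[X[P 10,X[X[X[X[X[X[P 7], X[P 3]]]]]]]], X[P 3]]]]]]]]], X[X[X[X[X[X[P
7], X[P 3]]]]]]]], X[P 3]]]]]]]]]) (CloseR [A,C,B,A])) (Split [C,A,C,C,A] (Up (Del [A,C,B,A,C,B] (X[X[P 3]])
(Split [C,B,A,C,C,B] (CloseL [B,A,C,C,B]) (Split [C,B,A,C,C,A] (CloseL [B,A,C,C,A]) (Split [C,C,B,A,C,B]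
(CloseL [C,B,A,C,B]) (Split [C,C,B,A,C,C] (Del [B,A,C,C,B,A] (X[X[X[X[X[X[X[X[X[X[X[X[P 7]]]]],
X[X[X[X[X[X[X[X[X[X[X[X[X[X[X[X[X[P 7,X[X[X[X[X[X[X[X[X[X[X[X[X[P 17]]], X[X[X[X[P 10]]]]]]]]]]]]]]]]]]]]],
X[X[X[X[P 10]]]]]]]]]]]]]]]]]]]]]) (CloseR [B,A,C,C,B])) (Up (Split [A,C,C,B,A,C,B] (CloseL [C,C,B,A,C,B])
(Split [A,C,C,B,A,C,C] (CloseL [C,C,B,A,C,C]) (Split [A,C,B,A,C,C,A] (Del [C,A,C,C,B,A,C]
(X[X[X[X[X[X[X[X[X[X[X[X[X[X[X[X[X[X[P 7]], X[P 4]]], X[X[X[X[X[X[X[X[X[X[X[X[X[X[X[X[X[X[P 7]], X[P 4]]], P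
14]]]]], P 4]], X[X[X[X[P 7]]]]]]]]]]]]]]]], P 4]], X[X[X[X[P 7]]]]]]]]]]]) (CloseR [C,A,C,C,B,A])) (Split
[A,C,B,A,C,C,B] (Del [B,A,C,C,B,A,C] (X[X[X[P 4]]]) (CloseR [B,A,C,C,B,A])) (Split [C,C,B,A,C,C,A] (Del
[C,A,C,C,B,A,C] (X[X[X[X[X[X[X[X[X[X[X[X[X[X[X[X[X[P 7,X[X[X[X[X[X[X[X[X[X[X[X[X[X[X[X[X[P 7,X[X[P 17]]]]]]],
X[P 4]]], X[X[X[X[P 10]]]]]]]]]]]]]]]]]]], X[P 4]]], X[X[X[X[X[X[X[X[P 10]]]]]]]]]]]]]]]]]]) (CloseR
[C,A,C,C,B,A])) (Split [C,C,B,A,C,C,B] (Up (Split [B,A,C,B,A,C,C,B] (CloseL [A,C,B,A,C,C,B]) (Split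
[B,A,C,B,A,C,C,A] (CloseL [A,C,B,A,C,C,A]) (Split [B,A,C,C,B,A,C,B] (Del [B,A,C,C,B,A,C,C]
(X[X[X[X[X[X[X[X[X[X[X[X[X[X[X[X[X[X[X[X[X[P 10]]]]]]]]], X[X[X[X[X[X[X[X[X[X[X[X[X[X[X[X[X[X[X[X[X[X[X[P
10]]]]]]]]], X[P 14]]]]]]]]]]]]], X[X[X[X[P 7]]]]]]]]]]]]]]]]]]) (CloseR [B,A,C,C,B,A,C])) (Split
[B,A,C,C,B,A,C,C] (Dead [B,A,C,C,B,A,C,B] (X[X[X[X[X[X[X[X[X[X[P 7]]], X[X[X[X[X[X[X[X[X[X[X[X[X[X[X[X[X[P
7,X[X[X[X[X[X[X[X[X[X[X[P 17], X[X[X[X[P 10]]]]]]]]], X[X[X[X[X[X[P 7]]]]]]]]]]]]]]]]]], X[X[X[X[P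
10]]]]]]]]], X[X[X[X[X[X[P 7]]]]]]]]]]]]]]]]]])) (Split [C,A,C,C,B,A,C,B] (Del [A,C,B,A,C,C,B,A]
(X[X[X[X[X[X[X[X[X[X[P 7]]]]]]]]]]) (CloseR [A,C,B,A,C,C,B])) (Split [C,A,C,C,B,A,C,C] (Match True
[A,C,B,A,C,C,A] [A] [A,B,C,C] [A,C,C] [A,B,C]) (Many [([B,A,C,C,B,A,C,C],
[B,A,C,C,B,A,C,B]),([B,A,C,B,A,C,C,B], [B,A,C,B,A,C,C,A]),([C,A,C,C,B,A,C,C], [C,A,C,C,B,A,C,B])]))))))))
(Many [([A,C,B,A,C,C,B], [A,C,B,A,C,C,A]),([A,C,C,B,A,C,C], [A,C,C,B,A,C,B]),([C,C,B,A,C,C,B],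
[C,C,B,A,C,C,A])])))))))))))))) (Split [C,A,C,C,B] (Del [A,C,B,A,C] (X[X[X[P 3,X[X[X[X[X[X[X[P 3,X[X[X[P
7]]]]]], X[P 4]]]]]]]]) (CloseR [A,C,B,A])) (Many [([C,B,A,C,C], [C,B,A,C,B]),([B,A,C,C,B],
[B,A,C,C,A]),([C,A,C,C,B], [C,A,C,C,A])]))))))) level4_11 (grow level4_11) Em"
    by code_simp
qed simp

definition level4_12 :: trie where
  "level4_12 = tries [[A,C,B,A], [A,C,C,A], [A,C,C,B], [B,A,C,C], [C,A,C,B], [C,A,C,C], [C,B,A,C], [C,C,A,C],
[C,C,B,A]]"

lemma refuted_level4_12:
  assumes "c < mu"
  shows "refuted c level4_12"
proof (rule check_refuted[OF _ assms])
  show "check [] (Split [C,C,A,C,C] (CloseL [C,A,C,C]) (Split [C,C,A,C,B] (CloseL [C,A,C,B]) (Split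
[B,A,C,C,A] (Del [A,C,C,A,C] (X[X[X[P 3]]]) (CloseR [A,C,C,A])) (Split [B,A,C,C,B] (Del [C,C,B,A,C]
(X[X[X[X[X[X[X[X[X[X[X[X[X[X[P 6], X[X[X[X[X[X[X[X[X[X[X[X[X[X[P 6], X[X[P 13]]]], X[X[P 3]]]]]], X[X[X[P
7]]]]], X[P 3]]]]]]]], X[X[P 3]]]]]], X[X[X[X[X[X[P 7], X[P 3]]]]]]]], X[P 3]]]]]]) (CloseR [C,C,B,A])) (Split
[C,A,C,C,A] (Match False [C,A,C,B] [C] [C] [C,A] [C,B,A]) (Split [C,A,C,C,B] (Del [C,C,B,A,C]
(X[X[X[X[X[X[X[X[X[X[X[X[X[P 6]]], X[X[X[X[X[X[X[X[X[X[X[X[X[P 6]]], P 10]], X[X[P 3]]]]]], P 4]]]]]], X[X[P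
3]]]]]], X[P 4]]]]]) (CloseR [C,C,B,A])) (Many [([C,C,A,C,C], [C,C,A,C,B]),([B,A,C,C,B],
[B,A,C,C,A]),([C,A,C,C,B], [C,A,C,C,A])]))))))) level4_12 (grow level4_12) Em"
    by code_simp
qed simp

definition level4_13 :: trie where
  "level4_13 = tries [[A,C,B,A], [A,C,C,A], [A,C,C,B], [B,A,C,B], [B,A,C,C], [C,A,C,B], [C,B,A,C], [C,C,A,C],
[C,C,B,A]]"

lemma refuted_level4_13:
  assumes "c < mu"
  shows "refuted c level4_13"
proof (rule check_refuted[OF _ assms])
  show "check [] (Split [C,B,A,C,C] (CloseL [B,A,C,C]) (Split [C,B,A,C,B] (CloseL [B,A,C,B]) (Split
[B,A,C,C,A] (CloseL [A,C,C,A]) (Split [B,A,C,C,B] (CloseL [A,C,C,B]) (Up (Split [C,B,A,C,C,B] (CloseL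
[B,A,C,C,B]) (Split [C,B,A,C,C,A] (CloseL [B,A,C,C,A]) (Split [A,C,B,A,C,C] (Del [A,C,C,B,A,C] (X[X[X[X[P
4]]]]) (CloseR [A,C,C,B,A])) (Split [C,C,B,A,C,B] (Del [B,A,C,B,A,C] (X[X[P 3]]) (CloseR [B,A,C,B,A])) (Split
[C,C,B,A,C,C] (Del [B,A,C,B,A,C] (X[X[P 3,X[X[X[X[X[X[X[P 3,X[X[X[P 7]]]]], X[X[X[X[X[X[X[X[P
3,X[X[X[X[X[X[X[P 3,X[X[P 7]]]], X[X[X[X[X[X[X[P 13], X[X[P 6]]]]]]]]]]]]]]], X[X[P 6]]]]]]]]]]]]]]]) (CloseR
[B,A,C,B,A])) (Split [A,C,B,A,C,B] (Up (Del [C,C,B,A,C,C,B] (X[X[X[P 4]]]) (Split [A,C,B,A,C,C,B] (CloseL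
[C,B,A,C,C,B]) (Split [A,C,C,B,A,C,B] (CloseL [C,C,B,A,C,B]) (Split [A,C,C,B,A,C,C] (CloseL [C,C,B,A,C,C])
(Split [A,C,B,A,C,C,A] (Del [B,A,C,B,A,C,C] (X[X[X[X[X[X[X[X[X[X[X[P 7]]]],
X[X[X[X[X[X[X[X[X[X[X[X[X[X[X[X[X[X[P 7], X[X[X[X[X[X[X[X[X[X[X[X[P 17]], X[X[X[X[X[P
10]]]]]]]]]]]]]]]]]]]]]], X[X[X[X[X[P 10]]]]]]]]]]]]]]]]]]]]]]) (CloseR [B,A,C,B,A,C])) (Up (Split
[B,A,C,C,B,A,C,B] (CloseL [A,C,C,B,A,C,B]) (Split [B,A,C,C,B,A,C,C] (CloseL [A,C,C,B,A,C,C]) (Split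
[B,A,C,B,A,C,C,A] (Del [B,A,C,B,A,C,C,B] (X[X[X[X[X[X[X[X[X[X[P 7]]], X[X[X[X[X[X[X[X[P 6]]],
X[X[X[X[X[X[X[X[X[X[X[X[X[P 7], X[X[X[X[X[X[X[X[P 6]]], X[X[X[X[X[X[P 17], X[X[X[X[X[X[X[X[P 6]]], P
10]]]]]]]]]]]]]]]]]]]]]], X[X[X[X[X[X[X[X[P 6]]], P 10]]]]]]]]]]]]]]]]]]]]]]) (CloseR [B,A,C,B,A,C,C])) (Split
[B,A,C,B,A,C,C,B] (Del [C,C,B,A,C,C,A,C] (X[X[X[X[X[X[X[X[X[X[X[X[X[X[X[X[X[X[X[X[X[X[X[X[X[X[X[X[P 13]]]],
X[X[P 6]]], X[X[X[X[X[X[X[X[X[X[X[X[X[X[X[X[X[X[X[X[X[X[X[X[X[X[X[X[P 13]]]], X[X[P 6]]], X[X[X[X[P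
23]]]]]]]]]]]]]]]], X[X[P 6]]], P 10]]]]]]]]]]]]]]]]]]]]]], X[X[P 6]]], X[X[X[X[X[X[X[P 10]]]]]]]]]]]]]]]]])
(CloseR [C,C,B,A,C,C,A])) (Split [C,A,C,B,A,C,C,A] (Match True [A,C,B,A,C,C,A] [A] [A,B,C] [A,C,C] [A,B,C,C])
(Split [C,A,C,B,A,C,C,B] (Del [A,C,B,A,C,C,B,A] (X[X[X[X[X[X[X[X[X[X[P 7]]]]]]]]]]) (CloseR [A,C,B,A,C,C,B]))
(Many [([B,A,C,C,B,A,C,C], [B,A,C,C,B,A,C,B]),([B,A,C,B,A,C,C,B], [B,A,C,B,A,C,C,A]),([C,A,C,B,A,C,C,B],
[C,A,C,B,A,C,C,A])])))))))))))))) (Many [([C,B,A,C,C,B], [C,B,A,C,C,A]),([C,C,B,A,C,C],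
[C,C,B,A,C,B]),([A,C,B,A,C,B], [A,C,B,A,C,C])])))))))))))) level4_13 (grow level4_13) Em"
    by code_simp
qed simp

definition level3_7 :: trie where
  "level3_7 = tries [[A,C,B], [A,C,C], [B,A,C], [C,A,C], [C,B,A], [C,C,A], [C,C,B]]"

lemma refuted_level3_7:
  assumes "c < mu"
  shows "refuted c level3_7"
proof (rule check_refuted[OF _ assms])
  show "check [level4_11, level4_12, level4_13] (Split [A,C,C,A] (CloseL [C,C,A]) (Split [A,C,C,B] (CloseL [C,C,B]) (Split
[B,A,C,C] (Dead [A,C,C,A] (X[X[X[X[P 3]]]])) (Split [C,A,C,B] (Split [B,A,C,B] (CloseL [A,C,B]) (Up (Ref 0 A B
C A B C False))) (Split [B,A,C,B] (Split [C,A,C,C] (Del [A,C,B,A] (X[X[X[X[X[X[X[X[X[X[X[P 6]]]]],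
X[X[X[X[X[X[X[X[X[X[X[X[X[P 6]]], X[X[X[X[X[P 10], P 4]]]]]]]]]], P 4]]]]]]]]]]) (CloseR [A,C,B])) (Up (Ref 1
A B C A B C False))) (Split [C,A,C,C] (Up (Ref 2 A B C A B C False)) (Many [([A,C,C,B], [A,C,C,A]),([B,A,C,C],
[B,A,C,B]),([C,A,C,C], [C,A,C,B])]))))))) level3_7 (grow level3_7) Em"
    by code_simp
qed (auto simp: refuted_level4_11[OF assms] refuted_level4_12[OF assms] refuted_level4_13[OF assms])

definition level4_14 :: trie where
  "level4_14 = tries [[A,C,A,C], [A,C,B,A], [A,C,C,A], [B,A,C,A], [B,A,C,C], [C,A,C,B], [C,A,C,C], [C,B,A,C],
[C,C,A,C]]"

lemma refuted_level4_14:
  assumes "c < mu"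
  shows "refuted c level4_14"
proof (rule check_refuted[OF _ assms])
  show "check [] (Split [C,B,A,C,C] (CloseL [B,A,C,C]) (Split [C,B,A,C,A] (CloseL [B,A,C,A]) (Split
[A,C,A,C,B] (Del [B,A,C,C,A] (X[X[X[X[X[X[X[X[X[X[P 6]]]], X[X[X[X[X[X[X[X[X[X[X[X[X[X[P
6,X[X[X[X[X[X[X[X[X[X[P 14]], X[X[X[P 8]], X[P 3]]]]]]]]], X[P 3]]]]]]]], X[X[X[P 8]], X[P 3]]]]]]]]], X[P
3]]]]]]]]) (CloseR [B,A,C,C])) (Split [A,C,A,C,C] (Dead [A,C,A,C,B] (X[X[X[X[X[X[X[X[P 5]]],
X[X[X[X[X[X[X[X[X[X[X[X[P 5], X[X[X[X[X[X[X[P 11], X[X[P 6,X[X[P 3]]]]]]]], X[X[P 3]]]]]]]]], X[X[P 6,X[X[P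
3]]]]]]]], X[X[P 3]]]]]]]]])) (Split [C,C,A,C,B] (Dead [A,C,A,C,B] (X[X[X[X[X[X[X[X[P 5]]]]]]]])) (Split
[C,C,A,C,C] (Match True [A,C,A,C] [C] [C,A] [C] [C,A,B]) (Many [([C,B,A,C,C], [C,B,A,C,A]),([A,C,A,C,C],
[A,C,A,C,B]),([C,C,A,C,C], [C,C,A,C,B])]))))))) level4_14 (grow level4_14) Em"
    by code_simp
qed simp

definition level3_8 :: trie where
  "level3_8 = tries [[A,C,A], [A,C,B], [A,C,C], [B,A,C], [C,A,C], [C,B,A], [C,C,A]]"

lemma refuted_level3_8:
  assumes "c < mu"
  shows "refuted c level3_8"
proof (rule check_refuted[OF _ assms])
  show "check [level4_14] (Split [B,A,C,A] (Del [A,C,A,C] (X[P 2]) (CloseR [A,C,A])) (Split [B,A,C,C] (Del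
[A,C,A,C] (X[X[X[X[X[X[P 3]], X[X[X[X[X[X[X[P 3]], P 5]]], P 2], X[X[X[X[X[X[X[X[X[P 3]], X[X[X[X[X[X[X[P 3]],
P 5]]], P 2], X[X[X[P 8,X[P 3]]]]]]]], P 2], X[P 3]]]]]]]], P 2]) (CloseR [A,C,A])) (Split [C,A,C,B] (Del
[A,C,B,A] (X[X[X[X[P 3]]]]) (CloseR [A,C,B])) (Split [C,A,C,C] (Del [C,C,A,C] (X[X[X[X[X[X[X[P 3]],
X[X[X[X[X[X[X[P 3]], X[X[P 5,P 2], X[X[X[X[X[X[X[P 3]], X[X[X[X[X[X[X[P 3]], X[X[P 5,P 2], X[X[P 11]]]]]], P
2], X[X[P 6]]]]]]]]]]]], P 2], X[X[X[X[X[X[X[P 3]], P 6]]]]]]]]]]]) (CloseR [C,C,A])) (Split [B,A,C,B] (Split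
[C,A,C,A] (Up (Ref 0 A B C A B C False)) (Many [([B,A,C,C], [B,A,C,A]),([C,A,C,C], [C,A,C,B]),([C,A,C,A],
[C,A,C,B])])) (Many [([B,A,C,C], [B,A,C,A]),([C,A,C,C], [C,A,C,B]),([B,A,C,B], [B,A,C,A])])))))) level3_8 (grow
level3_8) Em"
    by code_simp
qed (auto simp: refuted_level4_14[OF assms])

definition level2_4 :: trie where
  "level2_4 = tries [[A,C], [B,A], [C,A], [C,B], [C,C]]"

lemma refuted_level2_4:
  assumes "c < mu"
  shows "refuted c level2_4"
proof (rule check_refuted[OF _ assms])
  show "check [level3_5, level3_6, level3_7, level3_8] (Del [C,C,C] (P 1) (Split [A,C,C] (CloseL [C,C]) (Split [C,C,A] (Split
[A,C,A] (CloseL [C,A]) (Split [A,C,B] (Del [B,A,C] (X[X[X[X[X[X[X[P 4]]], X[X[X[X[X[X[X[X[X[P 4]]], X[X[P 6,P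
2]]]]]], P 2]]]]]]) (CloseR [B,A])) (Up (Ref 0 A B C A B C False)))) (Split [A,C,B] (Split [C,C,B] (CloseL
[C,B]) (Split [A,C,A] (Del [B,A,C] (X[X[X[X[X[X[X[P 4]]], X[X[X[X[X[X[X[X[X[P 4]], X[X[X[X[P 7], X[P
3]]]]]]]], X[P 3]]]]]]]]) (CloseR [B,A])) (Up (Ref 1 A B C A B C False)))) (Split [A,C,A] (Split [C,C,B] (Del
[B,A,C] (X[X[X[X[X[P 3]], X[X[X[X[X[X[X[X[P 3]], X[X[X[P 6,X[X[P 3]]]]]]]], X[X[P 3]]]]]]]]) (CloseR [B,A]))
(Up (Ref 2 A B C A B C False))) (Split [C,C,B] (Up (Ref 3 A B C A B C False)) (Many [([A,C,B],
[A,C,A]),([A,C,C], [A,C,A]),([C,C,B], [C,C,A])]))))))) level2_4 (grow level2_4) Em"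
    by code_simp
qed (auto simp: refuted_level3_5[OF assms] refuted_level3_6[OF assms] refuted_level3_7[OF assms] refuted_level3_8[OF assms])

section \<open>Three letters, none of them doubled\<close>

definition level4_15 :: trie where
  "level4_15 = tries [[A,C,A,C], [A,C,B,A], [A,C,B,C], [B,A,C,A], [B,A,C,B], [B,C,B,A], [C,A,C,B], [C,B,A,C],
[C,B,C,B]]"

lemma refuted_level4_15:
  assumes "c < mu"
  shows "refuted c level4_15"
proof (rule check_refuted[OF _ assms])
  show "check [] (Split [C,B,A,C,A] (CloseL [B,A,C,A]) (Split [C,B,A,C,B] (CloseL [B,A,C,B]) (Split
[B,A,C,B,C] (Del [B,C,B,A,C] (X[X[X[X[X[X[X[X[X[X[P 3,X[X[X[X[X[X[X[X[X[X[P 3,P 10]], X[X[X[X[P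
5,X[X[X[X[X[X[X[X[X[X[P 3,X[X[X[X[X[X[X[X[X[X[P 3,P 10]], X[X[X[X[P 5,X[X[X[X[X[X[P 22]]]]]]]]]]],
X[X[X[X[X[X[P 7]]]]]]]]]]]]]]], X[X[X[X[P 5,X[P 12]]]]]], X[X[X[P 7]]]]]]]]]]]]]]], X[X[X[X[X[X[P
7]]]]]]]]]]]]]]], X[X[X[X[P 5,X[X[X[X[X[X[X[X[X[X[P 3,X[X[X[X[X[X[X[X[X[X[P 3,P 10]], X[X[X[X[P
5,X[X[X[X[X[X[X[X[X[X[P 3,X[X[X[X[X[X[P 22]]]]]]]], X[X[X[X[P 5,X[P 12]]]]]], X[X[X[P 7]]]]]]]]]]]]]]],
X[X[X[X[X[X[P 7]]]]]]]]]]]]]]], X[X[X[X[P 5,X[P 12]]]]]], X[X[X[P 7]]]]]]]]]]]]]]], X[X[X[X[X[X[P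
7]]]]]]]]]]]]]) (CloseR [B,C,B,A])) (Split [C,A,C,B,A] (Dead [B,A,C,B,C] (X[X[X[X[P 3]], X[X[X[X[X[X[X[P 3]],
X[P 5]]], X[X[X[X[X[X[X[P 3,X[X[X[X[X[X[X[P 3]], X[X[P 5]]]], X[X[X[X[X[X[P 10]], X[X[X[X[X[X[X[P 3]], X[X[X[P
5,X[X[X[X[X[X[X[P 3,X[X[X[X[X[X[X[P 3]], X[X[P 5]]]], X[X[X[X[X[X[P 10]], X[X[X[X[X[X[X[P 3]], X[X[X[P 5,X[P
22]]]]]], X[X[X[P 7]]]]]]]]]]]]]]]], X[X[X[X[X[X[X[P 3]], P 12]], X[X[X[P 7]]]]]]]]]]]]]]], X[X[X[P
7]]]]]]]]]]]]]]]], X[X[X[X[X[X[X[P 3]], X[X[X[P 5,X[X[X[X[X[X[X[P 3,X[X[X[X[X[X[X[P 3]], X[X[P 5]]]],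
X[X[X[X[X[X[P 10]], X[X[X[X[X[X[X[P 3]], X[X[X[P 5,X[X[X[X[X[X[X[P 3,X[X[X[X[X[X[X[P 3]], X[X[P 5]]]], X[X[P
22]]]]]]]], X[X[X[X[X[X[X[P 3]], P 12]], X[X[X[P 7]]]]]]]]]]]]]]], X[X[X[P 7]]]]]]]]]]]]]]]], X[X[X[X[P 12],
X[X[X[P 7]]]]]]]]]]]]]]], X[X[X[P 7]]]]]]]]]]]]]]])) (Split [C,A,C,B,C] (Del [B,C,B,A,C] (X[X[X[X[X[X[X[P 3],
X[X[X[X[X[X[X[P 3,X[X[X[X[X[X[X[P 3], X[X[X[X[X[X[X[P 3,X[X[P 13]]]], X[X[P 5]]], X[X[X[X[X[X[X[P 3],
X[X[X[X[X[X[X[P 3,X[X[X[X[X[X[X[P 3], X[X[X[X[X[X[X[P 3,X[X[P 13]]]], X[X[P 5]]], X[X[X[X[X[X[X[P 3], X[P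
23]], X[X[X[P 5]]]]]]]]]]]]], X[X[P 5]]]]]]]]], X[X[P 5]]], P 10]]]]], X[X[X[P 5]]]]]]]]]]]]], X[X[P
5]]]]]]]]], X[X[P 5]]], X[X[X[X[X[X[X[P 3], X[X[X[X[X[X[X[P 3,X[X[X[X[X[X[X[P 3], X[X[X[X[X[X[X[P 3,X[X[P
13]]]], X[X[P 5]]], X[X[X[X[X[X[X[P 3], X[X[X[X[X[X[X[P 3,X[X[X[X[X[X[X[P 3], X[P 23]], X[X[P 5]]]]]]]]],
X[X[P 5]]], P 10]]]]], X[X[X[P 5]]]]]]]]]]]]], X[X[P 5]]]]]]]]], X[X[P 5]]], P 10]]]]], X[X[X[P
5]]]]]]]]]]]]], X[X[X[P 5]]]]]]]]) (CloseR [B,C,B,A])) (Split [B,A,C,B,A] (Up (Split [A,C,A,C,B,C] (CloseL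
[C,A,C,B,C]) (Split [A,C,A,C,B,A] (CloseL [C,A,C,B,A]) (Split [A,C,B,A,C,A] (Split [B,C,B,A,C,A] (CloseL
[C,B,A,C,A]) (Match False [C,A,C,B,A] [C] [C,B,A] [C,A] [C,B])) (Split [B,C,B,A,C,A] (Dead [A,C,A,C,B,A]
(X[X[X[X[X[X[X[P 5]]]]]]])) (Split [A,C,B,A,C,B] (Split [B,C,B,A,C,B] (CloseL [C,B,A,C,B]) (Up (Split
[C,B,C,B,A,C,A] (CloseL [B,C,B,A,C,A]) (Split [C,B,C,B,A,C,B] (CloseL [B,C,B,A,C,B]) (Split [B,A,C,A,C,B,A]
(CloseL [A,C,A,C,B,A]) (Split [B,A,C,A,C,B,C] (CloseL [A,C,A,C,B,C]) (Up (Split [C,B,A,C,A,C,B,C] (CloseL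
[B,A,C,A,C,B,C]) (Split [C,B,A,C,A,C,B,A] (CloseL [B,A,C,A,C,B,A]) (Split [A,C,B,C,B,A,C,B] (CloseL
[C,B,C,B,A,C,B]) (Split [A,C,B,C,B,A,C,A] (CloseL [C,B,C,B,A,C,A]) (Up (Del [A,C,B,A,C,A,C,B,A] (X[X[X[X[P
5]]]]) (Del [B,A,C,B,C,B,A,C,B] (X[X[X[X[P 5]]]]) (Split [C,A,C,B,C,B,A,C,B] (CloseL [A,C,B,C,B,A,C,B]) (Split
[B,C,B,A,C,A,C,B,A] (CloseL [C,B,A,C,A,C,B,A]) (Split [B,C,B,A,C,A,C,B,C] (Del [A,C,A,C,B,C,B,A,C]
(X[X[X[X[X[X[X[X[X[X[X[X[X[X[X[X[X[X[X[X[X[X[X[X[X[X[X[X[X[X[X[X[X[X[P 17]]]]]], X[X[X[X[X[X[X[X[X[X[P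
12]]]]]]]]]]]]]]]]]]]]]]]]]]], X[X[X[X[X[X[X[X[X[X[P 12]]]]]]]]]]]]]]]]]]]]]) (CloseR [A,C,A,C,B,C,B,A]))
(Split [C,A,C,B,C,B,A,C,A] (Del [A,C,A,C,B,A,C,A,C]
(X[X[X[X[X[X[X[X[X[X[X[X[X[X[X[X[X[X[X[X[X[X[X[X[X[X[X[X[X[X[X[X[X[X[P 17]], X[X[X[X[X[X[X[X[X[X[P
12]]]]]]]]]]]]]]]]]]]]]]]]]]], X[X[X[X[X[X[X[X[X[X[P 12]]]]]]]]]]]]]]]]]]]]]]]]]) (CloseR [A,C,A,C,B,A,C,A]))
(Up (Del [B,A,C,B,C,B,A,C,A,C] (X[X[X[X[X[X[X[X[X[X[X[X[X[X[X[X[X[X[X[X[X[X[X[X[X[X[X[X[X[X[X[X[X[P 17]]]]]]],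
X[X[X[X[X[X[X[X[X[X[P 12]]]]]]], X[X[X[P 7]]]]]]]]]]]]]]], X[X[X[X[X[X[X[X[X[X[P 12]]]]]],
X[X[X[X[X[X[X[X[X[X[X[X[X[X[X[X[X[X[X[X[X[X[X[X[X[X[X[X[X[X[X[X[X[X[X[P 17]]]]]], X[X[X[X[X[X[X[X[X[X[P
12]]]]]]], X[X[X[P 7]]]]]]]]]]]]]]], X[X[X[X[X[X[X[X[X[X[P 12]]]]]], X[X[X[X[X[P 24]], P 7]]]]]]]]]]]]]]],
X[X[X[X[X[X[P 12]]], X[X[X[P 7]]]]]]]]]]]]]]], P 7]]]]]]]]]]]]]]], X[X[X[X[X[X[X[X[X[X[X[P 12]]]]]]]], X[X[X[P
7]]]]]]]]]]]]]]]) (CloseR [B,A,C,B,C,B,A,C,A]))))))))))))))))))))) (Split [B,C,B,A,C,B] (Match True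
[A,C,B,A,C] [C] [C,A,B] [C,B] [C,A]) (Many [([A,C,A,C,B,C], [A,C,A,C,B,A]),([A,C,B,A,C,B],
[A,C,B,A,C,A]),([B,C,B,A,C,B], [B,C,B,A,C,A])])))))))) (Many [([C,A,C,B,C], [C,A,C,B,A]),([C,B,A,C,B],
[C,B,A,C,A]),([B,A,C,B,A], [B,A,C,B,C])]))))))) level4_15 (grow level4_15) Em"
    by code_simp
qed simp

definition level3_9 :: trie where
  "level3_9 = tries [[A,C,A], [A,C,B], [B,A,C], [B,C,B], [C,A,C], [C,B,A], [C,B,C]]"

lemma refuted_level3_9:
  assumes "c < mu"
  shows "refuted c level3_9"
proof (rule check_refuted[OF _ assms])
  show "check [level4_15] (Del [B,C,B,C] (X[P 2]) (Del [C,A,C,A] (X[P 2]) (Split [A,C,B,C] (CloseL [C,B,C]) (Split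
[B,A,C,A] (CloseL [A,C,A]) (Split [A,C,B,A] (Del [B,A,C,B] (X[X[X[X[X[X[X[X[X[P 5]]]],
X[X[X[X[X[X[X[X[X[X[X[X[P 5,X[X[X[X[X[X[X[X[X[P 12]], X[X[X[P 7]]]]]]]]]]]]]]], X[X[X[P 7]]]]]]]]]]]]]]]) (Del
[A,C,A,C] (X[X[X[X[X[X[X[X[X[X[X[X[X[X[P 7]]]]]]]]]]]]]]) (CloseR [A,C,A]))) (Split [B,A,C,B] (Dead [A,C,B,A]
(X[X[X[X[X[X[X[X[X[P 5]]]], X[X[X[X[X[X[X[X[X[X[X[X[P 5,X[X[X[X[X[X[X[X[X[P 12]], X[X[X[P 7]]]]]]]]]]]]]]],
X[X[X[P 7]]]]]]]]]]]]]]])) (Up (Ref 0 A B C A B C False)))))))) level3_9 (grow level3_9) Em"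
    by code_simp
qed (auto simp: refuted_level4_15[OF assms])

definition level4_16 :: trie where
  "level4_16 = tries [[A,C,B,A], [A,C,B,C], [B,A,C,B], [B,C,A,C], [B,C,B,A], [C,A,C,B], [C,B,A,C], [C,B,C,A],
[C,B,C,B]]"

lemma refuted_level4_16:
  assumes "c < mu"
  shows "refuted c level4_16"
proof (rule check_refuted[OF _ assms])
  show "check [] (Split [A,C,B,C,A] (CloseL [C,B,C,A]) (Split [A,C,B,C,B] (CloseL [C,B,C,B]) (Split
[B,A,C,B,C] (Dead [A,C,B,C,A] (X[X[X[X[X[P 4]]]]])) (Split [C,A,C,B,A] (Dead [B,A,C,B,C] (X[X[X[X[P 3]],
X[X[X[X[X[X[X[P 3]], X[P 5]]], X[X[X[X[X[X[X[X[P 3]], X[X[X[X[X[X[X[P 3]], X[P 5]]], X[X[X[X[P 9,X[P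
4]]]]]]]]]], X[P 4]]]]]]]]]])) (Split [C,A,C,B,C] (Del [B,C,B,A,C] (X[X[X[X[X[X[X[P 3], X[X[X[X[X[X[X[X[P 3],
X[X[X[P 7]]]], X[X[X[X[X[X[X[P 3], X[X[X[X[X[X[X[X[P 3], X[X[X[P 7]]]], X[P 12]]]]]]]], X[P 5]]]]]]]]]]]]],
X[X[X[P 5]]]]]]]]) (CloseR [B,C,B,A])) (Split [B,A,C,B,A] (Up (Split [B,C,A,C,B,C] (CloseL [C,A,C,B,C]) (Split
[B,C,A,C,B,A] (CloseL [C,A,C,B,A]) (Split [B,A,C,B,C,A] (Del [A,C,B,C,A,C] (X[X[X[X[P 4]]]]) (CloseR
[A,C,B,C,A])) (Split [B,A,C,B,C,B] (Del [B,C,B,A,C,B] (X[X[X[X[X[X[X[X[X[X[X[X[X[X[X[X[X[P 7],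
X[X[X[X[X[X[X[X[X[X[X[X[X[X[X[X[X[P 7], X[X[P 16]]]], X[X[P 4]]]]]]], X[X[X[X[P 9]]]]]], X[P 4]]]]]]]]]],
X[X[P 4]]]]]]], X[X[X[X[X[X[X[X[P 9], X[P 4]]]]]]]]]], X[P 4]]]]]]]]) (CloseR [B,C,B,A,C])) (Split
[C,A,C,B,C,A] (Match False [C,A,C,B,A] [C] [C,B] [C,A] [C,B,A]) (Split [C,A,C,B,C,B] (Del [B,C,B,A,C,B]
(X[X[X[X[X[X[X[X[X[X[X[X[X[X[X[X[P 7]]]], X[X[X[X[X[X[X[X[X[X[X[X[X[X[X[X[P 7]]]], P 12]], X[X[P 4]]]]]]], X[P
5]]]]]]]], X[X[P 4]]]]]]], X[X[P 5]]]]]]]) (CloseR [B,C,B,A,C])) (Many [([B,C,A,C,B,C],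
[B,C,A,C,B,A]),([B,A,C,B,C,B], [B,A,C,B,C,A]),([C,A,C,B,C,B], [C,A,C,B,C,A])])))))))) (Many [([C,A,C,B,C],
[C,A,C,B,A]),([A,C,B,C,B], [A,C,B,C,A]),([B,A,C,B,A], [B,A,C,B,C])]))))))) level4_16 (grow level4_16) Em"
    by code_simp
qed simp

definition level3_10 :: trie where
  "level3_10 = tries [[A,C,B], [B,A,C], [B,C,A], [B,C,B], [C,A,C], [C,B,A], [C,B,C]]"

lemma refuted_level3_10:
  assumes "c < mu"
  shows "refuted c level3_10"
proof (rule check_refuted[OF _ assms])
  show "check [level4_16] (Del [B,C,B,C] (X[P 2]) (Split [C,B,C,A] (CloseL [B,C,A]) (Split [C,B,C,B] (CloseL
[B,C,B]) (Split [A,C,B,C] (CloseL [C,B,C]) (Split [A,C,B,A] (Del [B,A,C,B] (X[X[X[X[X[X[X[X[X[P 5]]]],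
X[X[X[X[X[X[X[X[X[X[X[X[P 5]]], X[X[X[X[X[P 9], X[P 4]]]]]]]]]], X[P 4]]]]]]]]]]) (CloseR [B,A,C])) (Up (Ref 0
A B C A B C False))))))) level3_10 (grow level3_10) Em"
    by code_simp
qed (auto simp: refuted_level4_16[OF assms])

text \<open>After exchanging A and C these are the two-letter words permitted by
  \<open>core\<close>. The fixed point of \<open>gamma\<close>, whose critical exponent is
  \<open>mu\<close>, belongs to this case.\<close>

definition level2_5 :: trie where
  "level2_5 = tries [[A,C], [B,A], [B,C], [C,A], [C,B]]"

lemma refuted_level2_5:
  assumes "c < mu"
  shows "refuted c level2_5"
proof (rule check_refuted[OF _ assms])
  show "check [level3_9, level3_10] (Split [C,B,A] (CloseL [B,A]) (Split [C,B,C] (CloseL [B,C]) (Split [A,C,B] (Del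
[B,C,A] (X[X[X[P 2]]]) (Del [B,C,B] (X[X[P 2]]) (CloseR [B,C]))) (Split [B,C,A] (Split [A,C,A] (CloseL [C,A])
(Up (Ref 0 A B C A B C False))) (Split [A,C,A] (Split [B,C,B] (Del [B,A,C] (X[X[X[X[X[P 3]], X[X[X[X[X[X[X[X[P
3], X[X[X[X[X[P 7], X[X[P 4]]]]]]]]], X[X[P 4]]]]]]]]]) (CloseR [B,A])) (Up (Ref 1 A B C A B C False))) (Split
[B,C,B] (Up (Ref 1 B A C B A C True)) (Many [([A,C,B], [A,C,A]),([C,B,C], [C,B,A]),([B,C,B], [B,C,A])])))))))
level2_5 (grow level2_5) Em"
    by code_simp
qed (auto simp: refuted_level3_9[OF assms] refuted_level3_10[OF assms])

section \<open>Three letters in the cyclic order A, C, B, with BB and CC allowed\<close>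

definition level5_1 :: trie where
  "level5_1 = tries [[A,C,B,B,A], [A,C,C,B,A], [A,C,C,B,B], [B,A,C,B,B], [B,A,C,C,B], [B,B,A,C,C], [C,B,A,C,B],
[C,B,A,C,C], [C,B,B,A,C], [C,C,B,A,C], [C,C,B,B,A]]"

text \<open>\<open>level4_17\<close> is invariant under reversal combined with the exchange of B and
  C. Of two branches interchanged by this symmetry, one is the state treated here and the other
  refers to it.\<close>

lemma refuted_level5_1:
  assumes "c < mu"
  shows "refuted c level5_1"
proof (rule check_refuted[OF _ assms])
  show "check [] (Split [B,A,C,C,B,B] (CloseL [A,C,C,B,B]) (Split [B,A,C,C,B,A] (CloseL [A,C,C,B,A]) (Split
[C,C,B,A,C,C] (CloseL [C,B,A,C,C]) (Split [C,C,B,A,C,B] (CloseL [C,B,A,C,B]) (Up (Del [C,B,A,C,C,B,A] (X[X[X[P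
4]]]) (Split [A,C,C,B,A,C,B] (CloseL [C,C,B,A,C,B]) (Split [A,C,C,B,A,C,C] (CloseL [C,C,B,A,C,C]) (Split
[B,B,A,C,C,B,A] (CloseL [B,A,C,C,B,A]) (Split [B,B,A,C,C,B,B] (Del [A,C,B,B,A,C,C]
(X[X[X[X[X[X[X[X[X[X[X[X[X[P 8]]]]], X[X[X[X[X[X[X[X[X[X[X[X[X[X[X[X[X[X[X[P 8]], X[X[X[X[X[X[X[X[X[X[X[P
17]], X[X[X[X[P 9]]]]]]]]]]]]]]]]]]]]], X[X[X[X[P 9]]]]]]]]]]]]]]]]]]]]]) (CloseR [A,C,B,B,A,C])) (Up (Split
[C,B,B,A,C,C,B,B] (CloseL [B,B,A,C,C,B,B]) (Split [C,B,B,A,C,C,B,A] (CloseL [B,B,A,C,C,B,A]) (Split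
[B,A,C,C,B,A,C,B] (CloseL [A,C,C,B,A,C,B]) (Split [B,A,C,C,B,A,C,C] (CloseL [A,C,C,B,A,C,C]) (Up (Split
[B,B,A,C,C,B,A,C,B] (CloseL [B,A,C,C,B,A,C,B]) (Split [B,B,A,C,C,B,A,C,C] (CloseL [B,A,C,C,B,A,C,C]) (Split
[A,C,B,B,A,C,C,B,A] (Del [C,B,A,C,C,B,B,A,C] (X[X[X[X[X[X[X[X[X[X[X[X[X[X[X[X[X[X[X[X[X[X[X[X[X[X[X[X[X[P
13]]]]], P 5]], X[X[X[X[X[X[X[X[X[X[X[X[X[X[X[X[X[X[X[X[X[X[X[X[X[X[X[X[X[P 13]]]]], P 5]], X[X[P
22]]]]]]]]]]]]], P 5]], X[P 9]]]]]]]]]]]]]]]]]]]]], P 5]], X[X[X[X[X[P 9]]]]]]]]]]]]]]) (CloseR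
[C,B,A,C,C,B,B,A])) (Split [A,C,B,B,A,C,C,B,B] (Del [B,B,A,C,C,B,B,A,C] (X[X[X[X[P 5]]]]) (CloseR
[B,B,A,C,C,B,B,A])) (Split [C,C,B,B,A,C,C,B,A] (Dead [A,C,B,B,A,C,C,B,A] (X[X[X[X[X[X[X[X[X[X[X[P
8]]]]]]]]]]])) (Split [C,C,B,B,A,C,C,B,B] (Up (Split [B,A,C,B,B,A,C,C,B,B] (CloseL [A,C,B,B,A,C,C,B,B]) (Split
[B,A,C,B,B,A,C,C,B,A] (CloseL [A,C,B,B,A,C,C,B,A]) (Split [C,B,B,A,C,C,B,A,C,B] (CloseL [B,B,A,C,C,B,A,C,B])
(Split [C,B,B,A,C,C,B,A,C,C] (CloseL [B,B,A,C,C,B,A,C,C]) (Up (Split [C,B,A,C,B,B,A,C,C,B,A] (CloseL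
[B,A,C,B,B,A,C,C,B,A]) (Split [C,B,A,C,B,B,A,C,C,B,B] (CloseL [B,A,C,B,B,A,C,C,B,B]) (Split
[A,C,B,B,A,C,C,B,A,C,B] (Split [C,C,B,B,A,C,C,B,A,C,B] (CloseL [C,B,B,A,C,C,B,A,C,B]) (Match False
[A,C,B,B,A,C,C,B,A,C] [A] [A,C,C,B] [A,C,B,B] [A,C,C,B,B])) (Split [A,C,B,B,A,C,C,B,A,C,C] (Del
[B,B,A,C,C,B,B,A,C,C,B] (X[X[X[X[X[X[X[X[X[X[X[X[X[X[P 8]]]], X[X[X[X[X[X[X[X[X[X[X[X[P 13]]]]]]]]],
X[X[X[X[X[X[X[X[X[X[X[X[X[X[X[X[X[X[X[X[X[X[X[P 8]]]], X[X[X[X[X[X[X[X[X[X[P 13]]]]]]], X[X[X[X[X[X[X[X[X[P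
22,X[P 9]]]]]]]]]]]]]]]]]]]]]]], X[P 9]]]]]]]]]]]]]]]]]]]]]]]) (CloseR [B,B,A,C,C,B,B,A,C,C])) (Split
[C,C,B,B,A,C,C,B,A,C,B] (Dead [A,C,B,B,A,C,C,B,A,C,B] (X[X[X[X[X[X[X[X[X[P 8]]]]]]]]])) (Split
[C,C,B,B,A,C,C,B,A,C,C] (Match True [A,C,B,B,A,C,C,B,B,A] [A] [A,B,C,C] [A,B,B,C,C] [A,B,B,C]) (Many
[([C,B,A,C,B,B,A,C,C,B,B], [C,B,A,C,B,B,A,C,C,B,A]),([A,C,B,B,A,C,C,B,A,C,C],
[A,C,B,B,A,C,C,B,A,C,B]),([C,C,B,B,A,C,C,B,A,C,C], [C,C,B,B,A,C,C,B,A,C,B])]))))))))))))) (Many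
[([A,C,B,B,A,C,C,B,B], [A,C,B,B,A,C,C,B,A]),([B,B,A,C,C,B,A,C,C], [B,B,A,C,C,B,A,C,B]),([C,C,B,B,A,C,C,B,B],
[C,C,B,B,A,C,C,B,A])]))))))))))))))))))))))) level5_1 (grow level5_1) Em"
    by code_simp
qed simp

definition level4_17 :: trie where
  "level4_17 = tries [[A,C,B,B], [A,C,C,B], [B,A,C,B], [B,A,C,C], [B,B,A,C], [C,B,A,C], [C,B,B,A], [C,C,B,A],
[C,C,B,B]]"

lemma refuted_level4_17:
  assumes "c < mu"
  shows "refuted c level4_17"
proof (rule check_refuted[OF _ assms])
  show "check [level5_1] (Split [A,C,C,B,B] (CloseL [C,C,B,B]) (Split [A,C,C,B,A] (CloseL [C,C,B,A]) (Split
[B,B,A,C,C] (Dead [A,C,C,B,A] (X[X[X[X[X[P 4]]]]])) (Split [C,B,A,C,B] (Split [B,B,A,C,B] (CloseL [B,A,C,B])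
(Up (Split [B,A,C,C,B,B] (CloseL [A,C,C,B,B]) (Split [B,A,C,C,B,A] (CloseL [A,C,C,B,A]) (Split [C,B,B,A,C,B]
(CloseL [B,B,A,C,B]) (Split [C,B,B,A,C,C] (CloseL [B,B,A,C,C]) (Up (Del [A,C,B,B,A,C,B] (X[X[X[P 4]]]) (Del
[C,B,A,C,C,B,A] (X[X[X[P 4]]]) (Split [C,C,B,B,A,C,B] (CloseL [C,B,B,A,C,B]) (Split [B,B,A,C,C,B,A] (CloseL
[B,A,C,C,B,A]) (Split [B,B,A,C,C,B,B] (Del [A,C,B,B,A,C,C]
(X[X[X[X[X[X[X[X[X[X[X[X[X[X[X[X[X[X[X[X[X[X[X[X[X[X[P 13,X[X[X[X[X[X[X[X[P 9]]]]]]]]]]]]]]]]]]]]],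
X[X[X[X[X[X[X[X[P 9]]]]]]]]]]]]]]]]]]]]]) (CloseR [A,C,B,B,A,C])) (Split [C,C,B,B,A,C,C] (Del [A,C,C,B,A,C,C]
(X[X[X[X[X[X[X[X[X[X[X[X[X[X[X[X[X[X[X[P 9]]]]]]]], X[X[X[X[X[X[X[X[X[X[X[X[X[X[X[X[X[X[X[X[X[P 9]]]]]]]],
X[X[P 13]]]]]]]]]]]]]]]]]]]]]]]]]]) (CloseR [A,C,C,B,A,C])) (Up (Del [A,C,B,B,A,C,C,B]
(X[X[X[X[X[X[X[X[X[X[X[X[X[X[X[P 9]]]]]], X[X[P 5]]]], X[X[X[X[X[X[X[X[X[X[X[X[X[X[X[X[X[X[X[X[X[P 9]]]]]],
X[X[P 5]]]], X[X[X[X[X[P 13]]]]]]]]]]]], X[X[X[X[X[X[X[X[X[X[X[X[X[X[X[X[X[P 9]]], X[X[P 5]]]],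
X[X[X[X[X[X[X[X[X[X[X[X[X[X[X[X[X[X[X[X[X[P 9]]]]]], X[X[P 5]]]], X[X[X[X[X[P 13]]]]]]]]]]]], X[X[X[X[X[X[P
18], P 5]], X[X[X[X[X[P 9]]]]]]]]]]]]]]]]]]]]], P 5]], X[X[X[X[X[P 9]]]]]]]]]]]]]]]]]]]]]) (CloseR
[A,C,B,B,A,C,C])))))))))))))))) (Split [B,B,A,C,B] (Split [C,B,A,C,C] (Del [A,C,B,B,A]
(X[X[X[X[X[X[X[X[X[X[X[X[X[X[X[P 8]]]]]]], X[X[X[X[X[X[X[X[X[X[X[X[X[X[X[X[X[P 8]]]], X[X[X[X[X[X[X[P 13]], P
5]]]]]]]]]]]]], P 5]]]]]]]]]]]]]) (CloseR [A,C,B,B])) (Up (Split [B,A,C,C,B,B] (CloseL [A,C,C,B,B]) (Split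
[B,A,C,C,B,A] (CloseL [A,C,C,B,A]) (Split [C,C,B,A,C,C] (CloseL [C,B,A,C,C]) (Split [C,C,B,A,C,B] (CloseL
[C,B,A,C,B]) (Up (Del [C,B,A,C,C,B,A] (X[X[X[P 4]]]) (Split [A,C,C,B,A,C,B] (CloseL [C,C,B,A,C,B]) (Split
[A,C,C,B,A,C,C] (CloseL [C,C,B,A,C,C]) (Split [B,B,A,C,C,B,A] (CloseL [B,A,C,C,B,A]) (Split [B,B,A,C,C,B,B]
(Del [A,C,B,B,A,C,C] (X[X[X[X[X[X[X[X[X[X[X[X[X[P 8]]]]], X[X[X[X[X[X[X[X[X[X[X[X[X[X[X[X[X[X[X[P 8]],
X[X[X[X[X[X[X[X[X[X[X[P 17]], X[X[X[X[P 9]]]]]]]]]]]]]]]]]]]]], X[X[X[X[P 9]]]]]]]]]]]]]]]]]]]]]) (CloseR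
[A,C,B,B,A,C])) (Up (Split [C,B,B,A,C,C,B,B] (CloseL [B,B,A,C,C,B,B]) (Split [C,B,B,A,C,C,B,A] (CloseL
[B,B,A,C,C,B,A]) (Split [B,A,C,C,B,A,C,B] (CloseL [A,C,C,B,A,C,B]) (Split [B,A,C,C,B,A,C,C] (CloseL
[A,C,C,B,A,C,C]) (Up (Split [B,B,A,C,C,B,A,C,B] (CloseL [B,A,C,C,B,A,C,B]) (Split [B,B,A,C,C,B,A,C,C] (CloseL
[B,A,C,C,B,A,C,C]) (Split [A,C,B,B,A,C,C,B,A] (Del [C,B,A,C,C,B,B,A,C]
(X[X[X[X[X[X[X[X[X[X[X[X[X[X[X[X[X[X[X[X[X[X[X[X[X[X[X[X[X[P 13]]]]], P 5]],
X[X[X[X[X[X[X[X[X[X[X[X[X[X[X[X[X[X[X[X[X[X[X[X[X[X[X[X[X[P 13]]]]], P 5]], X[X[P 22]]]]]]]]]]]]], P 5]], X[P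
9]]]]]]]]]]]]]]]]]]]]], P 5]], X[X[X[X[X[P 9]]]]]]]]]]]]]]) (CloseR [C,B,A,C,C,B,B,A])) (Split
[A,C,B,B,A,C,C,B,B] (Del [B,B,A,C,C,B,B,A,C] (X[X[X[X[P 5]]]]) (CloseR [B,B,A,C,C,B,B,A])) (Split
[C,C,B,B,A,C,C,B,A] (Dead [A,C,B,B,A,C,C,B,A] (X[X[X[X[X[X[X[X[X[X[X[P 8]]]]]]]]]]])) (Split
[C,C,B,B,A,C,C,B,B] (Up (Split [B,A,C,B,B,A,C,C,B,B] (CloseL [A,C,B,B,A,C,C,B,B]) (Split [B,A,C,B,B,A,C,C,B,A]
(CloseL [A,C,B,B,A,C,C,B,A]) (Split [C,B,B,A,C,C,B,A,C,B] (CloseL [B,B,A,C,C,B,A,C,B]) (Split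
[C,B,B,A,C,C,B,A,C,C] (CloseL [B,B,A,C,C,B,A,C,C]) (Up (Split [C,B,A,C,B,B,A,C,C,B,A] (CloseL
[B,A,C,B,B,A,C,C,B,A]) (Split [C,B,A,C,B,B,A,C,C,B,B] (CloseL [B,A,C,B,B,A,C,C,B,B]) (Split
[A,C,B,B,A,C,C,B,A,C,B] (Split [C,C,B,B,A,C,C,B,A,C,B] (CloseL [C,B,B,A,C,C,B,A,C,B]) (Match False
[A,C,B,B,A,C,C,B,A,C] [A] [A,C,C,B] [A,C,B,B] [A,C,C,B,B])) (Split [A,C,B,B,A,C,C,B,A,C,C] (Del
[B,B,A,C,C,B,B,A,C,C,B] (X[X[X[X[X[X[X[X[X[X[X[X[X[X[P 8]]]], X[X[X[X[X[X[X[X[X[X[X[X[P 13]]]]]]]]],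
X[X[X[X[X[X[X[X[X[X[X[X[X[X[X[X[X[X[X[X[X[X[X[P 8]]]], X[X[X[X[X[X[X[X[X[X[P 13]]]]]]], X[X[X[X[X[X[X[X[X[P
22,X[P 9]]]]]]]]]]]]]]]]]]]]]]], X[P 9]]]]]]]]]]]]]]]]]]]]]]]) (CloseR [B,B,A,C,C,B,B,A,C,C])) (Split
[C,C,B,B,A,C,C,B,A,C,B] (Dead [A,C,B,B,A,C,C,B,A,C,B] (X[X[X[X[X[X[X[X[X[P 8]]]]]]]]])) (Split
[C,C,B,B,A,C,C,B,A,C,C] (Match True [A,C,B,B,A,C,C,B,B,A] [A] [A,B,C,C] [A,B,B,C,C] [A,B,B,C]) (Many
[([C,B,A,C,B,B,A,C,C,B,B], [C,B,A,C,B,B,A,C,C,B,A]),([A,C,B,B,A,C,C,B,A,C,C],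
[A,C,B,B,A,C,C,B,A,C,B]),([C,C,B,B,A,C,C,B,A,C,C], [C,C,B,B,A,C,C,B,A,C,B])]))))))))))))) (Many
[([A,C,B,B,A,C,C,B,B], [A,C,B,B,A,C,C,B,A]),([B,B,A,C,C,B,A,C,C], [B,B,A,C,C,B,A,C,B]),([C,C,B,B,A,C,C,B,B],
[C,C,B,B,A,C,C,B,A])]))))))))))))))))))))))))) (Split [C,B,A,C,C] (Up (Ref 0 A C B A C B True)) (Many
[([A,C,C,B,B], [A,C,C,B,A]),([B,B,A,C,C], [B,B,A,C,B]),([C,B,A,C,C], [C,B,A,C,B])]))))))) level4_17 (grow level4_17)
Em"
    by code_simp
qed (auto simp: refuted_level5_1[OF assms])

definition level4_18 :: trie where
  "level4_18 = tries [[A,C,B,A], [A,C,B,B], [A,C,C,B], [B,A,C,B], [B,A,C,C], [B,B,A,C], [C,B,A,C], [C,B,B,A],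
[C,C,B,A]]"

lemma refuted_level4_18:
  assumes "c < mu"
  shows "refuted c level4_18"
proof (rule check_refuted[OF _ assms])
  show "check [] (Split [B,A,C,B,B] (CloseL [A,C,B,B]) (Split [B,A,C,B,A] (CloseL [A,C,B,A]) (Split
[B,B,A,C,B] (Del [B,B,A,C,C] (X[X[X[X[X[X[X[P 3]], X[X[X[X[X[X[X[X[X[X[P 3]], X[X[P 8]]]]]]], X[X[X[X[P
3,X[X[X[X[X[X[X[X[X[X[P 3]], X[X[X[X[X[X[P 8]]], X[X[X[X[P 3,X[X[X[X[X[X[P 15]]], X[X[P 7], X[P 4]]]]]]]], X[P
4]]]]]]]]]], X[X[P 7], X[P 4]]]]]]]], X[P 4]]]]]]]]]]) (CloseR [B,B,A,C])) (Split [B,B,A,C,C] (Dead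
[B,B,A,C,B] (X[X[X[X[X[P 4], X[X[X[X[X[X[X[X[P 4], X[X[P 7], X[X[X[X[X[X[X[X[X[X[X[P 4], X[X[X[X[X[X[X[X[P 4],
P 7]]]], P 3]], X[X[X[X[X[P 11], X[P 4]]]]]]]]]], X[P 3,X[X[X[X[X[P 7], X[P 4]]]]]]]], X[P 4]]]]]]]]]], P 3]],
X[X[X[X[X[X[X[X[X[X[X[P 4], X[X[X[X[X[X[X[X[P 4], P 7]]]], P 3]], X[X[X[X[X[X[X[P 11], X[P 3,X[X[X[X[X[P 7],
X[P 4]]]]]]]], X[P 4]]]]]]]]]], X[P 3,X[X[X[X[X[P 7], X[P 4]]]]]]]], X[P 4]]]]]]]]]])) (Split [C,B,A,C,B] (Del
[A,C,B,B,A] (X[X[X[X[X[P 4]]]]]) (CloseR [A,C,B,B])) (Split [C,B,A,C,C] (Del [C,C,B,A,C] (X[X[X[X[X[X[X[X[X[P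
4]], X[X[X[X[X[X[X[X[P 4], X[X[X[P 7,P 3]], X[X[X[X[X[X[X[X[X[P 4]], X[X[X[X[X[X[X[X[P 4], X[X[X[P 7,P 3]],
X[X[X[P 15]]]]]]]], P 3]], X[X[X[P 8]]]]]]]]]]]]]]]], P 3]], X[X[X[X[X[X[X[X[X[P 4]], P 8]]]]]]]]]]]]]]])
(CloseR [C,C,B,A])) (Many [([B,B,A,C,C], [B,B,A,C,B]),([B,A,C,B,B], [B,A,C,B,A]),([C,B,A,C,C],
[C,B,A,C,B])]))))))) level4_18 (grow level4_18) Em"
    by code_simp
qed simp

definition level4_19 :: trie where
  "level4_19 = tries [[A,C,B,A], [A,C,C,B], [B,A,C,B], [B,A,C,C], [B,B,A,C], [C,B,A,C], [C,B,B,A], [C,C,B,A],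
[C,C,B,B]]"

lemma refuted_level4_19:
  assumes "c < mu"
  shows "refuted c level4_19"
proof (rule check_refuted[OF _ assms])
  show "check [] (Split [A,C,C,B,B] (CloseL [C,C,B,B]) (Split [A,C,C,B,A] (CloseL [C,C,B,A]) (Split
[B,B,A,C,B] (Del [B,B,A,C,C] (X[X[X[X[X[X[X[X[P 5]]], X[X[X[X[P 3,X[X[X[X[X[X[X[X[X[X[P 5]], X[X[X[X[P
3,X[X[X[X[P 12], X[X[X[X[P 3,X[P 7]]]], X[P 4]]]]]]]], X[X[X[X[X[X[X[X[X[X[P 5]], X[X[X[X[P
3,X[X[X[X[X[X[X[X[X[X[P 5]], X[X[X[X[P 3,X[P 12]]]], X[X[X[X[X[X[X[X[X[X[P 5]], X[P 21,P 9]]]]]], P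
4]]]]]]]]], X[X[X[X[P 3,X[P 7]]]], X[P 4]]]]]]]], P 9]]]]]], P 4]]]]]]]]], X[X[X[X[P 3,X[P 7]]]], X[P
4]]]]]]]], X[X[X[X[X[X[X[X[X[X[P 5]], X[X[X[X[P 3,X[X[X[X[X[X[X[X[X[X[P 5]], X[X[X[X[P 3,X[P 12]]]],
X[X[X[X[X[X[X[X[X[X[P 5]], X[X[X[X[P 3,X[X[X[X[X[X[X[X[X[X[P 5]], X[X[X[X[P 3,X[P 12]]]], P 21]]]]]],
X[X[X[X[P 3,X[P 7]]]], X[P 4]]]]]]]], P 9]]]]]], P 4]]]]]]]]], X[X[X[X[P 3,X[P 7]]]], X[P 4]]]]]]]], X[X[X[P
9,P 4]]]]]]]]], P 4]]]]]]]]]) (CloseR [B,B,A,C])) (Split [B,B,A,C,C] (Dead [B,B,A,C,B]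
(X[X[X[X[X[X[X[X[X[X[X[X[X[X[X[P 8], X[X[X[P 4]]]]]]]]], X[P 3,X[X[X[X[X[X[X[X[X[X[X[X[X[X[X[X[X[P 8]]], X[P
3,X[X[X[X[X[X[X[X[X[P 15]]], X[P 3,X[P 7]]]], X[P 4]]]]]]]], X[X[X[P 4]]]]]]]]], X[P 3,X[P 7]]]], X[P
4]]]]]]]], X[X[X[P 4]]]]]]]]])) (Split [C,B,A,C,B] (Del [A,C,B,A,C] (X[X[X[X[X[X[X[X[X[X[X[P 5]]]],
X[X[X[X[X[X[X[X[X[X[X[X[P 5]]]], P 8]]]]]]], X[X[X[X[X[X[X[X[X[X[P 5]], X[X[X[X[X[X[X[X[X[X[X[X[P 5]]]],
X[X[X[P 8]], X[X[X[X[X[X[X[X[X[X[P 5]], X[X[X[X[X[P 17]]]], X[X[X[X[P 9], P 4]]]]]]]]], P 4]]]]]]]]]]],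
X[X[X[X[P 9], P 4]]]]]]]]], P 4]]]]]]]]]]]) (CloseR [A,C,B,A])) (Split [C,B,A,C,C] (Dead [A,C,C,B,B]
(X[X[X[X[X[X[X[X[P 5]]]]]]]])) (Many [([A,C,C,B,B], [A,C,C,B,A]),([B,B,A,C,C], [B,B,A,C,B]),([C,B,A,C,C],
[C,B,A,C,B])]))))))) level4_19 (grow level4_19) Em"
    by code_simp
qed simp

definition level3_11 :: trie where
  "level3_11 = tries [[A,C,B], [A,C,C], [B,A,C], [B,B,A], [C,B,A], [C,B,B], [C,C,B]]"

lemma refuted_level3_11:
  assumes "c < mu"
  shows "refuted c level3_11"
proof (rule check_refuted[OF _ assms])
  show "check [level4_17, level4_18, level4_19] (Split [B,A,C,B] (CloseL [A,C,B]) (Split [B,A,C,C] (CloseL [A,C,C]) (Split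
[A,C,B,A] (Split [C,C,B,A] (CloseL [C,B,A]) (Split [C,C,B,B] (Del [B,B,A,C] (X[X[X[X[X[X[P 4]],
X[X[X[X[X[X[X[X[X[X[P 4]], X[X[X[X[P 8,X[X[P 4]]]]]]]]]], X[X[P 4]]]]]]]]]]) (CloseR [B,B,A])) (Up (Ref 0 A B
C A B C False)))) (Split [C,C,B,B] (Split [A,C,B,B] (CloseL [C,B,B]) (Up (Ref 1 A B C A B C False))) (Split
[A,C,B,B] (Split [C,C,B,A] (Del [B,B,A,C] (X[X[X[X[X[X[X[X[X[P 5]]]], X[X[X[X[X[X[X[X[X[X[X[X[P 5]]]], X[X[X[P
8,X[P 3]]]]]]]]], X[P 3]]]]]]]]]) (CloseR [B,B,A])) (Up (Ref 2 A B C A B C False))) (Split [C,C,B,A] (Up (Ref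
2 A C B A C B True)) (Many [([B,A,C,C], [B,A,C,B]),([A,C,B,B], [A,C,B,A]),([C,C,B,A], [C,C,B,B])]))))))) level3_11
(grow level3_11) Em"
    by code_simp
qed (auto simp: refuted_level4_17[OF assms] refuted_level4_18[OF assms] refuted_level4_19[OF assms])

definition level2_6 :: trie where
  "level2_6 = tries [[A,C], [B,A], [B,B], [C,B], [C,C]]"

lemma refuted_level2_6:
  assumes "c < mu"
  shows "refuted c level2_6"
proof (rule check_refuted[OF _ assms])
  show "check [level3_11] (Del [B,B,B] (P 1) (Del [C,C,C] (P 1) (Split [C,B,B] (CloseL [B,B]) (Split [A,C,C]
(CloseL [C,C]) (Split [A,C,B] (Del [C,B,A] (X[X[X[X[X[X[X[X[X[X[X[P 5]], X[X[X[X[X[X[X[X[X[X[X[P 5]], X[X[P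
9]]]]]]], P 4]]]]]]]]], X[X[X[P 4]]]]]]]) (Dead [A,C,C] (X[X[X[X[X[X[X[X[X[X[P 5]]]]]]]]]]))) (Split [C,B,A]
(Dead [A,C,B] (X[X[X[X[X[X[X[P 4]]], X[X[X[X[X[X[X[X[X[P 4,X[X[X[X[X[X[X[P 9]], X[X[P 5]]]]]]]]]]], X[X[P
5]]]]]]]]]]])) (Up (Ref 0 A B C A B C False)))))))) level2_6 (grow level2_6) Em"
    by code_simp
qed (auto simp: refuted_level3_11[OF assms])

section \<open>Three letters, with BB allowed and A followed only by C\<close>

definition level4_20 :: trie where
  "level4_20 = tries [[A,C,A,C], [A,C,B,A], [A,C,B,B], [B,A,C,A], [B,A,C,B], [B,B,A,C], [C,A,C,B], [C,B,A,C],
[C,B,B,A]]"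

text \<open>No coding arises here: powers, missing extensions and the growth bound close every
  branch.\<close>

lemma refuted_level4_20:
  assumes "c < mu"
  shows "refuted c level4_20"
proof (rule check_refuted[OF _ assms])
  show "check [] (Split [B,A,C,B,A] (Del [C,B,A,C,A] (X[X[X[X[X[X[X[X[X[X[X[P 4]], X[X[X[X[X[X[X[X[X[X[X[P
4]], X[P 9]], X[X[X[X[X[P 6]], X[X[X[X[X[X[X[X[X[X[X[P 4]], X[X[X[X[X[X[X[X[X[X[X[P 4]], X[P 9]], X[X[X[X[X[P
6]], X[X[X[X[X[P 20,X[P 5]]]]]]]]]]]], X[X[X[X[P 5]]]]]]]]]], X[X[X[X[X[P 6]], X[X[P 11]]]]]]]], X[P
5]]]]]]]]]]]], X[X[X[X[P 5]]]]]]]]]], X[X[X[X[X[P 6]], X[X[X[X[X[X[X[X[X[X[X[P 4]], X[X[X[X[X[X[X[X[X[X[X[P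
4]], X[P 9]], X[X[X[X[X[P 6]], X[X[X[X[X[X[X[X[X[X[X[P 4]], X[X[X[X[X[X[P 20], X[X[X[X[P 5]]]]]]]]]],
X[X[X[X[X[P 6]], X[X[P 11]]]]]]]], X[P 5]]]]]]]]]]]], X[X[X[X[P 5]]]]]]]]]], X[X[X[X[X[P 6]], X[P 11]]]]]]],
X[P 5]]]]]]]]]]]], X[X[X[P 5]]]]]]]]) (Del [A,C,A,C,B] (X[X[X[X[X[X[X[X[P 4]], X[X[X[X[X[X[X[X[X[X[X[P 4]],
X[X[X[P 9]]]], X[X[X[X[X[P 6]]]]]]]]]]]]]], X[X[X[X[X[P 6]]]]]]]]]]) (CloseR [A,C,A,C]))) (Split [B,A,C,B,B]
(Del [B,B,A,C,B] (X[X[X[X[X[X[X[X[X[X[X[P 6]]]]], X[X[X[X[X[X[X[X[X[X[X[X[X[X[P 6]]]]], X[X[X[P 9,X[P 3]],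
X[X[X[X[X[X[X[X[X[X[X[P 6]], X[X[X[X[X[X[X[X[X[X[X[X[X[X[P 6]]]]], X[X[X[X[P 9], X[P 3]],
X[X[X[X[X[X[X[X[X[X[X[P 6]], P 20]]]]]], X[P 5]]]]]]]]]]]], X[P 3]], X[X[X[X[X[P 11]], X[P 5]]]]]]]]]]]], X[P
5]]]]]]]]]]]], X[P 3]], X[X[X[X[X[X[X[X[X[X[X[P 6]], X[X[X[X[X[X[X[X[X[X[X[X[X[X[P 6]]]]], X[X[X[X[P 9], X[P
3]], X[X[X[X[X[X[X[X[X[X[X[P 6]], X[X[X[X[X[X[X[X[P 20]]]]], X[P 3]], X[X[X[X[X[P 11]], X[P 5]]]]]]]]]]]], X[P
5]]]]]]]]]]]], X[P 3]], X[X[X[X[X[P 11]], X[P 5]]]]]]]]]]]], X[P 5]]]]]]]]]]]]) (Del [B,B,A,C,A]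
(X[X[X[X[X[X[X[X[X[X[P 6]]]], X[X[X[X[P 3]], X[X[X[X[X[X[X[X[X[X[X[P 6]], X[X[X[X[P 3]], X[X[X[X[P 11], X[P
5]]]]]]]]]]]], X[P 5]]]]]]]]]]]]) (CloseR [B,B,A,C]))) (Split [B,B,A,C,B] (Dead [B,A,C,B,B] (X[X[X[X[P 3],
X[X[X[X[X[X[X[X[X[X[P 3], X[X[X[X[X[X[P 9,X[X[X[X[X[P 6]], X[X[X[X[P 3]], X[X[X[X[X[X[X[X[X[X[P 3],
X[X[X[X[X[X[X[X[P 9]], X[X[X[X[X[P 6]], X[X[X[X[P 3]], X[X[X[X[P 20], X[P 5]]]]]]]]]]]], X[X[X[X[P 3]], X[X[P
5]]]]]]]]]], X[X[X[X[X[P 6]], X[X[X[X[P 3]], P 11]]]]]]]], X[P 5]]]]]]]]]]]], X[X[X[X[P 3]], X[X[P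
5]]]]]]]]]], X[X[X[X[X[P 6]], X[X[X[X[P 3]], X[X[X[X[X[X[X[X[X[X[P 3], X[X[X[X[X[X[X[X[P 9]], X[X[X[X[X[P 6]],
X[X[X[X[P 3]], X[X[X[X[X[X[X[X[X[X[P 3], X[X[P 20]]]]], X[X[X[X[X[P 6]], X[X[X[X[P 3]], P 11]]]]]]]], X[P
5]]]]]]]]]]]], X[X[X[X[P 3]], X[X[P 5]]]]]]]]]], X[X[X[X[X[P 6]], X[X[X[X[P 3]], P 11]]]]]]]], X[P
5]]]]]]]]]]]], X[X[X[X[P 3]], X[X[P 5]]]]]]]]]])) (Split [C,B,A,C,B] (Dead [B,A,C,B,A] (X[X[X[X[X[X[P 4]],
X[X[X[X[X[X[X[X[X[P 4]]], X[X[P 6]]]]], X[X[X[X[X[X[X[X[P 4]], X[X[X[X[X[X[X[X[X[P 4]]], X[X[P 6]]]]], X[X[P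
9,X[X[X[X[X[X[X[X[X[P 4]]], X[X[X[X[X[P 6]], X[X[X[X[X[X[X[X[P 4]], X[X[X[X[X[X[X[X[X[P 4]]], X[X[P 6]]]]],
X[X[X[X[P 9]], X[X[X[X[X[X[X[X[X[P 4]]], X[X[X[X[X[P 6]], P 20]]]]]], X[P 5]]]]]]]]]]]]], X[X[X[X[X[P 11]],
X[P 5]]]]]]]]]]]], X[P 5]]]]]]]]]]]]], X[X[X[X[X[X[X[X[X[P 4]]], X[X[X[X[X[P 6]], X[X[X[X[X[X[X[X[P 4]],
X[X[X[X[X[X[X[X[X[P 4]]], X[X[P 6]]]]], X[X[X[X[P 9]], X[X[X[X[X[X[X[X[X[P 4]]], X[X[X[X[X[P 6]],
X[X[X[X[X[X[X[X[P 4]], X[P 20]]]]], X[X[X[X[X[P 11]], X[P 5]]]]]]]]]]]], X[P 5]]]]]]]]]]]]], X[X[X[X[X[P 11]],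
X[P 5]]]]]]]]]]]], X[P 5]]]]]]]]]]]]])) (Split [B,B,A,C,A] (Split [C,B,A,C,A] (CloseL [B,A,C,A]) (Split
[C,A,C,B,A] (Del [C,A,C,B,B] (X[X[X[X[X[X[X[X[X[X[X[P 4], X[X[X[X[X[X[X[X[P 4], P 7], X[X[X[X[X[X[X[X[X[X[X[P
4], X[X[X[X[X[X[X[X[P 4], P 7], X[X[X[P 16]]]]]], P 3]]]], X[X[X[X[P 9]]]]]]], X[P 3]]]]]]]]]], P 3]]]],
X[X[X[X[X[X[X[X[X[X[X[P 4], X[X[X[X[X[X[X[X[P 4], P 7], X[X[X[X[X[X[X[X[X[X[X[P 4], X[X[X[X[P 16], P 3]]]],
X[X[X[X[P 9]]]]]]], X[P 3]]]]]]]]]], P 3]]]], P 9]]], X[P 3]]]]]]]]]], X[P 3]]]]]]]) (CloseR [C,A,C,B]))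
(Split [C,A,C,B,B] (Dead [C,A,C,B,A] (X[X[X[X[X[X[X[X[X[X[X[P 4], X[X[X[X[X[X[X[X[P 4], P 7]]]], P 3],
X[X[X[X[X[X[X[X[X[X[X[P 4], X[X[X[X[X[X[X[X[P 4], P 7]]]], P 3], X[P 12]]]]]]], X[P 3]], X[X[P 5]]]]]]]]]]]]],
X[P 3]], X[X[X[P 5]]]]]]]])) (Many [([B,A,C,B,B], [B,A,C,B,A]),([C,B,A,C,B], [C,B,A,C,A]),([C,A,C,B,B],
[C,A,C,B,A])])))) (Split [C,B,A,C,A] (Split [C,A,C,B,A] (Del [C,A,C,B,B] (X[X[X[X[X[X[X[X[X[P 4]],
X[X[X[X[X[X[X[X[P 4], X[X[X[P 7,P 3]]]], X[X[X[X[X[X[X[X[X[P 4]], X[X[X[X[X[X[X[X[P 4], X[X[X[P 7,P 3]]]],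
X[X[P 13]]]]], P 3]]]], X[X[P 6]]]]]]]]]]], P 3]]]], X[X[X[X[P 6]]]]]]]]]]) (CloseR [C,A,C,B])) (Split
[C,A,C,B,B] (Dead [C,A,C,B,A] (X[X[X[X[X[X[X[X[X[P 4]], X[X[X[X[X[X[X[X[P 4], X[X[X[P 7,P 3],
X[X[X[X[X[X[X[X[X[P 4]], X[X[X[X[X[X[X[X[P 4], X[X[X[P 7,P 3], X[X[X[P 16]]]]]]]]], P 3], X[X[X[X[P
9]]]]]]]]]]]]]]]]]]], P 3], X[X[X[X[X[X[X[X[X[P 4]], X[X[X[X[X[X[X[X[P 4], X[X[X[P 7,P 3], X[X[X[X[X[X[X[X[X[P
4]], X[X[X[X[X[X[X[X[P 4], P 16]]]], P 3], X[X[X[X[P 9]]]]]]]]]]]]]]]]]]], P 3], P 9]]]]]]]]]]]]]]]]]])) (Many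
[([B,B,A,C,B], [B,B,A,C,A]),([B,A,C,B,B], [B,A,C,B,A]),([C,A,C,B,B], [C,A,C,B,A])]))) (Many [([B,B,A,C,B],
[B,B,A,C,A]),([B,A,C,B,B], [B,A,C,B,A]),([C,B,A,C,A], [C,B,A,C,B])]))))))) level4_20 (grow level4_20) Em"
    by code_simp
qed simp

definition level3_12 :: trie where
  "level3_12 = tries [[A,C,A], [A,C,B], [B,A,C], [B,B,A], [C,A,C], [C,B,A], [C,B,B]]"

lemma refuted_level3_12:
  assumes "c < mu"
  shows "refuted c level3_12"
proof (rule check_refuted[OF _ assms])
  show "check [level4_20] (Del [C,A,C,A] (X[P 2]) (Split [B,A,C,A] (CloseL [A,C,A]) (Split [A,C,B,B] (CloseL
[C,B,B]) (Split [A,C,B,A] (CloseL [C,B,A]) (Split [B,A,C,B] (Del [B,B,A,C] (X[X[X[X[X[X[X[X[X[X[X[P 6]]]]],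
X[X[X[X[X[X[X[X[X[X[X[X[X[P 6]], X[X[X[X[X[X[X[P 11]], X[P 5]]]]]]]]]]]], X[P 5]]]]]]]]]]]]) (CloseR [B,B,A]))
(Up (Ref 0 A B C A B C False))))))) level3_12 (grow level3_12) Em"
    by code_simp
qed (auto simp: refuted_level4_20[OF assms])

definition level2_7 :: trie where
  "level2_7 = tries [[A,C], [B,A], [B,B], [C,A], [C,B]]"

lemma refuted_level2_7:
  assumes "c < mu"
  shows "refuted c level2_7"
proof (rule check_refuted[OF _ assms])
  show "check [level3_12] (Del [B,B,B] (P 1) (Split [A,C,A] (CloseL [C,A]) (Split [A,C,B] (CloseL [C,B]) (Split
[C,B,B] (CloseL [B,B]) (Split [C,B,A] (Del [B,A,C] (X[X[X[X[X[X[X[P 4]]], X[X[X[X[X[X[X[X[X[P 4]]], X[X[P 6,P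
2]]]]]], P 2]]]]]]) (CloseR [B,A])) (Up (Ref 0 A B C A B C False))))))) level2_7 (grow level2_7) Em"
    by code_simp
qed (auto simp: refuted_level3_12[OF assms])

section \<open>Combining the cases\<close>

definition level1_2 :: trie where
  "level1_2 = tries [[A], [B], [C]]"

text \<open>Three letters admit at most five two-letter words. The six sets left for further study,
  up to renaming and reversal, all have exactly five.\<close>

lemma refuted_level1_2:
  assumes "c < mu"
  shows "refuted c level1_2"
proof (rule check_refuted[OF _ assms])
  show "check [level2_2, level2_3, level2_4, level2_5, level2_6, level2_7] (Split [A,A] (Split [A,B] (Split [C,B] (Del [B,A] (X[X[P
1]]) (Del [B,B] (X[P 1]) (CloseL [B]))) (Split [B,A] (Split [C,A] (CloseL [A]) (Split [B,C] (Del [A,C]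
(X[X[X[P 2], X[X[X[X[P 2], X[P 3,P 1]]], P 1]]]) (CloseR [A])) (Split [B,B] (Split [C,C] (Del [A,C] (X[X[X[P
2], X[X[X[X[X[P 2], X[X[P 4,X[P 2]]]]], X[P 2]]]]]) (CloseR [A])) (Up (Ref 0 A B C A B C False))) (Split [C,C]
(Up (Ref 1 A B C A B C False)) (Many [([C,B], [C,A]),([B,C], [B,B]),([C,C], [C,A])]))))) (Split [B,B] (Split
[B,C] (Split [C,A] (Del [C,C] (X[X[X[X[X[X[X[P 3,X[X[X[X[X[X[X[P 3,X[X[P 7], P 1]]]], X[P 4,P 1]]]], P 1]]]],
X[X[X[X[X[X[X[P 3,X[X[X[X[X[X[P 7]], X[P 4,P 1]]]], P 1]]]], P 4]]], P 1]]]], P 1]) (Del [A,C] (X[X[X[X[X[X[P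
3]]]]]]) (CloseR [A]))) (Split [C,C] (Dead [C,A] (X[X[X[X[X[X[X[P 3]], X[X[X[X[X[X[X[P 3]], X[P 5]]]], P
2]]]]], X[P 2]]])) (Up (Ref 2 A B C A B C False)))) (Split [C,A] (Split [C,C] (Dead [B,C] (X[X[X[X[X[X[X[P
3]], X[X[X[X[X[X[X[P 3]], X[P 5]]]], P 2]]]]], X[P 2]]])) (Up (Ref 2 B A C B A C True))) (Split [C,C] (Up (Ref
3 A B C A B C False)) (Many [([C,B], [C,A]),([B,C], [B,A]),([C,C], [C,A])])))) (Split [B,C] (Split [C,A]
(Split [C,C] (Dead [B,B] (X[P 1,X[X[X[X[P 1,X[X[X[P 4,X[X[X[X[P 1,X[X[X[X[P 1,P 4], X[X[P 7]]]]]], P 3]]]]]]],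
X[X[X[X[P 1,X[X[X[X[P 1,P 4], X[X[X[X[P 1,X[P 7]], P 3]]]]]]], P 3]]]]]]])) (Up (Ref 4 A B C A B C False)))
(Split [C,C] (Up (Ref 5 A B C A B C False)) (Many [([B,B], [B,A]),([C,B], [C,A]),([C,C], [C,A])]))) (Split
[C,C] (Split [C,A] (Up (Ref 2 B C A C A B False)) (Many [([B,B], [B,A]),([B,C], [B,A]),([C,A], [C,B])])) (Many
[([B,B], [B,A]),([B,C], [B,A]),([C,C], [C,B])])))))) (Split [B,A] (Split [C,A] (CloseL [A]) (Split [B,C] (Del
[A,C] (X[X[X[P 2], X[X[X[X[P 2], X[P 3,P 1]]], P 1]]]) (Dead [A,B] (X[X[X[P 1]]]))) (Split [A,C] (Split [B,B]
(Split [C,B] (Del [C,C] (X[X[X[X[X[X[X[P 3,X[X[X[X[X[X[X[P 3,X[X[P 7], P 1]]]], X[P 4,P 1]]]], P 1]]]],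
X[X[X[X[X[X[X[P 3,X[X[X[X[X[X[P 7]], X[P 4,P 1]]]], P 1]]]], P 4]]], P 1]]]], P 1]) (Dead [A,B] (X[X[X[X[X[X[P
3]]]]]]))) (Split [C,C] (Dead [C,B] (X[X[X[X[X[X[X[P 3]], X[X[X[X[X[X[X[P 3]], X[P 5]]]], P 2]]]]], X[P 2]]]))
(Up (Ref 2 B A C B A C False)))) (Split [C,B] (Split [C,C] (Dead [B,B] (X[X[X[X[X[X[X[P 3,X[X[X[X[X[X[X[P
3,X[X[P 7], P 1]]]], X[P 4,P 1]]]], P 1]]]], X[X[X[X[X[X[X[P 3,X[X[X[X[X[X[P 7]], X[P 4,P 1]]]], P 1]]]], P
4]]], P 1]]]], P 1])) (Up (Ref 4 A B C A B C True))) (Split [C,C] (Up (Ref 2 B C A C A B True)) (Many [([C,B],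
[C,A]),([B,C], [B,B]),([C,C], [C,A])])))) (Split [B,B] (Split [C,B] (Split [C,C] (Dead [A,C] (X[X[X[P 2],
X[X[X[X[X[P 2,X[X[X[X[P 5], X[X[P 3]]]]]]], X[X[P 3]]]]]]])) (Up (Ref 2 A B C A B C True))) (Split [C,C] (Up
(Ref 3 A B C A B C True)) (Many [([C,B], [C,A]),([A,C], [A,B]),([C,C], [C,A])]))) (Split [C,C] (Split [C,B]
(Up (Ref 5 A B C A B C True)) (Many [([B,C], [B,B]),([A,C], [A,B]),([C,B], [C,A])])) (Many [([B,C],
[B,B]),([A,C], [A,B]),([C,C], [C,A])])))))) (Split [A,C] (Split [B,C] (Del [C,A] (X[X[P 1]]) (Del [C,B] (X[X[P
1]]) (Del [C,C] (X[P 1]) (CloseR [C])))) (Split [B,B] (Split [C,A] (Split [C,B] (Dead [A,B] (X[X[X[P 2]]]))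
(Split [C,C] (Dead [A,B] (X[X[X[P 2], X[X[X[X[X[P 2], X[X[P 4,X[P 2]]]]], X[P 2]]]]])) (Up (Ref 1 A C B A C B
False)))) (Split [C,B] (Split [C,C] (Dead [B,A] (X[X[X[P 2], X[X[X[X[X[P 2,X[X[X[X[P 5], X[X[P 3]]]]]]], X[X[P
3]]]]]]])) (Up (Ref 5 A C B A C B False))) (Split [C,C] (Up (Ref 3 A C B A C B False)) (Many [([C,B],
[C,A]),([B,C], [B,A]),([C,C], [C,A])])))) (Split [C,C] (Split [C,A] (Up (Ref 0 A C B A C B False)) (Split
[C,B] (Up (Ref 2 A C B A C B False)) (Many [([B,B], [B,A]),([B,C], [B,A]),([C,B], [C,A])]))) (Split [C,A]
(Split [C,B] (Dead [A,B] (X[X[X[P 2], X[X[X[X[P 2], X[P 3,P 1]]], P 1]]])) (Many [([B,B], [B,A]),([B,C],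
[B,A]),([C,B], [C,C])])) (Many [([B,B], [B,A]),([B,C], [B,A]),([C,A], [C,C])]))))) (Split [B,B] (Split [B,C]
(Split [C,A] (Split [C,B] (Dead [A,B] (X[X[X[P 2]]])) (Split [C,C] (Dead [A,B] (X[X[X[P 2], X[X[X[X[X[P
2,X[X[X[X[P 5], X[X[P 3]]]]]]], X[X[P 3]]]]]]])) (Up (Ref 5 A C B A C B True)))) (Split [C,B] (Split [C,C]
(Dead [B,A] (X[X[X[P 2], X[X[X[X[X[P 2], X[X[P 4,X[P 2]]]]], X[P 2]]]]])) (Up (Ref 1 C A B B C A False)))
(Split [C,C] (Up (Ref 3 C A B B C A False)) (Many [([C,B], [C,A]),([A,C], [A,B]),([C,C], [C,A])])))) (Split
[C,C] (Split [C,A] (Up (Ref 3 A C B A C B True)) (Split [C,B] (Up (Ref 3 C A B B C A True)) (Many [([A,C],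
[A,B]),([B,C], [B,A]),([C,B], [C,A])]))) (Split [C,A] (Split [C,B] (Dead [A,B] (X[X[X[P 2]]])) (Many [([B,C],
[B,A]),([A,C], [A,B]),([C,B], [C,C])])) (Many [([B,C], [B,A]),([A,C], [A,B]),([C,A], [C,C])])))) (Split [B,C]
(Split [C,C] (Split [C,A] (Up (Ref 2 A C B A C B True)) (Split [C,B] (Up (Ref 1 C B A C B A False)) (Many
[([B,B], [B,A]),([A,C], [A,B]),([C,B], [C,A])]))) (Split [C,A] (Split [C,B] (Dead [A,B] (X[X[X[P 2], X[X[X[X[P
2], X[P 3,P 1]]], P 1]]])) (Many [([B,B], [B,A]),([A,C], [A,B]),([C,B], [C,C])])) (Many [([B,B],
[B,A]),([A,C], [A,B]),([C,A], [C,C])]))) (Many [([A,C], [A,B]),([B,B], [B,A]),([B,C], [B,A])])))))) (Split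
[A,B] (Split [C,B] (Del [B,A] (X[X[P 1]]) (Del [B,B] (X[P 1]) (CloseL [B]))) (Split [A,C] (Split [B,B] (Del
[B,C] (X[X[X[P 2], X[X[X[X[P 2], X[P 3,P 1]]], P 1]]]) (Del [B,A] (X[X[X[P 1]]]) (CloseR [B]))) (Split [B,C]
(Del [C,A] (X[X[P 1]]) (Dead [C,B] (X[X[P 1]]))) (Split [C,C] (Dead [B,B] (X[P 1,X[X[X[P 1,X[X[P 3,X[P 2]]]],
X[P 2]]]])) (Split [B,A] (Split [C,A] (Dead [A,A] (X[P 1])) (Many [([B,C], [B,B]),([C,C], [C,B]),([C,A],
[C,B])])) (Many [([B,C], [B,B]),([C,C], [C,B]),([B,A], [B,B])]))))) (Split [C,A] (Split [B,A] (Dead [A,A] (X[P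
1])) (Split [B,B] (Split [B,C] (Split [C,C] (Dead [A,A] (X[P 1,X[X[X[X[P 1,X[X[X[P 4,X[X[X[X[P 1,X[X[X[X[P 1,P
4], X[X[P 7]]]]]], P 3]]]]]]], X[X[X[X[P 1,X[X[X[X[P 1,P 4], X[X[X[X[P 1,X[P 7]], P 3]]]]]]], P 3]]]]]]])) (Up
(Ref 4 B A C B A C True))) (Split [C,C] (Up (Ref 5 B A C B A C True)) (Many [([A,C], [A,A]),([B,C],
[B,A]),([C,C], [C,B])]))) (Split [B,C] (Split [C,C] (Up (Ref 4 B C A C A B False)) (Many [([B,B],
[B,A]),([A,C], [A,A]),([C,C], [C,B])])) (Many [([B,B], [B,A]),([A,C], [A,A]),([B,C], [B,A])])))) (Split [C,C]
(Split [B,B] (Split [B,A] (Up (Ref 1 B A C B A C False)) (Split [B,C] (Up (Ref 2 C B A C B A True)) (Many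
[([A,C], [A,A]),([C,B], [C,A]),([B,C], [B,A])]))) (Split [B,A] (Split [B,C] (Dead [A,A] (X[P 1,X[X[X[P 1,X[X[P
3,X[P 2]]]], X[P 2]]]])) (Many [([A,C], [A,A]),([C,B], [C,A]),([B,C], [B,B])])) (Many [([A,C], [A,A]),([C,B],
[C,A]),([B,A], [B,B])]))) (Many [([A,C], [A,A]),([C,B], [C,A]),([C,C], [C,A])]))))) (Split [A,C] (Split [B,C]
(Del [C,A] (X[X[P 1]]) (Del [C,B] (X[X[P 1]]) (Del [C,C] (X[P 1]) (CloseR [C])))) (Split [B,A] (Split [C,A]
(Dead [A,A] (X[P 1])) (Split [B,B] (Split [C,B] (Split [C,C] (Dead [A,A] (X[P 1,X[X[X[X[P 1,X[X[X[P
4,X[X[X[X[P 1,X[X[X[X[P 1,P 4], X[X[P 7]]]]]], P 3]]]]]]], X[X[X[X[P 1,X[X[X[X[P 1,P 4], X[X[X[X[P 1,X[P 7]],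
P 3]]]]]]], P 3]]]]]]])) (Up (Ref 4 B A C B A C False))) (Split [C,C] (Up (Ref 5 B A C B A C False)) (Many
[([A,B], [A,A]),([C,B], [C,A]),([C,C], [C,A])]))) (Split [C,C] (Split [C,B] (Up (Ref 4 B C A C A B True))
(Many [([B,C], [B,B]),([A,B], [A,A]),([C,B], [C,A])])) (Many [([B,C], [B,B]),([A,B], [A,A]),([C,C],
[C,A])])))) (Split [B,B] (Split [C,C] (Split [C,A] (Up (Ref 1 B C A C A B False)) (Split [C,B] (Up (Ref 2 C A
B B C A True)) (Many [([A,B], [A,A]),([B,C], [B,A]),([C,B], [C,A])]))) (Split [C,A] (Split [C,B] (Dead [A,A]
(X[P 1,X[X[X[P 1,X[X[P 3,X[P 2]]]], X[P 2]]]])) (Many [([B,C], [B,A]),([A,B], [A,A]),([C,B], [C,C])])) (Many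
[([B,C], [B,A]),([A,B], [A,A]),([C,A], [C,C])]))) (Many [([A,B], [A,A]),([B,C], [B,A]),([B,B], [B,A])]))))
(Split [B,A] (Split [C,A] (Dead [A,A] (X[P 1])) (Split [C,C] (Split [C,B] (Split [B,B] (Up (Ref 2 C B A C B A
False)) (Split [B,C] (Dead [A,A] (X[P 1,X[X[X[P 1,X[X[P 3,X[P 2]]]], X[P 2]]]])) (Many [([A,B], [A,A]),([A,C],
[A,A]),([B,C], [B,B])]))) (Many [([A,B], [A,A]),([A,C], [A,A]),([C,B], [C,A])])) (Many [([A,B], [A,A]),([A,C],
[A,A]),([C,C], [C,A])]))) (Split [B,C] (Split [B,B] (Split [C,C] (Split [C,A] (Up (Ref 2 C A B B C A False))
(Split [C,B] (Up (Ref 0 C A B B C A False)) (Many [([A,B], [A,A]),([A,C], [A,A]),([C,B], [C,A])]))) (Split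
[C,A] (Split [C,B] (Dead [A,A] (X[P 1,X[X[X[P 1,X[X[P 3,X[P 2]]]], X[P 2]]]])) (Many [([A,B], [A,A]),([A,C],
[A,A]),([C,B], [C,C])])) (Many [([A,B], [A,A]),([A,C], [A,A]),([C,A], [C,C])]))) (Many [([A,B], [A,A]),([A,C],
[A,A]),([B,B], [B,A])])) (Many [([A,B], [A,A]),([A,C], [A,A]),([B,C], [B,A])])))))) level1_2 (grow level1_2) Em"
    by code_simp
qed (auto simp: refuted_level2_2[OF assms] refuted_level2_3[OF assms] refuted_level2_4[OF assms] refuted_level2_5[OF assms] refuted_level2_6[OF assms] refuted_level2_7[OF assms])

text \<open>\<open>Lf\<close> contains just the empty word and so imposes nothing on a language. A
  single letter gives cubes, two letters lead to \<open>level1_1\<close> up to renaming, and three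
  to \<open>level1_2\<close>.\<close>

lemma refuted_Lf:
  assumes "c < mu"
  shows "refuted c Lf"
proof (rule check_refuted[OF _ assms])
  show "check [level1_1, level1_2] (Split [A] (Split [B] (Del [C] (X[X[P 1]]) (CloseR [])) (Split [C] (Dead [B] (X[X[P
1]])) (Up (Ref 0 A B C A B C False)))) (Split [B] (Split [C] (Dead [A] (X[X[P 1]])) (Up (Ref 0 B A C B A C
False))) (Split [C] (Up (Ref 0 B C A C A B False)) (Up (Ref 1 A B C A B C False))))) Lf (grow Lf) Em"
    by code_simp
qed (auto simp: refuted_level1_1[OF assms] refuted_level1_2[OF assms])

section \<open>Recurrent factors\<close>

definition occurs :: "'a word \<Rightarrow> 'a list \<Rightarrow> nat \<Rightarrow> bool" where
  "occurs w x i \<longleftrightarrow> w [i \<rightarrow> i + length x] = x"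

lemma occurs_iff_nth: "occurs w x i \<longleftrightarrow> (\<forall>j<length x. w (i + j) = x ! j)"
  unfolding occurs_def list_eq_iff_nth_eq by (simp add: subsequence_def)

lemma occurs_append: "occurs w (x @ y) i \<longleftrightarrow> occurs w x i \<and> occurs w y (i + length x)"
  unfolding occurs_iff_nth
proof (intro iffI conjI allI impI)
  assume *: "\<forall>j<length (x @ y). w (i + j) = (x @ y) ! j"
  fix j
  show "w (i + j) = x ! j" if "j < length x"
    using * that by (metis length_append nth_append trans_less_add1)
  show "w (i + length x + j) = y ! j" if "j < length y"
    using *[rule_format, of "length x + j"] that by (simp add: add.assoc)
next
  assume *: "(\<forall>j<length x. w (i + j) = x ! j) \<and> (\<forall>j<length y. w (i + length x + j) = y ! j)"
  fix j assume "j < length (x @ y)"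
  then show "w (i + j) = (x @ y) ! j"
    using * by (cases "j < length x") (auto simp: nth_append dest!: spec[of _ "j - length x"])
qed

lemma occurs_single: "occurs w [l] i \<longleftrightarrow> w i = l"
  by (simp add: occurs_iff_nth)

lemma factors_iff_occurs: "x \<in> factors w \<longleftrightarrow> (\<exists>i. occurs w x i)"
proof
  assume "x \<in> factors w"
  then obtain i j where "x = w [i \<rightarrow> j]" "i \<le> j"
    by (auto simp: factors_def)
  then have "occurs w x i"
    by (simp add: occurs_def)
  then show "\<exists>i. occurs w x i" ..
next
  assume "\<exists>i. occurs w x i"
  then show "x \<in> factors w"
    unfolding factors_def occurs_def by (metis (mono_tags, lifting) le_add1 mem_Collect_eq)
qed

text \<open>The set of all factors may fail to extend to the left, since a prefix of the word may
  occur only once.\<close>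

definition recurrent :: "letter word \<Rightarrow> letter list set" where
  "recurrent w = {x. \<forall>N. \<exists>i\<ge>N. occurs w x i}"

lemma recurrent_factor: "x \<in> recurrent w \<Longrightarrow> x \<in> factors w"
  unfolding recurrent_def factors_iff_occurs by blast

text \<open>The alphabet is finite: if each one-letter extension of \<open>x\<close> ceased to occur
  from some position on, occurrences of \<open>x\<close> beyond all these positions would have no
  neighbouring letter.\<close>

lemma lang_recurrent: "lang (recurrent w)"
proof -
  have "[] \<in> recurrent w"
    by (auto simp: recurrent_def occurs_iff_nth)
  moreover have "y \<in> recurrent w" if x: "x \<in> recurrent w" "sublist y x" for x y
    unfolding recurrent_def
  proof (intro CollectI allI)
    fix N
    obtain p s where "x = p @ y @ s"
      using x(2) by (auto simp: sublist_def)
    moreover obtain i where "i \<ge> N" "occurs w x i"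
      using x(1) by (auto simp: recurrent_def)
    ultimately show "\<exists>i\<ge>N. occurs w y i"
      by (intro exI[of _ "i + length p"]) (auto simp: occurs_append)
  qed
  moreover have "\<exists>l. x @ [l] \<in> recurrent w" if x: "x \<in> recurrent w" for x
  proof (rule ccontr)
    assume "\<nexists>l. x @ [l] \<in> recurrent w"
    then have "\<forall>l. \<exists>N. \<forall>i\<ge>N. \<not> occurs w (x @ [l]) i"
      by (auto simp: recurrent_def)
    then obtain N where N: "\<And>l i. i \<ge> N l \<Longrightarrow> \<not> occurs w (x @ [l]) i"
      by metis
    obtain i where i: "i \<ge> Max (range N)" "occurs w x i"
      using x unfolding recurrent_def by blast
    have "N (w (i + length x)) \<le> i"
      using i(1) by (meson Max_ge finite finite_imageI order_trans rangeI)
    then show False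
      using N[of "w (i + length x)" i] i(2) by (simp add: occurs_append occurs_single)
  qed
  moreover have "\<exists>l. l # x \<in> recurrent w" if x: "x \<in> recurrent w" for x
  proof (rule ccontr)
    assume "\<nexists>l. l # x \<in> recurrent w"
    then have "\<forall>l. \<exists>N. \<forall>i\<ge>N. \<not> occurs w ([l] @ x) i"
      by (auto simp: recurrent_def)
    then obtain N where N: "\<And>l i. i \<ge> N l \<Longrightarrow> \<not> occurs w ([l] @ x) i"
      by metis
    \<comment> \<open>The successor leaves room for the preceding position, which must itself lie
      beyond all bounds.\<close>
    obtain i where i: "i \<ge> Suc (Max (range N))" "occurs w x i"
      using x unfolding recurrent_def by blast
    then obtain j where j: "i = Suc j" "j \<ge> Max (range N)"
      by (cases i) auto
    have "N (w j) \<le> j"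
      using j(2) by (meson Max_ge finite finite_imageI order_trans rangeI)
    then show False
      using N[of "w j" j] i(2) j(1) by (simp only: occurs_append) (simp add: occurs_single)
  qed
  ultimately show ?thesis
    by (auto simp: lang_def)
qed

text \<open>A factor occurring only finitely often has an extension with the same property, and
  distinct factors of one length have distinct extensions. So the number of such factors never
  decreases, and the recurrent ones gain at most the two words gained in total.\<close>

lemma thin_recurrent:
  assumes "\<And>n. factor_complexity w n = 2 * n + 1"
  shows "thin (recurrent w)"
  unfolding thin_def
proof
  fix n
  define F where "F n = {x \<in> factors w. length x = n}" for n
  define R where "R n = {x \<in> recurrent w. length x = n}" for n
  have fin: "finite (F n)" "R n \<subseteq> F n" for n
    using finite_words recurrent_factor by (auto simp: F_def R_def)
  then have finR: "finite (R n)" for n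
    using finite_subset by blast
  have "F n - R n \<subseteq> butlast ` (F (Suc n) - R (Suc n))"
  proof
    fix x assume x: "x \<in> F n - R n"
    then obtain i where i: "occurs w x i"
      by (auto simp: F_def factors_iff_occurs)
    define y where "y = x @ [w (i + n)]"
    have "occurs w y i"
      using i x by (auto simp: y_def occurs_append occurs_single F_def)
    moreover have "y \<notin> recurrent w"
      using x lang_sublist[OF lang_recurrent, of y w x] by (auto simp: y_def F_def R_def)
    ultimately have "y \<in> F (Suc n) - R (Suc n)"
      using x by (auto simp: F_def R_def factors_iff_occurs y_def)
    moreover have "x = butlast y"
      by (simp add: y_def)
    ultimately show "x \<in> butlast ` (F (Suc n) - R (Suc n))"
      by blast
  qed
  then have "card (F n - R n) \<le> card (F (Suc n) - R (Suc n))"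
    using fin by (meson finite_Diff surj_card_le)
  then have "card (F n) - card (R n) \<le> card (F (Suc n)) - card (R (Suc n))"
    using fin finR by (simp add: card_Diff_subset)
  moreover have "card (R n) \<le> card (F n)" "card (R (Suc n)) \<le> card (F (Suc n))"
    by (rule card_mono[OF fin])+
  moreover have "card (F n) = 2 * n + 1" "card (F (Suc n)) = 2 * Suc n + 1"
    using assms by (auto simp: factor_complexity_def F_def)
  ultimately show "card {x \<in> recurrent w. length x = Suc n} \<le> card {x \<in> recurrent w. length x = n} + 2"
    by (simp add: R_def)
qed

lemma factors_comp: "factors (f \<circ> w) = map f ` factors w"
proof -
  have *: "(f \<circ> w) [i \<rightarrow> j] = map f (w [i \<rightarrow> j])" for i j
    by (simp add: subsequence_def)
  show ?thesis
    unfolding factors_def * by blast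
qed

theorem mainTheorem1:
  fixes w :: "nat word"
  assumes "range w \<subseteq> {0, 1, 2}"
    and "\<And>n. factor_complexity w n = 2 * n + 1"
  shows "critical_exponent w \<ge> ereal mu"
proof (rule ccontr)
  assume "\<not> critical_exponent w \<ge> ereal mu"
  then have less: "critical_exponent w < ereal mu"
    by simp
  \<comment> \<open>The growth argument contradicts a uniform real bound strictly below
    \<open>mu\<close>, which an intermediate value provides.\<close>
  then obtain c where c: "critical_exponent w < ereal c" "c < mu"
    using ereal_dense2 by fastforce
  define f :: "nat \<Rightarrow> letter" where "f n = (if n = 0 then A else if n = 1 then B else C)" for n
  have inj: "inj_on f {0, 1, 2}"
    by (auto simp: f_def inj_on_def)
  have sub: "set x \<subseteq> {0, 1, 2}" if "x \<in> factors w" for x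
  proof -
    have "set x \<subseteq> range w"
      using that by (auto simp: factors_def subsequence_def)
    then show ?thesis
      using assms(1) by (rule subset_trans)
  qed
  have inj_map: "inj_on (map f) (factors w)"
    using map_inj_on[of f] sub inj by (intro inj_onI) (metis Un_least inj_on_subset)
  have "factor_complexity (f \<circ> w) n = 2 * n + 1" for n
  proof -
    have "{x \<in> factors (f \<circ> w). length x = n} = map f ` {x \<in> factors w. length x = n}"
      by (auto simp: factors_comp)
    moreover have "inj_on (map f) {x \<in> factors w. length x = n}"
      using inj_map by (rule inj_on_subset) auto
    ultimately show ?thesis
      using assms(2)[of n] by (simp add: factor_complexity_def card_image)
  qed
  then have "thin (recurrent (f \<circ> w))"
    by (rule thin_recurrent)
  moreover have "low c (recurrent (f \<circ> w))"
    unfolding low_def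
  proof (intro ballI allI impI)
    fix x p assume x: "x \<in> recurrent (f \<circ> w)" "is_period p x"
    then obtain y where y: "y \<in> factors w" "x = map f y"
      using recurrent_factor factors_comp by blast
    have p: "is_period p y"
      using is_period_map[of f y p] inj_on_subset[OF inj sub[OF y(1)]] x(2) y(2) by blast
    then have ne: "y \<noteq> []"
      by (auto simp: is_period_def)
    \<comment> \<open>\<open>exponent\<close> refers to the smallest period q, \<open>low\<close> to
      an arbitrary period p. Passing from c q to c p requires c > 0, which follows since c q exceeds
      a length.\<close>
    define q where "q = smallest_period y"
    have "q \<le> p"
      unfolding q_def smallest_period_def using p by (rule Least_le)
    have "0 < q"
      using smallest_period_is_period[OF ne] by (simp add: q_def is_period_def)
    have "ereal (exponent y) \<le> critical_exponent w"
      unfolding critical_exponent_def using y(1) ne by (intro SUP_upper) auto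
    then have "ereal (exponent y) < ereal c"
      using c(1) by (rule order_le_less_trans)
    then have *: "real (length y) < c * real q"
      using \<open>0 < q\<close> by (simp add: exponent_def q_def field_simps)
    then have "0 < c * real q"
      using of_nat_0_le_iff[of "length y"] by linarith
    then have "0 < c"
      using \<open>0 < q\<close> by (simp add: zero_less_mult_iff)
    then have "c * real q \<le> c * real p"
      using \<open>q \<le> p\<close> by simp
    then show "real (length x) \<le> c * real p"
      using * y(2) by simp
  qed
  ultimately have "admissible c (recurrent (f \<circ> w))"
    using lang_recurrent by (simp add: admissible_def)
  moreover have "lb (recurrent (f \<circ> w)) Lf"
    using lang_Nil[OF lang_recurrent] by (auto simp: lb_def mem_words)
  moreover have "ub (recurrent (f \<circ> w)) Lf"
    by (simp add: ub_def)
  ultimately show False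
    using refuted_Lf[OF c(2)] by (auto simp: refuted_def)
qed

end
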